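(* Let $0<p\le\infty$, $0<\alpha<\infty$, and let $g\in\mathcal{B}\setminus\mathcal{B}_0$. Then the integral operator $T_g:H(p,0,\alpha)\to H(p,0,\alpha)$ fixes a copy of $c_0$, and the operator $T_g:H(p,\infty,\alpha)\to H(p,\infty,\alpha)$ fixes a copy of $\ell_\infty$. Consequently, $T_g(H(p,\infty,\alpha))$ is non-separable.
   Context: $T_g(f)(z)=\int_0^z f(\zeta)g'(\zeta)\,d\zeta$. For $f$ analytic on the unit disk $\mathbb{D}$, $M_p(r,f)=\left(\int_0^{2\pi}|f(re^{i\theta})|^p\frac{d\theta}{2\pi}\right)^{1/p}$ ($p<\infty$), $M_\infty(r,f)=\max_\theta|f(re^{i\theta})|$. $H(p,\infty,\alpha)$ is the space of analytic $f$ with $\|f\|_{p,\infty,\alpha}=\sup_{0\le r<1}(1-r)^\alpha M_p(r,f)<\infty$, and $H(p,0,\alpha)$ is its subspace where $\lim_{r\to1^-}(1-r)^\alpha M_p(r,f)=0$. $\mathcal{B}$ is the Bloch space ($\sup_z(1-|z|^2)|f'(z)|<\infty$) and $\mathcal{B}_0$ the little Bloch space ($(1-|z|^2)|f'(z)|\to0$ as $|z|\to1$). An operator $T:Z\to W$ fixes a copy of a space $Y$ if there is a closed subspace $Z_0\subseteq Z$ isomorphic to $Y$ such that $T|_{Z_0}$ is an isomorphism onto its image (i.e. $\|Tz\|\ge c\|z\|$ for some $c>0$ and all $z\in Z_0$). *)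

theory Defs
  imports "HOL-Complex_Analysis.Complex_Analysis"
begin

definition Mp :: "ereal \<Rightarrow> real \<Rightarrow> (complex \<Rightarrow> complex) \<Rightarrow> real" where
  "Mp p r f =
     (if p = \<infinity> then (SUP t\<in>{0..2*pi}. cmod (f (of_real r * cis t)))
      else (integral {0..2*pi} (\<lambda>t. cmod (f (of_real r * cis t)) powr real_of_ereal p) / (2*pi))
             powr (1 / real_of_ereal p))"

definition Hnorm :: "ereal \<Rightarrow> real \<Rightarrow> (complex \<Rightarrow> complex) \<Rightarrow> real" where
  "Hnorm p \<alpha> f = (SUP r\<in>{0..<1}. (1 - r) powr \<alpha> * Mp p r f)"

definition Hinf :: "ereal \<Rightarrow> real \<Rightarrow> (complex \<Rightarrow> complex) set" where
  "Hinf p \<alpha> = {f. f holomorphic_on ball 0 1 \<and>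
                  bdd_above ((\<lambda>r. (1 - r) powr \<alpha> * Mp p r f) ` {0..<1})}"

definition H0 :: "ereal \<Rightarrow> real \<Rightarrow> (complex \<Rightarrow> complex) set" where
  "H0 p \<alpha> = {f \<in> Hinf p \<alpha>. ((\<lambda>r. (1 - r) powr \<alpha> * Mp p r f) \<longlongrightarrow> 0) (at_left 1)}"

definition Bloch :: "(complex \<Rightarrow> complex) set" where
  "Bloch = {g. g holomorphic_on ball 0 1 \<and>
               bdd_above ((\<lambda>z. (1 - (cmod z)\<^sup>2) * cmod (deriv g z)) ` ball 0 1)}"

definition little_Bloch :: "(complex \<Rightarrow> complex) set" where
  "little_Bloch = {g \<in> Bloch. \<forall>e>0. \<exists>\<delta><1. \<forall>z. \<delta> < cmod z \<and> cmod z < 1 \<longrightarrow>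
                      (1 - (cmod z)\<^sup>2) * cmod (deriv g z) < e}"

definition Tg :: "(complex \<Rightarrow> complex) \<Rightarrow> (complex \<Rightarrow> complex) \<Rightarrow> (complex \<Rightarrow> complex)" where
  "Tg g f = (\<lambda>z. contour_integral (linepath 0 z) (\<lambda>\<zeta>. f \<zeta> * deriv g \<zeta>))"

definition c0 :: "(nat \<Rightarrow> complex) set" where
  "c0 = {x. x \<longlonglongrightarrow> 0}"

definition linf :: "(nat \<Rightarrow> complex) set" where
  "linf = {x. bounded (range x)}"

definition supnorm :: "(nat \<Rightarrow> complex) \<Rightarrow> real" where
  "supnorm x = (SUP n. cmod (x n))"

text \<open>T : Z \<rightarrow> Z fixes a copy of the sequence space Y: there is a linear isomorphic embedding
  J of Y into Z (whose range is then a closed subspace isomorphic to Y, Y being complete)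
  such that T restricted to the range of J is bounded below.\<close>
definition fixes_copy ::
  "(nat \<Rightarrow> complex) set \<Rightarrow> (complex \<Rightarrow> complex) set \<Rightarrow> ((complex \<Rightarrow> complex) \<Rightarrow> real) \<Rightarrow>
   ((complex \<Rightarrow> complex) \<Rightarrow> (complex \<Rightarrow> complex)) \<Rightarrow> bool" where
  "fixes_copy Y Z nZ T \<longleftrightarrow>
     (\<exists>J a b c. a > 0 \<and> b > 0 \<and> c > 0 \<and>
        (\<forall>x\<in>Y. \<forall>y\<in>Y. J (\<lambda>n. x n + y n) = (\<lambda>z. J x z + J y z)) \<and>
        (\<forall>x\<in>Y. \<forall>s::complex. J (\<lambda>n. s * x n) = (\<lambda>z. s * J x z)) \<and>
        (\<forall>x\<in>Y. J x \<in> Z \<and> T (J x) \<in> Z \<and>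
                a * supnorm x \<le> nZ (J x) \<and> nZ (J x) \<le> b * supnorm x \<and>
                c * nZ (J x) \<le> nZ (T (J x))))"

definition separable_in :: "(complex \<Rightarrow> complex) set \<Rightarrow> ((complex \<Rightarrow> complex) \<Rightarrow> real) \<Rightarrow> bool" where
  "separable_in S nS \<longleftrightarrow>
     (\<exists>D. countable D \<and> D \<subseteq> S \<and> (\<forall>f\<in>S. \<forall>e>0. \<exists>d\<in>D. nS (\<lambda>z. f z - d z) < e))"

end

theory Submission
  imports Defs
begin

text \<open>
  Since g is not in the little Bloch space there are points \<open>z\<^sub>n\<close> with \<open>d\<^sub>n = 1 - |z\<^sub>n|\<close> decreasing as fast as
  we like and \<open>d\<^sub>n |g'(z\<^sub>n)|\<close> bounded below. With \<open>q = 1/p\<close> and a large integer k, put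
  \<open>f\<^sub>n(w) = d\<^sub>n\<^sup>k\<^sup>-\<^sup>\<alpha>\<^sup>-\<^sup>q / (1 - cnj z\<^sub>n w)\<^sup>k\<close> and \<open>J x = \<Sum> x\<^sub>n f\<^sub>n\<close>. The functions
  \<open>(1 - r)\<^sup>\<alpha> M\<^sub>p(r, f\<^sub>n)\<close> peak at \<open>1 - r = d\<^sub>n\<close> and decay geometrically away from it, so \<open>\<parallel>J x\<parallel>\<close> is at most
  a constant times \<open>sup |x\<^sub>n|\<close>; and \<open>d\<^sub>n\<^sup>\<alpha>\<^sup>+\<^sup>q (J x)(z\<^sub>n)\<close> is \<open>x\<^sub>n\<close> up to a factor and a small error.

  Conversely every F in the space satisfies \<open>|F'(w)| \<le> C \<parallel>F\<parallel> (1 - |w|) powr -(\<alpha> + q + 1)\<close>. Applied to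
  \<open>F = T\<^sub>g (J x)\<close>, where \<open>F'(z\<^sub>n) = (J x)(z\<^sub>n) g'(z\<^sub>n)\<close>, this bounds \<open>sup |x\<^sub>n|\<close> by \<open>\<parallel>T\<^sub>g (J x)\<parallel>\<close>.

  \<open>T\<^sub>g\<close> is bounded: for \<open>p < 1\<close> the triangle inequality is unavailable and F is instead bounded on each
  radius by a weighted maximal function of \<open>F' = f g'\<close>. Finally, non-separability follows from the
  uncountably many 0-1 sequences.
\<close>


text \<open>The range p < 1 shapes the estimates. \<open>Mp\<close> then satisfies the triangle
  inequality only up to a constant, which can neither be iterated over a series nor passed under an
  integral. Two devices replace it: infinite sums are split with summable weights before P-th powers
  are taken, and integration along a radius is carried out pointwise, so that only a cone integral,
  which Tonelli evaluates, has to be averaged. The substitution z = exp w turns circles into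
  vertical lines and makes all these integrals iterated ones over squares and cones. The constants
  are tied together. k must exceed \<alpha> + q so that f_n decays on both sides of its own scale,
  and k >= 2q allows a comparison with the inverse square kernel. At its own point f_n is at least
  2^-k d_n^-(\<alpha>+q); the ratio of consecutive d_n is so small that all other terms together
  reach at most half of this, and the error can be absorbed. For c_0, truncated sequences give
  bounded functions; these and their images under T_g lie in H(p,0,\<alpha>), which is
  closed.\<close>

definition pinv :: "ereal \<Rightarrow> real" where
  "pinv p = (if p = \<infinity> then 0 else 1 / real_of_ereal p)"

text \<open>An \<open>ennreal\<close> integral carries no integrability side conditions under
  Tonelli and termwise summation, whereas \<open>Mp\<close> is built on the gauge integral.
  \<open>Mp_ereal_le_iff\<close> is the passage between the two and also disposes of the P-th
  root.\<close>

definition circ_integral :: "real \<Rightarrow> real \<Rightarrow> (complex \<Rightarrow> complex) \<Rightarrow> ennreal" where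
  "circ_integral P r f = (\<integral>\<^sup>+t\<in>{0..2*pi}. ennreal (cmod (f (of_real r * cis t)) powr P) \<partial>lborel)"

text \<open>\<open>Hnorm\<close> is a supremum of reals, hence meaningless outside \<open>Hinf\<close>; this predicate says at once
  that f lies in \<open>Hinf\<close> and that its norm is at most A.\<close>
definition Hle :: "ereal \<Rightarrow> real \<Rightarrow> real \<Rightarrow> (complex \<Rightarrow> complex) \<Rightarrow> bool" where
  "Hle p \<alpha> A f \<longleftrightarrow> f holomorphic_on ball 0 1 \<and>
     (\<forall>r\<in>{0..<1}. Mp p r f \<le> A * (1 - r) powr (-\<alpha>))"

section \<open>Integral means over circles\<close>

lemma continuous_on_circle:
  assumes "continuous_on (ball 0 1) f" "0 \<le> r" "r < 1"
  shows "continuous_on UNIV (\<lambda>t. f (of_real r * cis t))"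
proof -
  have "continuous_on UNIV (\<lambda>t. of_real r * cis t)"
    by (intro continuous_intros)
  moreover have "(\<lambda>t. of_real r * cis t) ` UNIV \<subseteq> ball 0 1"
    using assms by (auto simp: norm_mult)
  ultimately show ?thesis
    using assms(1) continuous_on_compose2 by blast
qed

lemma continuous_on_circle_powr:
  assumes "continuous_on (ball 0 1) f" "0 \<le> r" "r < 1" "0 < P"
  shows "continuous_on UNIV (\<lambda>t. cmod (f (of_real r * cis t)) powr P)"
  using continuous_on_circle[OF assms(1-3)] assms(4)
  by (intro continuous_on_powr') (auto intro!: continuous_intros)

lemma circ_integral_eq:
  assumes "continuous_on (ball 0 1) f" "0 \<le> r" "r < 1" "0 < P"
  shows "circ_integral P r f =
     ennreal (integral {0..2*pi} (\<lambda>t. cmod (f (of_real r * cis t)) powr P))"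
proof -
  let ?h = "\<lambda>t. cmod (f (of_real r * cis t)) powr P"
  have c: "continuous_on UNIV ?h" by (rule continuous_on_circle_powr[OF assms])
  have "?h integrable_on {0..2*pi}"
    by (rule integrable_continuous_interval) (rule continuous_on_subset[OF c], simp)
  then have "(?h has_integral integral {0..2*pi} ?h) {0..2*pi}" by (rule integrable_integral)
  then have "((\<lambda>t. indicator {0..2*pi} t * ?h t) has_integral integral {0..2*pi} ?h) UNIV"
    by (subst (asm) has_integral_restrict_UNIV[symmetric], elim has_integral_eq[rotated]) (auto simp: indicator_def)
  moreover have "?h \<in> borel_measurable borel"
    using c by (rule borel_measurable_continuous_onI)
  ultimately have "integral\<^sup>N lborel (\<lambda>t. ennreal (indicator {0..2*pi} t * ?h t)) = ennreal (integral {0..2*pi} ?h)"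
    by (intro nn_integral_has_integral_lborel) auto
  moreover have "integral\<^sup>N lborel (\<lambda>t. ennreal (indicator {0..2*pi} t * ?h t)) = circ_integral P r f"
    unfolding circ_integral_def by (intro nn_integral_cong) (auto simp: indicator_def)
  ultimately show ?thesis by simp
qed

lemma Mp_nonneg:
  assumes "continuous_on (ball 0 1) f" "0 \<le> r" "r < 1"
  shows "0 \<le> Mp p r f"
proof (cases "p = \<infinity>")
  case True
  have "compact ((\<lambda>t. cmod (f (of_real r * cis t))) ` {0..2*pi})"
    by (intro compact_continuous_image continuous_on_norm
      continuous_on_subset[OF continuous_on_circle[OF assms]]) auto
  then have "bdd_above ((\<lambda>t. cmod (f (of_real r * cis t))) ` {0..2*pi})"
    by (simp add: compact_imp_bounded bounded_imp_bdd_above)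
  then have "cmod (f (of_real r * cis 0)) \<le> (SUP t\<in>{0..2*pi}. cmod (f (of_real r * cis t)))"
    by (intro cSUP_upper) auto
  then show ?thesis using True by (simp add: Mp_def order_trans[OF norm_ge_zero])
qed (simp add: Mp_def)

lemma Mp_ereal_le_iff:
  assumes "continuous_on (ball 0 1) f" "0 \<le> r" "r < 1" "0 < P" "0 \<le> B"
  shows "Mp (ereal P) r f \<le> B \<longleftrightarrow> circ_integral P r f \<le> ennreal (2*pi * B powr P)"
proof -
  define I where "I = integral {0..2*pi} (\<lambda>t. cmod (f (of_real r * cis t)) powr P)"
  have I: "0 \<le> I" unfolding I_def by (rule integral_nonneg)
    (auto intro!: integrable_continuous_interval continuous_on_subset[OF continuous_on_circle_powr[OF assms(1-4)]])
  have "Mp (ereal P) r f \<le> B \<longleftrightarrow> (I / (2*pi)) powr (1/P) \<le> B" by (simp add: Mp_def I_def)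
  also have "\<dots> \<longleftrightarrow> ((I / (2*pi)) powr (1/P)) powr P \<le> B powr P"
    using assms by (metis powr_ge_zero powr_less_mono2 powr_mono2 not_le less_imp_le)
  also have "((I / (2*pi)) powr (1/P)) powr P = I / (2*pi)"
    using assms I by (simp add: powr_powr)
  also have "I / (2*pi) \<le> B powr P \<longleftrightarrow> I \<le> 2*pi * B powr P"
    by (simp add: field_simps)
  also have "\<dots> \<longleftrightarrow> circ_integral P r f \<le> ennreal (2*pi * B powr P)"
    unfolding circ_integral_eq[OF assms(1-4)] I_def[symmetric]
    by (subst ennreal_le_iff) auto
  finally show ?thesis .
qed

lemma complex_polar_0_2pi:
  obtains t where "t \<in> {0..2*pi}" "z = of_real (cmod z) * cis t"
proof
  show "Arg2pi z \<in> {0..2*pi}"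
    using Arg2pi_ge_0[of z] Arg2pi_lt_2pi[of z] by simp
  show "z = of_real (cmod z) * cis (Arg2pi z)"
    using Arg2pi_eq[of z] by (simp add: cis_conv_exp)
qed

lemma Mp_infinity_le_iff:
  assumes "continuous_on (ball 0 1) f" "0 \<le> r" "r < 1"
  shows "Mp \<infinity> r f \<le> B \<longleftrightarrow> (\<forall>z. cmod z = r \<longrightarrow> cmod (f z) \<le> B)"
proof -
  have "compact ((\<lambda>t. cmod (f (of_real r * cis t))) ` {0..2*pi})"
    by (intro compact_continuous_image continuous_on_norm
      continuous_on_subset[OF continuous_on_circle[OF assms]]) auto
  then have bdd: "bdd_above ((\<lambda>t. cmod (f (of_real r * cis t))) ` {0..2*pi})"
    by (simp add: compact_imp_bounded bounded_imp_bdd_above)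
  have "Mp \<infinity> r f \<le> B \<longleftrightarrow> (\<forall>t\<in>{0..2*pi}. cmod (f (of_real r * cis t)) \<le> B)"
    unfolding Mp_def using bdd by (simp add: cSUP_le_iff)
  also have "\<dots> \<longleftrightarrow> (\<forall>z. cmod z = r \<longrightarrow> cmod (f z) \<le> B)"
  proof (intro iffI allI impI ballI)
    fix z assume *: "\<forall>t\<in>{0..2*pi}. cmod (f (of_real r * cis t)) \<le> B" and "cmod z = r"
    obtain t where "t \<in> {0..2*pi}" "z = of_real (cmod z) * cis t" by (rule complex_polar_0_2pi)
    then show "cmod (f z) \<le> B" using * \<open>cmod z = r\<close> by metis
  qed (use assms in \<open>auto simp: norm_mult\<close>)
  finally show ?thesis .
qed

lemma Mp_mono:
  assumes "continuous_on (ball 0 1) f" "continuous_on (ball 0 1) h" "0 \<le> r" "r < 1" "0 < p"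
    and "\<And>z. cmod z = r \<Longrightarrow> cmod (f z) \<le> cmod (h z)"
  shows "Mp p r f \<le> Mp p r h"
proof (cases p)
  case (real P)
  then have "0 < P" using assms by simp
  have "circ_integral P r f \<le> circ_integral P r h"
    unfolding circ_integral_def using assms \<open>0 < P\<close>
    by (intro nn_integral_mono mult_right_mono ennreal_leI powr_mono2) (auto simp: norm_mult)
  also have "\<dots> \<le> ennreal (2*pi * Mp p r h powr P)"
    using Mp_ereal_le_iff[of h r P "Mp p r h"] Mp_nonneg[of h r p] \<open>0 < P\<close> assms real by auto
  finally show ?thesis
    using Mp_ereal_le_iff[of f r P "Mp p r h"] Mp_nonneg[of h r p] \<open>0 < P\<close> assms real by auto
next
  case PInf
  have "\<forall>z. cmod z = r \<longrightarrow> cmod (h z) \<le> Mp \<infinity> r h"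
    using Mp_infinity_le_iff[of h r "Mp \<infinity> r h"] assms by auto
  then have "\<forall>z. cmod z = r \<longrightarrow> cmod (f z) \<le> Mp \<infinity> r h" using assms(6) order_trans by blast
  then show ?thesis
    using Mp_infinity_le_iff[of f r "Mp \<infinity> r h"] assms PInf by auto
qed (use assms in auto)

lemma Mp_le_of_bound:
  assumes "continuous_on (ball 0 1) f" "0 \<le> r" "r < 1" "0 < p" "0 \<le> B"
    and "\<And>z. cmod z = r \<Longrightarrow> cmod (f z) \<le> B"
  shows "Mp p r f \<le> B"
proof (cases p)
  case (real P)
  then have "0 < P" using assms by simp
  have "circ_integral P r f \<le> (\<integral>\<^sup>+t\<in>{0..2*pi}. ennreal (B powr P) \<partial>lborel)"
    unfolding circ_integral_def using assms \<open>0 < P\<close>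
    by (intro nn_integral_mono mult_right_mono ennreal_leI powr_mono2) (auto simp: norm_mult)
  also have "\<dots> = ennreal (2*pi * B powr P)"
    by (simp add: nn_integral_cmult_indicator ennreal_mult[symmetric] mult.commute)
  finally show ?thesis
    using Mp_ereal_le_iff[of f r P B] \<open>0 < P\<close> assms real by auto
next
  case PInf
  then show ?thesis
    using Mp_infinity_le_iff[of f r B] assms by auto
qed (use assms in auto)

lemma Mp_cong:
  assumes "\<And>z. cmod z = \<bar>r\<bar> \<Longrightarrow> f z = h z"
  shows "Mp p r f = Mp p r h"
  unfolding Mp_def using assms by (simp add: norm_mult)

lemma Mp_cmult:
  assumes "continuous_on (ball 0 1) f" "0 \<le> r" "r < 1" "0 < p"
  shows "Mp p r (\<lambda>z. c * f z) \<le> cmod c * Mp p r f"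
proof (cases p)
  case (real P)
  then have P: "0 < P" using assms by simp
  have "circ_integral P r (\<lambda>z. c * f z) =
     (\<integral>\<^sup>+t. ennreal (cmod c powr P) * (ennreal (cmod (f (of_real r * cis t)) powr P) * indicator {0..2*pi} t) \<partial>lborel)"
    unfolding circ_integral_def
    by (intro nn_integral_cong) (auto simp: norm_mult powr_mult ennreal_mult indicator_def)
  also have "\<dots> = ennreal (cmod c powr P) * circ_integral P r f"
    unfolding circ_integral_def
    using borel_measurable_continuous_onI[OF continuous_on_circle_powr[OF assms(1-3) P]]
    by (intro nn_integral_cmult) auto
  also have "\<dots> \<le> ennreal (cmod c powr P) * ennreal (2*pi * Mp p r f powr P)"
    using Mp_ereal_le_iff[of f r P "Mp p r f"] Mp_nonneg[of f r p] P assms real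
    by (intro mult_left_mono) auto
  also have "\<dots> = ennreal (2*pi * (cmod c * Mp p r f) powr P)"
    using Mp_nonneg[of f r p] assms by (simp add: powr_mult ennreal_mult[symmetric] mult_ac)
  finally show ?thesis
    using Mp_ereal_le_iff[OF continuous_on_mult_left[OF assms(1), of c], of r P "cmod c * Mp p r f"] Mp_nonneg[of f r p] P assms real
    by auto
next
  case PInf
  have "\<forall>z. cmod z = r \<longrightarrow> cmod (f z) \<le> Mp \<infinity> r f"
    using Mp_infinity_le_iff[of f r "Mp \<infinity> r f"] assms by auto
  then show ?thesis
    using Mp_infinity_le_iff[OF continuous_on_mult_left[OF assms(1), of c], of r "cmod c * Mp \<infinity> r f"] assms PInf
    by (auto simp: norm_mult mult_left_mono)
qed (use assms in auto)

text \<open>Replacing the sum by twice the larger summand needs no convexity, so one argument covers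
  P < 1 and P >= 1.\<close>

lemma powr_add_le:
  fixes a b P :: real
  assumes "0 \<le> a" "0 \<le> b" "0 < P"
  shows "(a + b) powr P \<le> 2 powr P * a powr P + 2 powr P * b powr P"
proof -
  have "(a + b) powr P \<le> (2 * max a b) powr P"
    using assms by (intro powr_mono2) auto
  also have "\<dots> = 2 powr P * max a b powr P" by (rule powr_mult)
  also have "\<dots> \<le> 2 powr P * (a powr P + b powr P)"
    by (intro mult_left_mono) (auto simp: max_def)
  finally show ?thesis by (simp add: distrib_left)
qed

lemma Mp_quasi_triangle:
  assumes "0 < p"
  shows "\<exists>K>0. \<forall>f h r. continuous_on (ball 0 1) f \<longrightarrow> continuous_on (ball 0 1) h \<longrightarrow> 0 \<le> r \<longrightarrow> r < 1 \<longrightarrow>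
     Mp p r (\<lambda>z. f z + h z) \<le> K * (Mp p r f + Mp p r h)"
proof (cases p)
  case (real P)
  then have P: "0 < P" using assms by simp
  \<comment> \<open>Both summands contribute 2^P m^P, and 2 * 2^P m^P is the P-th power of 2 *
    2^(1/P) m.\<close>
  define K where "K = 2 * 2 powr (1/P)"
  have "Mp p r (\<lambda>z. f z + h z) \<le> K * (Mp p r f + Mp p r h)"
    if f: "continuous_on (ball 0 1) f" and h: "continuous_on (ball 0 1) h" and r: "0 \<le> r" "r < 1" for f h r
  proof -
    define m where "m = Mp p r f + Mp p r h"
    have m: "Mp p r f \<le> m" "Mp p r h \<le> m" "0 \<le> m"
      using Mp_nonneg[OF f r, of p] Mp_nonneg[OF h r, of p] by (auto simp: m_def)
    have cf: "circ_integral P r f \<le> ennreal (2*pi * m powr P)"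
      using Mp_ereal_le_iff[OF f r P m(3)] m real by auto
    have ch: "circ_integral P r h \<le> ennreal (2*pi * m powr P)"
      using Mp_ereal_le_iff[OF h r P m(3)] m real by auto
    have pw: "cmod (a + b) powr P \<le> 2 powr P * cmod a powr P + 2 powr P * cmod b powr P" for a b
    proof -
      have "cmod (a + b) powr P \<le> (cmod a + cmod b) powr P"
        using P by (intro powr_mono2 norm_triangle_ineq) auto
      also have "\<dots> \<le> 2 powr P * cmod a powr P + 2 powr P * cmod b powr P"
        using P by (intro powr_add_le) auto
      finally show ?thesis .
    qed
    let ?F = "\<lambda>u t. ennreal (cmod (u (of_real r * cis t)) powr P) * indicator {0..2*pi} t"
    have [measurable]: "(\<lambda>t. cmod (f (of_real r * cis t)) powr P) \<in> borel_measurable borel"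
      "(\<lambda>t. cmod (h (of_real r * cis t)) powr P) \<in> borel_measurable borel"
      using borel_measurable_continuous_onI[OF continuous_on_circle_powr[OF f r P]]
        borel_measurable_continuous_onI[OF continuous_on_circle_powr[OF h r P]] by auto
    have "circ_integral P r (\<lambda>z. f z + h z) \<le> (\<integral>\<^sup>+t. ennreal (2 powr P) * ?F f t + ennreal (2 powr P) * ?F h t \<partial>lborel)"
      unfolding circ_integral_def
      using pw by (intro nn_integral_mono)
       (auto simp: indicator_def ennreal_mult[symmetric] simp flip: ennreal_plus intro!: ennreal_leI)
    also have "\<dots> = ennreal (2 powr P) * circ_integral P r f + ennreal (2 powr P) * circ_integral P r h"
      unfolding circ_integral_def
      by (subst nn_integral_add) (auto intro!: arg_cong2[where f = "(+)"] nn_integral_cmult)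
    also have "\<dots> \<le> ennreal (2 powr P) * ennreal (2*pi * m powr P) + ennreal (2 powr P) * ennreal (2*pi * m powr P)"
      using cf ch by (intro add_mono mult_left_mono) auto
    also have "\<dots> = ennreal (2*pi * (K * m) powr P)"
    proof -
      have "(K * m) powr P = 2 * 2 powr P * m powr P"
        using P m(3) by (simp add: K_def powr_mult powr_powr)
      then show ?thesis
        by (simp add: ennreal_mult[symmetric] flip: ennreal_plus)
    qed
    finally have "Mp (ereal P) r (\<lambda>z. f z + h z) \<le> K * m"
      by (subst Mp_ereal_le_iff[OF continuous_on_add[OF f h] r P]) (use m in \<open>auto simp: K_def\<close>)
    then show ?thesis by (simp add: m_def real)
  qed
  moreover have "K > 0" by (simp add: K_def)
  ultimately show ?thesis by blast
next
  case PInf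
  have "Mp p r (\<lambda>z. f z + h z) \<le> 1 * (Mp p r f + Mp p r h)"
    if f: "continuous_on (ball 0 1) f" and h: "continuous_on (ball 0 1) h" and r: "0 \<le> r" "r < 1" for f h r
    using Mp_infinity_le_iff[OF f r, of "Mp \<infinity> r f"] Mp_infinity_le_iff[OF h r, of "Mp \<infinity> r h"]
      Mp_infinity_le_iff[OF continuous_on_add[OF f h] r, of "Mp \<infinity> r f + Mp \<infinity> r h"] PInf
    by (auto intro!: norm_triangle_le add_mono)
  then show ?thesis by (intro exI[of _ 1]) simp
qed (use assms in auto)

section \<open>The norm expressed by bounds on the integral means\<close>

lemma Hinf_Hnorm_le_iff_Hle: "f \<in> Hinf p \<alpha> \<and> Hnorm p \<alpha> f \<le> A \<longleftrightarrow> Hle p \<alpha> A f"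
proof -
  have eq: "(1 - r) powr \<alpha> * Mp p r f \<le> A \<longleftrightarrow> Mp p r f \<le> A * (1 - r) powr (-\<alpha>)" if "r \<in> {0..<1}" for r
    using that by (simp add: powr_minus field_simps)
  show ?thesis
  proof
    assume *: "f \<in> Hinf p \<alpha> \<and> Hnorm p \<alpha> f \<le> A"
    then have bdd: "bdd_above ((\<lambda>r. (1 - r) powr \<alpha> * Mp p r f) ` {0..<1})"
      by (simp add: Hinf_def)
    have "(1 - r) powr \<alpha> * Mp p r f \<le> A" if "r \<in> {0..<1}" for r
      using cSUP_upper[OF that bdd] * by (simp add: Hnorm_def)
    then show "Hle p \<alpha> A f" using * eq by (auto simp: Hle_def Hinf_def)
  next
    assume *: "Hle p \<alpha> A f"
    then have b: "(1 - r) powr \<alpha> * Mp p r f \<le> A" if "r \<in> {0..<1}" for r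
      using that eq by (auto simp: Hle_def)
    have "Hnorm p \<alpha> f \<le> A" unfolding Hnorm_def
      using b by (intro cSUP_least) auto
    moreover have "f \<in> Hinf p \<alpha>" using * b by (auto simp: Hinf_def Hle_def intro!: bdd_aboveI[of _ A])
    ultimately show "f \<in> Hinf p \<alpha> \<and> Hnorm p \<alpha> f \<le> A" by simp
  qed
qed

lemma Hle_Hnorm: "f \<in> Hinf p \<alpha> \<Longrightarrow> Hle p \<alpha> (Hnorm p \<alpha> f) f"
  using Hinf_Hnorm_le_iff_Hle by blast

lemma Hle_nonneg: "Hle p \<alpha> A f \<Longrightarrow> 0 \<le> A"
proof -
  assume *: "Hle p \<alpha> A f"
  then have "0 \<le> Mp p 0 f" by (intro Mp_nonneg) (auto simp: Hle_def holomorphic_on_imp_continuous_on)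
  also have "Mp p 0 f \<le> A" using * by (auto simp: Hle_def dest: bspec[of _ _ 0])
  finally show ?thesis .
qed

text \<open>Functions are total here, but identities for \<open>Tg\<close> are available only inside
  the disk; this transfers norm bounds along them.\<close>

lemma Hle_cong:
  assumes "\<And>z. z \<in> ball 0 1 \<Longrightarrow> f z = h z"
  shows "Hle p \<alpha> A f \<longleftrightarrow> Hle p \<alpha> A h"
proof -
  have "Mp p r f = Mp p r h" if "r \<in> {0..<1}" for r
    using that assms by (intro Mp_cong) auto
  moreover have "f holomorphic_on ball 0 1 \<longleftrightarrow> h holomorphic_on ball 0 1"
    using assms by (intro holomorphic_cong) auto
  ultimately show ?thesis by (auto simp: Hle_def)
qed

lemma Hle_add:
  assumes "0 < p"
  shows "\<exists>K>0. \<forall>f h A B. Hle p \<alpha> A f \<longrightarrow> Hle p \<alpha> B h \<longrightarrow> Hle p \<alpha> (K * (A + B)) (\<lambda>z. f z + h z)"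
proof -
  obtain K where K: "K > 0" "\<And>f h r. continuous_on (ball 0 1) f \<Longrightarrow> continuous_on (ball 0 1) h \<Longrightarrow>
      0 \<le> r \<Longrightarrow> r < 1 \<Longrightarrow> Mp p r (\<lambda>z. f z + h z) \<le> K * (Mp p r f + Mp p r h)"
    using Mp_quasi_triangle[OF assms] by metis
  have "Hle p \<alpha> (K * (A + B)) (\<lambda>z. f z + h z)" if f: "Hle p \<alpha> A f" and h: "Hle p \<alpha> B h" for f h A B
    unfolding Hle_def
  proof (intro conjI ballI)
    fix r :: real assume r: "r \<in> {0..<1}"
    have "Mp p r (\<lambda>z. f z + h z) \<le> K * (Mp p r f + Mp p r h)"
      using f h r by (intro K) (auto simp: Hle_def holomorphic_on_imp_continuous_on)
    also have "\<dots> \<le> K * (A * (1 - r) powr (-\<alpha>) + B * (1 - r) powr (-\<alpha>))"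
      using f h r K(1) by (intro mult_left_mono add_mono) (auto simp: Hle_def)
    finally show "Mp p r (\<lambda>z. f z + h z) \<le> K * (A + B) * (1 - r) powr (-\<alpha>)"
      by (simp add: algebra_simps)
  qed (use f h in \<open>auto simp: Hle_def intro!: holomorphic_intros\<close>)
  then show ?thesis using K(1) by blast
qed

lemma Hle_minus:
  assumes "0 < p" "Hle p \<alpha> A f" shows "Hle p \<alpha> A (\<lambda>z. - f z)"
  unfolding Hle_def
proof (intro conjI ballI)
  fix r :: real assume r: "r \<in> {0..<1}"
  have "Mp p r (\<lambda>z. (-1) * f z) \<le> cmod (-1) * Mp p r f"
    using assms r by (intro Mp_cmult) (auto simp: Hle_def holomorphic_on_imp_continuous_on)
  also have "\<dots> \<le> A * (1 - r) powr (-\<alpha>)"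
    using assms r by (auto simp: Hle_def)
  finally show "Mp p r (\<lambda>z. - f z) \<le> A * (1 - r) powr (-\<alpha>)" by simp
qed (use assms in \<open>auto simp: Hle_def intro!: holomorphic_intros\<close>)

section \<open>A local mean value inequality for all positive exponents\<close>

text \<open>The square of half-side R is integrated iteratively, with y inside: after the
  exponential substitution the inner integral runs along an arc of a circle, which
  \<open>circ_integral\<close> controls.\<close>

definition square_integral :: "real \<Rightarrow> (complex \<Rightarrow> complex) \<Rightarrow> complex \<Rightarrow> real \<Rightarrow> ennreal" where
  "square_integral P G w R =
     (\<integral>\<^sup>+x\<in>{Re w - R..Re w + R}. (\<integral>\<^sup>+y\<in>{Im w - R..Im w + R}. ennreal (cmod (G (Complex x y)) powr P) \<partial>lborel) \<partial>lborel)"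

text \<open>A substitute for the subharmonicity of \<open>|G|\<^sup>P\<close> that works for every \<open>P > 0\<close>: at a point \<open>z\<^sub>0\<close>
  maximising \<open>(R - |z - w|) powr (2/P) * |G z|\<close>, nearby values of \<open>|G|\<close> are at most a constant times
  \<open>|G z\<^sub>0|\<close>, so Cauchy's estimate keeps \<open>|G| \<ge> |G z\<^sub>0|/2\<close> on a square of side comparable to the weight.\<close>
lemma local_powr_le_square_integral:
  assumes P: "(0::real) < P"
  shows "\<exists>C>0. \<forall>G w R S. 0 < R \<longrightarrow> open S \<longrightarrow> cball w R \<subseteq> S \<longrightarrow> G holomorphic_on S \<longrightarrow>
    ennreal (R\<^sup>2 * cmod (G w) powr P) \<le> ennreal C *
      square_integral P G w R"
proof -
  \<comment> \<open>M is the loss when the weight drops from d to d/2. In C, the square has side 2 *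
    \<kappa> = d / (8*M), which gives (8*M)^2, and the lower bound |G z0| / 2 on it gives
    2^P.\<close>
  define M :: real where "M = 2 powr (2/P)"
  define C where "C = (8*M)\<^sup>2 * 2 powr P"
  have M: "M \<ge> 1" unfolding M_def using P by (simp add: ge_one_powr_ge_zero)
  have "ennreal (R\<^sup>2 * cmod (G w) powr P) \<le> ennreal C *
      square_integral P G w R"
    if R: "0 < R" and S: "open S" and sub: "cball w R \<subseteq> S" and hol: "G holomorphic_on S" for G w R S
  proof (cases "G w = 0")
    case True
    then show ?thesis using P by simp
  next
    case False
    \<comment> \<open>Raised to the power P, the weight becomes a squared length, the scale of the
      area of a square; at the centre it equals R^2.\<close>
    define \<phi> where "\<phi> z = (R - cmod (z - w)) powr (2/P) * cmod (G z)" for z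
    have contG: "continuous_on S G" using hol by (rule holomorphic_on_imp_continuous_on)
    have "continuous_on (cball w R) \<phi>"
      unfolding \<phi>_def using P
      by (intro continuous_on_mult continuous_on_powr' continuous_on_norm continuous_on_subset[OF contG sub]
         continuous_intros) (auto simp: dist_norm norm_minus_commute)
    then obtain z0 where z0: "z0 \<in> cball w R" and max: "\<And>z. z \<in> cball w R \<Longrightarrow> \<phi> z \<le> \<phi> z0"
      using continuous_attains_sup[of "cball w R" \<phi>] R by auto
    define d where "d = R - cmod (z0 - w)"
    define \<rho> where "\<rho> = d / 2"
    have w: "R powr (2/P) * cmod (G w) \<le> d powr (2/P) * cmod (G z0)"
      using max[of w] R by (simp add: \<phi>_def d_def)
    have pos: "0 < R powr (2/P) * cmod (G w)" using False R by simp
    have "d \<ge> 0" using z0 by (simp add: d_def dist_norm norm_minus_commute)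
    moreover have "d \<noteq> 0" using w pos by auto
    ultimately have d: "d > 0" by simp
    have G0: "cmod (G z0) > 0" using w pos by fastforce
    have rho: "\<rho> > 0" using d by (simp add: \<rho>_def)
    have inball: "cball z0 \<rho> \<subseteq> cball w R"
    proof
      fix z assume "z \<in> cball z0 \<rho>"
      then have "dist z0 z \<le> \<rho>" by simp
      moreover have "dist w z \<le> dist w z0 + dist z0 z" by (rule dist_triangle)
      moreover have "dist w z0 = R - d" by (simp add: d_def dist_norm norm_minus_commute)
      ultimately show "z \<in> cball w R" using d by (simp add: \<rho>_def)
    qed
    have bound: "cmod (G z) \<le> M * cmod (G z0)" if "z \<in> cball z0 \<rho>" for z
    proof -
      have "cmod (z - w) \<le> cmod (z - z0) + cmod (z0 - w)"
        using norm_triangle_ineq[of "z - z0" "z0 - w"] by simp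
      then have "\<rho> \<le> R - cmod (z - w)"
        using that by (simp add: \<rho>_def d_def dist_norm norm_minus_commute)
      then have "\<rho> powr (2/P) * cmod (G z) \<le> \<phi> z"
        unfolding \<phi>_def using rho P by (intro mult_right_mono powr_mono2) auto
      also have "\<dots> \<le> \<phi> z0" using inball that by (intro max) auto
      also have "\<phi> z0 = \<rho> powr (2/P) * (M * cmod (G z0))"
        using rho by (simp add: \<phi>_def M_def \<rho>_def powr_divide flip: d_def)
      finally show ?thesis using rho by simp
    qed
    have deriv: "cmod (deriv G z) \<le> M * cmod (G z0) / (\<rho>/2)" if z: "z \<in> ball z0 (\<rho>/2)" for z
    proof -
      have sub': "cball z (\<rho>/2) \<subseteq> cball z0 \<rho>"
        using z by (simp add: cball_subset_cball_iff dist_commute)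
      then have "cball z (\<rho>/2) \<subseteq> S" using inball sub by blast
      then have "cmod ((deriv ^^ 1) G z) \<le> fact 1 * (M * cmod (G z0)) / (\<rho>/2) ^ 1"
        using rho sub' ball_subset_cball
        by (intro Cauchy_inequality holomorphic_on_subset[OF hol] continuous_on_subset[OF contG] bound)
          (auto simp: dist_norm subset_iff)
      then show ?thesis by simp
    qed
    \<comment> \<open>On the square of half-side \<kappa> the distance to z0 is at most 2 *
      \<kappa>; the derivative bound times this distance is exactly |G z0| / 2.\<close>
    define \<kappa> where "\<kappa> = \<rho> / (8*M)"
    have kappa: "\<kappa> > 0" "4 * \<kappa> < \<rho>" "2 * \<kappa> < \<rho> / 2"
      using rho M by (auto simp: \<kappa>_def field_simps)
    have low: "cmod (G z0) / 2 \<le> cmod (G z)" if z: "cmod (z - z0) \<le> 2 * \<kappa>" for z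
    proof -
      have "cmod (G z - G z0) \<le> M * cmod (G z0) / (\<rho>/2) * cmod (z - z0)"
      proof (rule field_differentiable_bound[of "ball z0 (\<rho>/2)" _ "deriv G"])
        fix u assume u: "u \<in> ball z0 (\<rho>/2)"
        then have "u \<in> cball z0 \<rho>" using rho by auto
        then have "u \<in> S" using inball sub by blast
        then show "(G has_field_derivative deriv G u) (at u within ball z0 (\<rho>/2))"
          using hol S by (metis holomorphic_derivI)
        show "cmod (deriv G u) \<le> M * cmod (G z0) / (\<rho>/2)" by (rule deriv[OF u])
      qed (use z kappa rho in \<open>auto simp: dist_norm norm_minus_commute\<close>)
      also have "\<dots> \<le> M * cmod (G z0) / (\<rho>/2) * (2 * \<kappa>)"
        using z rho M by (intro mult_left_mono) auto
      also have "\<dots> = cmod (G z0) / 2" using rho M by (simp add: \<kappa>_def field_simps)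
      finally show ?thesis using norm_triangle_ineq2[of "G z0" "G z"] by (simp add: norm_minus_commute)
    qed
    let ?I = "\<lambda>A B. (\<integral>\<^sup>+x\<in>A. (\<integral>\<^sup>+y\<in>B. ennreal (cmod (G (Complex x y)) powr P) \<partial>lborel) \<partial>lborel)"
    let ?A = "{Re z0 - \<kappa>..Re z0 + \<kappa>}" and ?B = "{Im z0 - \<kappa>..Im z0 + \<kappa>}"
    let ?c = "(cmod (G z0) / 2) powr P"
    have sq: "cmod (Complex x y - z0) \<le> 2 * \<kappa>" if "x \<in> ?A" "y \<in> ?B" for x y
      using that cmod_le[of "Complex x y - z0"] by auto
    have "ennreal ((2*\<kappa>) * ((2*\<kappa>) * ?c)) = (\<integral>\<^sup>+x\<in>?A. (\<integral>\<^sup>+y\<in>?B. ennreal ?c \<partial>lborel) \<partial>lborel)"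
      using kappa by (simp add: nn_integral_cmult_indicator ennreal_mult[symmetric])
    also have "\<dots> \<le> ?I ?A ?B"
      using low sq P by (intro nn_integral_mono) (auto simp: indicator_def intro!: nn_integral_mono ennreal_leI powr_mono2)
    also have "\<dots> \<le> ?I {Re w - R..Re w + R} {Im w - R..Im w + R}"
    proof -
      have "?A \<subseteq> {Re w - R..Re w + R}" "?B \<subseteq> {Im w - R..Im w + R}"
        using abs_Re_le_cmod[of "z0 - w"] abs_Im_le_cmod[of "z0 - w"] kappa
        by (auto simp: \<rho>_def d_def abs_le_iff)
      then show ?thesis
        by (intro nn_integral_mono) (auto simp: indicator_def intro!: nn_integral_mono)
    qed
    also have "\<dots> = square_integral P G w R" by (simp add: square_integral_def)
    finally have I: "ennreal ((2*\<kappa>) * ((2*\<kappa>) * ?c)) \<le> square_integral P G w R" .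
    have "(R powr (2/P) * cmod (G w)) powr P \<le> (d powr (2/P) * cmod (G z0)) powr P"
      using w P R by (intro powr_mono2) auto
    then have "R\<^sup>2 * cmod (G w) powr P \<le> d\<^sup>2 * cmod (G z0) powr P"
      using P R d by (simp add: powr_mult powr_powr)
    also have "\<dots> = C * ((2*\<kappa>) * ((2*\<kappa>) * ?c))"
      using M P by (simp add: C_def \<kappa>_def \<rho>_def powr_divide power2_eq_square field_simps)
    finally have "ennreal (R\<^sup>2 * cmod (G w) powr P) \<le> ennreal C * ennreal ((2*\<kappa>) * ((2*\<kappa>) * ?c))"
      using kappa by (subst ennreal_mult[symmetric]) (auto simp: C_def intro!: ennreal_leI)
    also have "\<dots> \<le> ennreal C * square_integral P G w R"
      using I by (intro mult_left_mono) auto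
    finally show ?thesis .
  qed
  moreover have "C > 0" using M by (simp add: C_def)
  ultimately show ?thesis by blast
qed

section \<open>Logarithmic coordinates on the disk\<close>

text \<open>Three translates of one closed period cover the interval. They overlap at endpoints,
  which does no harm to an upper bound.\<close>

lemma periodic_nn_integral_le:
  fixes \<phi> :: "real \<Rightarrow> ennreal"
  assumes [measurable]: "\<phi> \<in> borel_measurable borel" and per: "\<And>y. \<phi> (y + c) = \<phi> y" and "0 < c"
  shows "(\<integral>\<^sup>+y\<in>{-c..2*c}. \<phi> y \<partial>lborel) \<le> 3 * (\<integral>\<^sup>+y\<in>{0..c}. \<phi> y \<partial>lborel)"
proof -
  let ?f = "\<lambda>y. \<phi> y * indicator {0..c} y"
  have per': "\<phi> (y - c) = \<phi> y" for y using per[of "y - c"] by simp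
  have "(\<integral>\<^sup>+y\<in>{-c..2*c}. \<phi> y \<partial>lborel) \<le> (\<integral>\<^sup>+y. ?f y + ?f (c + 1 * y) + ?f (-c + 1 * y) \<partial>lborel)"
    using per per' by (intro nn_integral_mono) (auto simp: indicator_def add.commute)
  also have "\<dots> = (\<integral>\<^sup>+y. ?f y \<partial>lborel) + (\<integral>\<^sup>+y. ?f (c + 1 * y) \<partial>lborel) + (\<integral>\<^sup>+y. ?f (-c + 1 * y) \<partial>lborel)"
    by (simp add: nn_integral_add)
  also have "(\<integral>\<^sup>+y. ?f (c + 1 * y) \<partial>lborel) = (\<integral>\<^sup>+y. ?f y \<partial>lborel)"
    using nn_integral_real_affine[of ?f 1 c] by simp
  also have "(\<integral>\<^sup>+y. ?f (-c + 1 * y) \<partial>lborel) = (\<integral>\<^sup>+y. ?f y \<partial>lborel)"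
    using nn_integral_real_affine[of ?f 1 "-c"] by simp
  also have "(\<integral>\<^sup>+y. ?f y \<partial>lborel) + (\<integral>\<^sup>+y. ?f y \<partial>lborel) + (\<integral>\<^sup>+y. ?f y \<partial>lborel) = 3 * (\<integral>\<^sup>+y\<in>{0..c}. \<phi> y \<partial>lborel)"
  proof -
    have "a + a + a = 3 * a" for a :: ennreal
    proof -
      have "(1 + 1 + 1) * a = a + a + a" by (simp only: distrib_right mult_1)
      then show ?thesis by simp
    qed
    then show ?thesis .
  qed
  finally show ?thesis .
qed

text \<open>The exponential wraps such a segment at most three times around the circle of radius
  \<open>exp x\<close>. The window leaves a full period on either side of [0, 2 pi], room for the
  squares and cones centred at an angle in that interval.\<close>

lemma circ_integral_arc_le:
  assumes "continuous_on (ball 0 1) f" "x < 0" "0 < P" "- 2*pi \<le> a" "b \<le> 4*pi"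
  shows "(\<integral>\<^sup>+y\<in>{a..b}. ennreal (cmod (f (exp (Complex x y))) powr P) \<partial>lborel) \<le> 3 * circ_integral P (exp x) f"
proof -
  let ?\<phi> = "\<lambda>y. ennreal (cmod (f (of_real (exp x) * cis y)) powr P)"
  have "(\<integral>\<^sup>+y\<in>{a..b}. ennreal (cmod (f (exp (Complex x y))) powr P) \<partial>lborel) \<le> (\<integral>\<^sup>+y\<in>{-(2*pi)..2*(2*pi)}. ?\<phi> y \<partial>lborel)"
    using assms by (intro nn_integral_mono) (auto simp: exp_eq_polar indicator_def)
  also have "\<dots> \<le> 3 * (\<integral>\<^sup>+y\<in>{0..2*pi}. ?\<phi> y \<partial>lborel)"
  proof (rule periodic_nn_integral_le)
    show "?\<phi> \<in> borel_measurable borel"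
      using borel_measurable_continuous_onI[OF continuous_on_circle_powr[OF assms(1), of "exp x" P]] assms
      by simp
    show "?\<phi> (y + 2*pi) = ?\<phi> y" for y
      by (simp add: cis.ctr)
  qed auto
  finally show ?thesis by (simp add: circ_integral_def)
qed

text \<open>Together with 1 - exp (-u) \<le> u this makes 1 - |z| and the logarithmic coordinate u =
  -ln |z| comparable near the unit circle, so weights can be moved between the two pictures.\<close>

lemma exp_minus_le: "exp (- u) \<le> 1 - u/2" if "0 \<le> u" "u \<le> 1" for u :: real
proof -
  have "1 / exp u \<le> 1 / (1 + u)"
    using exp_ge_add_one_self[of u] that by (intro divide_left_mono) auto
  also have "\<dots> \<le> 1 - u/2"
    using that mult_left_mono[of u 1 u] by (simp add: field_simps)
  finally show ?thesis by (simp add: exp_minus inverse_eq_divide)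
qed

lemma Hle_circ_integral_le:
  assumes "Hle (ereal P) \<alpha> A f" "0 < P" "0 \<le> r" "r < 1"
  shows "circ_integral P r f \<le> ennreal (2*pi * (A * (1 - r) powr (-\<alpha>)) powr P)"
  using assms Hle_nonneg[OF assms(1)]
  by (subst Mp_ereal_le_iff[symmetric]) (auto simp: Hle_def holomorphic_on_imp_continuous_on)

lemma holomorphic_on_exp_halfplane:
  assumes "f holomorphic_on ball 0 1"
  shows "(\<lambda>w. f (exp w)) holomorphic_on {w. Re w < 0}"
proof -
  have "exp holomorphic_on {w::complex. Re w < 0}" by (rule holomorphic_on_exp)
  moreover have "exp ` {w::complex. Re w < 0} \<subseteq> ball 0 1" by auto
  ultimately show ?thesis
    using holomorphic_on_compose_gen[OF _ assms] by (auto simp: o_def)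
qed

section \<open>Pointwise growth of functions and derivatives\<close>

text \<open>For finite P, the mean value inequality on a square of side s around w, where z = exp w,
  bounds s^2 |F z|^P by a constant times the integral over x of arc integrals, which is at most of
  order s * s^(-\<alpha> P). The one power of s that is lost becomes \<open>pinv p\<close> after the
  P-th root.\<close>

lemma pointwise_growth:
  assumes "0 < p" "0 < \<alpha>"
  shows "\<exists>C>0. \<forall>A F z. Hle p \<alpha> A F \<longrightarrow> cmod z < 1 \<longrightarrow> cmod (F z) \<le> C * A * (1 - cmod z) powr (-(\<alpha> + pinv p))"
proof (cases p)
  case (real P)
  then have P: "0 < P" using assms by simp
  obtain C where C: "C > 0" "\<And>G w R S. 0 < R \<Longrightarrow> open S \<Longrightarrow> cball w R \<subseteq> S \<Longrightarrow> G holomorphic_on S \<Longrightarrow>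
    ennreal (R\<^sup>2 * cmod (G w) powr P) \<le> ennreal C *
      square_integral P G w R"
    using local_powr_le_square_integral[OF P] by meson
  define K where "K = (24 * pi * C) powr (1/P) * 4 powr \<alpha>"
  have main: "cmod (F z) \<le> K * A * (1 - cmod z) powr (-(\<alpha> + pinv p))"
    if F: "Hle p \<alpha> A F" and z: "cmod z < 1" "z \<noteq> 0" for A F z
  proof -
    have A: "0 \<le> A" by (rule Hle_nonneg[OF F])
    have holF: "F holomorphic_on ball 0 1" using F by (simp add: Hle_def)
    obtain \<theta> where \<theta>: "\<theta> \<in> {0..2*pi}" "z = of_real (cmod z) * cis \<theta>" by (rule complex_polar_0_2pi)
    define \<sigma> where "\<sigma> = - ln (cmod z)"
    \<comment> \<open>The cap at 1 matters for small |z|: it keeps the square inside the angular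
      window and the argument of \<open>exp_minus_le\<close> inside [0, 1].\<close>
    define s where "s = min \<sigma> 1"
    define R where "R = s / 2"
    define w where "w = Complex (-\<sigma>) \<theta>"
    define S where "S = {z. Re z < 0}"
    have \<sigma>: "\<sigma> > 0" using z by (simp add: \<sigma>_def)
    have s: "0 < s" "s \<le> 1" "s \<le> \<sigma>" using \<sigma> by (auto simp: s_def)
    have R: "0 < R" "R \<le> 1/2" "R < \<sigma>" using s by (auto simp: R_def)
    have expw: "exp w = z" using \<theta> z by (simp add: w_def exp_eq_polar \<sigma>_def)
    have sz: "1 - cmod z \<le> s" using z ln_le_minus_one[of "cmod z"] by (auto simp: s_def \<sigma>_def)
    have hol: "(\<lambda>w. F (exp w)) holomorphic_on S"
      unfolding S_def by (rule holomorphic_on_exp_halfplane[OF holF])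
    have sub: "cball w R \<subseteq> S"
    proof
      fix u assume "u \<in> cball w R"
      then have "cmod (u - w) \<le> R" by (simp add: dist_norm norm_minus_commute)
      then have "Re u - Re w \<le> R" using abs_Re_le_cmod[of "u - w"] by simp
      then show "u \<in> S" using R by (simp add: S_def w_def)
    qed
    have op: "open S" unfolding S_def by (rule open_halfspace_Re_lt)
    let ?b = "2*pi * (A * (s/4) powr (-\<alpha>)) powr P"
    have inner: "(\<integral>\<^sup>+y\<in>{Im w - R..Im w + R}. ennreal (cmod (F (exp (Complex x y))) powr P) \<partial>lborel) \<le> ennreal (3 * ?b)"
      if x: "x \<in> {Re w - R..Re w + R}" for x
    proof -
      have "x < 0" using x R by (auto simp: w_def)
      have "(\<integral>\<^sup>+y\<in>{Im w - R..Im w + R}. ennreal (cmod (F (exp (Complex x y))) powr P) \<partial>lborel)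
          \<le> 3 * circ_integral P (exp x) F"
        using \<theta> R pi_gt3 \<open>x < 0\<close> P holF
        by (intro circ_integral_arc_le) (auto simp: w_def holomorphic_on_imp_continuous_on)
      also have "\<dots> \<le> 3 * ennreal (2*pi * (A * (1 - exp x) powr (-\<alpha>)) powr P)"
        using F real P \<open>x < 0\<close> by (intro mult_left_mono Hle_circ_integral_le) auto
      also have "\<dots> \<le> 3 * ennreal ?b"
      proof -
        have "exp x \<le> exp (- (s/2))" using x s by (simp add: w_def R_def)
        also have "\<dots> \<le> 1 - s/2/2" using s by (intro exp_minus_le) auto
        finally have "s/4 \<le> 1 - exp x" by simp
        then have *: "(1 - exp x) powr (-\<alpha>) \<le> (s/4) powr (-\<alpha>)"
          using s assms by (intro powr_mono2') auto
        have "(A * (1 - exp x) powr (-\<alpha>)) powr P \<le> (A * (s/4) powr (-\<alpha>)) powr P"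
          using A P by (intro powr_mono2 mult_left_mono[OF *]) auto
        then show ?thesis
          by (intro mult_left_mono ennreal_leI) auto
      qed
      also have "3 * ennreal ?b = ennreal (3 * ?b)"
        by (simp add: ennreal_mult[symmetric] flip: ennreal_numeral)
      finally show ?thesis .
    qed
    have "ennreal (R\<^sup>2 * cmod (F z) powr P) \<le> ennreal C *
      (\<integral>\<^sup>+x\<in>{Re w - R..Re w + R}. (\<integral>\<^sup>+y\<in>{Im w - R..Im w + R}. ennreal (cmod (F (exp (Complex x y))) powr P) \<partial>lborel) \<partial>lborel)"
      using C(2)[OF R(1) op sub hol] expw by (simp add: square_integral_def)
    also have "\<dots> \<le> ennreal C * (\<integral>\<^sup>+x\<in>{Re w - R..Re w + R}. ennreal (3 * ?b) \<partial>lborel)"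
      using inner by (intro mult_left_mono nn_integral_mono) (auto simp: indicator_def)
    also have "\<dots> = ennreal (C * (3 * ?b * (2 * R)))"
      using R C(1) by (simp add: nn_integral_cmult_indicator ennreal_mult[symmetric])
    finally have "R\<^sup>2 * cmod (F z) powr P \<le> C * (3 * ?b * (2 * R))"
      using R C(1) by (subst (asm) ennreal_le_iff) auto
    then have "R * (R * cmod (F z) powr P) \<le> R * (6 * C * ?b)"
      by (simp add: power2_eq_square mult_ac)
    then have "R * cmod (F z) powr P \<le> 6 * C * ?b" using R by simp
    then have "cmod (F z) powr P \<le> 24 * pi * C * (1/s) * (A * (s/4) powr (-\<alpha>)) powr P"
      using s by (simp add: R_def field_simps)
    then have "(cmod (F z) powr P) powr (1/P) \<le> (24 * pi * C * (1/s) * (A * (s/4) powr (-\<alpha>)) powr P) powr (1/P)"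
      using P by (intro powr_mono2) auto
    also have "\<dots> = (24 * pi * C) powr (1/P) * (1/s) powr (1/P) * (A * (s/4) powr (-\<alpha>))"
    proof -
      have "(a * b * c powr P) powr (1/P) = a powr (1/P) * b powr (1/P) * c" if "c \<ge> 0" for a b c
        using P that by (simp add: powr_mult powr_powr)
      then show ?thesis using A by (metis mult_nonneg_nonneg powr_ge_zero)
    qed
    also have "\<dots> = K * A * s powr (-(\<alpha> + pinv p))"
    proof -
      have "s powr (-(\<alpha> + 1/P)) = 1 / (s powr \<alpha> * s powr (1/P))"
        by (simp only: powr_minus_divide powr_add)
      then show ?thesis using s real by (simp add: K_def pinv_def powr_divide powr_minus field_simps)
    qed
    also have "\<dots> \<le> K * A * (1 - cmod z) powr (-(\<alpha> + pinv p))"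
      using sz s z A P assms C(1) real by (intro mult_left_mono powr_mono2') (auto simp: K_def pinv_def intro: order_trans[of _ 0])
    finally show ?thesis using P by (simp add: powr_powr)
  qed
  have "cmod (F z) \<le> K * A * (1 - cmod z) powr (-(\<alpha> + pinv p))"
    if F: "Hle p \<alpha> A F" and z: "cmod z < 1" for A F z
  proof (cases "z = 0")
    case True
    \<comment> \<open>The origin has no logarithm; both sides of the estimate are continuous
      there.\<close>
    have "isCont F 0" using F
      by (auto simp: Hle_def dest!: holomorphic_on_imp_continuous_on simp: continuous_on_eq_continuous_at)
    then have "((\<lambda>z. cmod (F z)) \<longlongrightarrow> cmod (F 0)) (at 0)"
      by (intro tendsto_norm) (simp add: isCont_def)
    moreover have "((\<lambda>z. K * A * (1 - cmod z) powr (-(\<alpha> + pinv p))) \<longlongrightarrow> K * A * (1 - cmod 0) powr (-(\<alpha> + pinv p))) (at 0)"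
      by (intro tendsto_intros) auto
    moreover have "eventually (\<lambda>z::complex. cmod z < 1 \<and> z \<noteq> 0) (at 0)"
      by (auto simp: eventually_at intro!: exI[of _ 1])
    then have "eventually (\<lambda>z. cmod (F z) \<le> K * A * (1 - cmod z) powr (-(\<alpha> + pinv p))) (at 0)"
      by eventually_elim (use main F in auto)
    ultimately show ?thesis unfolding True by (intro tendsto_le[of "at 0"]) auto
  qed (use main F z in auto)
  moreover have "K > 0" using C(1) by (simp add: K_def)
  ultimately show ?thesis by blast
next
  case PInf
  have "cmod (F z) \<le> 1 * A * (1 - cmod z) powr (-(\<alpha> + pinv p))"
    if F: "Hle p \<alpha> A F" and z: "cmod z < 1" for A F z
  proof -
    have "Mp \<infinity> (cmod z) F \<le> A * (1 - cmod z) powr (-\<alpha>)"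
      using F z PInf by (auto simp: Hle_def)
    then show ?thesis using F z PInf
      by (subst (asm) Mp_infinity_le_iff) (auto simp: pinv_def Hle_def holomorphic_on_imp_continuous_on)
  qed
  then show ?thesis by (intro exI[of _ 1]) auto
qed (use assms in auto)

text \<open>Cauchy's estimate on a circle of radius (1 - |z|)/2: there 1 - |u| is still at least
  half of 1 - |z|, and dividing by the radius costs one power.\<close>

lemma deriv_growth:
  assumes "0 < p" "0 < \<alpha>"
  shows "\<exists>C>0. \<forall>A F z. Hle p \<alpha> A F \<longrightarrow> cmod z < 1 \<longrightarrow> cmod (deriv F z) \<le> C * A * (1 - cmod z) powr (-(\<alpha> + pinv p + 1))"
proof -
  define e where "e = \<alpha> + pinv p"
  have e: "e > 0" using assms by (cases p) (auto simp: e_def pinv_def add_pos_nonneg)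
  obtain C where C: "C > 0" "\<And>A F z. Hle p \<alpha> A F \<Longrightarrow> cmod z < 1 \<Longrightarrow> cmod (F z) \<le> C * A * (1 - cmod z) powr (-e)"
    using pointwise_growth[OF assms] unfolding e_def by metis
  have "cmod (deriv F z) \<le> (C * 2 powr (e + 1)) * A * (1 - cmod z) powr (-(e + 1))"
    if F: "Hle p \<alpha> A F" and z: "cmod z < 1" for A F z
  proof -
    have A: "0 \<le> A" by (rule Hle_nonneg[OF F])
    define r where "r = (1 - cmod z) / 2"
    have r: "r > 0" using z by (simp add: r_def)
    have holF: "F holomorphic_on ball 0 1" using F by (simp add: Hle_def)
    have sub: "cball z r \<subseteq> ball 0 1"
    proof
      fix u assume "u \<in> cball z r"
      then have "cmod (u - z) \<le> r" by (simp add: dist_norm norm_minus_commute)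
      then have "cmod u \<le> cmod z + r" using norm_triangle_ineq[of "u - z" z] by simp
      then show "u \<in> ball 0 1" using r by (simp add: r_def field_simps)
    qed
    have "cmod ((deriv ^^ 1) F z) \<le> fact 1 * (C * A * r powr (-e)) / r ^ 1"
    proof (rule Cauchy_inequality)
      show "F holomorphic_on ball z r" using sub ball_subset_cball by (intro holomorphic_on_subset[OF holF]) blast
      show "continuous_on (cball z r) F" using sub by (intro continuous_on_subset[OF holomorphic_on_imp_continuous_on[OF holF]])
      fix u assume u: "cmod (z - u) = r"
      then have "cmod u \<le> cmod z + r" using norm_triangle_ineq[of "u - z" z] by (simp add: norm_minus_commute)
      then have ur: "r \<le> 1 - cmod u" by (simp add: r_def field_simps)
      then have "cmod (F u) \<le> C * A * (1 - cmod u) powr (-e)" using r by (intro C(2)[OF F]) auto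
      also have "\<dots> \<le> C * A * r powr (-e)" using ur r e A C(1) by (intro mult_left_mono powr_mono2') auto
      finally show "cmod (F u) \<le> C * A * r powr (-e)" .
    qed (rule r)
    then have "cmod (deriv F z) \<le> C * A * (r powr (-e) / r)" by simp
    also have "r powr (-e) / r = r powr (-(e + 1))"
      using r powr_diff[of r "-e" 1] by simp
    also have "\<dots> = 2 powr (e + 1) * (1 - cmod z) powr (-(e+1))"
    proof -
      have "(x/2) powr (-c) = 2 powr c * x powr (-c)" if "x > 0" for x c :: real
        using that by (simp add: powr_divide powr_minus field_simps)
      from this[of "1 - cmod z" "e + 1"] show ?thesis unfolding r_def using z by simp
    qed
    finally show ?thesis by (simp add: mult_ac)
  qed
  then show ?thesis using C(1) unfolding e_def by (intro exI[of _ "C * 2 powr (\<alpha> + pinv p + 1)"]) simp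
qed

section \<open>Integration lowers the weight exponent by one\<close>

text \<open>The majorant \<phi> is a primitive of the bound on h along the radius, so a mean value
  inequality compares increments and no integral has to be computed.\<close>

lemma radial_growth:
  assumes der: "\<And>z. cmod z < 1 \<Longrightarrow> (F has_field_derivative h z) (at z)" and F0: "F 0 = 0"
    and bnd: "\<And>z. cmod z < 1 \<Longrightarrow> cmod (h z) \<le> A * (1 - cmod z) powr (-(\<gamma> + 1))"
    and \<gamma>: "0 < \<gamma>" and z: "cmod z < 1"
  shows "cmod (F z) \<le> A / \<gamma> * (1 - cmod z) powr (-\<gamma>)"
proof -
  have A: "0 \<le> A" using bnd[of 0] by (simp add: order_trans[OF norm_ge_zero])
  have sz: "cmod (of_real s * z) < 1" "s * cmod z < 1" if "0 \<le> s" "s \<le> 1" for s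
    using that z mult_left_le_one_le[of "cmod z" s] by (auto simp: norm_mult)
  define \<phi> where "\<phi> s = A / \<gamma> * (1 - s * cmod z) powr (-\<gamma>)" for s
  let ?f = "F \<circ> (\<lambda>s. of_real s * z)"
  have f': "(?f has_vector_derivative (z * h (of_real s * z))) (at s)" if "0 \<le> s" "s \<le> 1" for s
    by (rule field_vector_diff_chain_at) (auto intro!: derivative_eq_intros der sz that)
  have \<phi>': "(\<phi> has_vector_derivative (A * cmod z * (1 - s * cmod z) powr (-(\<gamma> + 1)))) (at s)"
    if "0 \<le> s" "s \<le> 1" for s
  proof -
    have eq: "-(\<gamma> + 1) = -\<gamma> - 1" by simp
    show ?thesis
      unfolding eq has_real_derivative_iff_has_vector_derivative[symmetric] \<phi>_def
      using sz[OF that] \<gamma> by (auto intro!: derivative_eq_intros simp: field_simps)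
  qed
  have "norm (?f 1 - ?f 0) \<le> \<phi> 1 - \<phi> 0"
  proof (rule differentiable_bound_general)
    show "continuous_on {0..1} ?f"
      using has_vector_derivative_continuous[OF f'] by (intro continuous_at_imp_continuous_on) fastforce
    show "continuous_on {0..1} \<phi>"
      using has_vector_derivative_continuous[OF \<phi>'] by (intro continuous_at_imp_continuous_on) fastforce
    show "norm (z * h (of_real s * z)) \<le> A * cmod z * (1 - s * cmod z) powr (-(\<gamma> + 1))" if "0 < s" "s < 1" for s
    proof -
      have "norm (z * h (of_real s * z)) = cmod z * cmod (h (of_real s * z))" by (simp add: norm_mult)
      also have "\<dots> \<le> cmod z * (A * (1 - cmod (of_real s * z)) powr (-(\<gamma> + 1)))"
        using that by (intro mult_left_mono bnd sz) auto
      finally show ?thesis using that by (simp add: norm_mult mult_ac)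
    qed
    show "(?f has_vector_derivative (z * h (of_real s * z))) (at s)" if "0 < s" "s < 1" for s
      using that by (intro f') auto
    show "(\<phi> has_vector_derivative (A * cmod z * (1 - s * cmod z) powr (-(\<gamma> + 1)))) (at s)" if "0 < s" "s < 1" for s
      using that by (intro \<phi>') auto
  qed simp
  also have "\<dots> \<le> \<phi> 1" using A \<gamma> by (simp add: \<phi>_def)
  finally show ?thesis by (simp add: F0 \<phi>_def)
qed

text \<open>Nothing is known about h outside the disk; the cutoff x < 0 makes the function jointly
  measurable on the whole plane, as Tonelli demands.\<close>

definition halfplane_powr :: "real \<Rightarrow> (complex \<Rightarrow> complex) \<Rightarrow> real \<Rightarrow> real \<Rightarrow> ennreal" where
  "halfplane_powr P h x y = ennreal (cmod (h (exp (Complex x y))) powr P) * indicator {..<0} x"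

text \<open>In logarithmic coordinates the sets \<open>|y - \<theta>| \<le> -x\<close> are the nontangential approach regions, so this
  dominates a weighted radial maximal function of \<open>|h|\<^sup>P\<close>, while its average over \<open>\<theta>\<close> is computed by Tonelli.\<close>
definition cone_integral :: "real \<Rightarrow> real \<Rightarrow> real \<Rightarrow> (complex \<Rightarrow> complex) \<Rightarrow> real \<Rightarrow> ennreal" where
  "cone_integral P e \<tau> h \<theta> =
     (\<integral>\<^sup>+x. (\<integral>\<^sup>+y. ennreal ((-x) powr e) * indicator {-2..-\<tau>/2} x * (if \<theta> + x \<le> y \<and> y \<le> \<theta> - x then 1 else 0) *
        halfplane_powr P h x y \<partial>lborel) \<partial>lborel)"

text \<open>Allowing arbitrary measurable coordinates u and v makes this usable as a measurability
  rule under any nesting of the integration variables.\<close>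

lemma halfplane_powr_measurable:
  assumes "continuous_on (ball 0 1) h" "0 < P"
    and "u \<in> borel_measurable M" "v \<in> borel_measurable M"
  shows "(\<lambda>w. halfplane_powr P h (u w) (v w)) \<in> borel_measurable M"
proof -
  let ?A = "{..<0::real} \<times> (UNIV :: real set)"
  let ?f = "\<lambda>z. cmod (h (exp (Complex (fst z) (snd z)))) powr P"
  have "continuous_on ?A (\<lambda>z. exp (Complex (fst z) (snd z)))"
    unfolding Complex_eq by (intro continuous_intros)
  moreover have "(\<lambda>z. exp (Complex (fst z) (snd z))) ` ?A \<subseteq> ball 0 1" by auto
  ultimately have "continuous_on ?A (\<lambda>z. h (exp (Complex (fst z) (snd z))))"
    using assms(1) continuous_on_compose2 by blast
  then have "continuous_on ?A ?f"
    using assms(2) by (intro continuous_on_powr') (auto intro!: continuous_intros)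
  moreover have "?A \<in> sets borel" by (intro borel_open open_Times) auto
  ultimately have "(\<lambda>z. indicator ?A z *\<^sub>R ?f z) \<in> borel_measurable borel"
    by (rule borel_measurable_continuous_on_indicator[rotated])
  then have "(\<lambda>z. ennreal (indicator ?A z *\<^sub>R ?f z)) \<in> borel_measurable (borel \<Otimes>\<^sub>M borel)"
    unfolding borel_prod by measurable
  also have "(\<lambda>z. ennreal (indicator ?A z *\<^sub>R ?f z)) = (\<lambda>z. halfplane_powr P h (fst z) (snd z))"
    by (auto simp: indicator_def fun_eq_iff mem_Times_iff halfplane_powr_def)
  finally have *: "(\<lambda>z. halfplane_powr P h (fst z) (snd z)) \<in> borel_measurable (borel \<Otimes>\<^sub>M borel)" .
  have "(\<lambda>w. (u w, v w)) \<in> M \<rightarrow>\<^sub>M (borel \<Otimes>\<^sub>M borel)" using assms(3,4) by measurable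
  from measurable_compose[OF this *] show ?thesis by simp
qed

text \<open>After Tonelli the integral over \<theta> is innermost. For fixed x and y the vertices of
  cones containing the point form an interval of length -2x, so averaging over vertices yields one
  extra power of -x and leaves means over circles.\<close>

lemma nn_integral_cone_integral_le:
  assumes h: "continuous_on (ball 0 1) h" and P: "0 < P" and \<tau>: "0 < \<tau>"
  shows "(\<integral>\<^sup>+\<theta>\<in>{0..2*pi}. cone_integral P e \<tau> h \<theta> \<partial>lborel)
    \<le> (\<integral>\<^sup>+x\<in>{-2..-\<tau>/2}. ennreal ((-x) powr e * (-2*x)) * (3 * circ_integral P (exp x) h) \<partial>lborel)"
proof -
  note [measurable (raw)] = halfplane_powr_measurable[OF h P]
  let ?k = "\<lambda>x. ennreal ((-x) powr e) * indicator {-2..-\<tau>/2} x"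
  let ?K = "\<lambda>\<theta> x y. ?k x * (if \<theta> + x \<le> y \<and> y \<le> \<theta> - x then 1 else 0) * halfplane_powr P h x y"
  have "(\<integral>\<^sup>+\<theta>\<in>{0..2*pi}. cone_integral P e \<tau> h \<theta> \<partial>lborel) =
      (\<integral>\<^sup>+\<theta>. (\<integral>\<^sup>+x. (\<integral>\<^sup>+y. ?K \<theta> x y * indicator {0..2*pi} \<theta> \<partial>lborel) \<partial>lborel) \<partial>lborel)"
    unfolding cone_integral_def by (simp add: nn_integral_multc)
  also have "\<dots> = (\<integral>\<^sup>+x. (\<integral>\<^sup>+\<theta>. (\<integral>\<^sup>+y. ?K \<theta> x y * indicator {0..2*pi} \<theta> \<partial>lborel) \<partial>lborel) \<partial>lborel)"
    by (rule lborel_pair.Fubini') measurable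
  also have "\<dots> = (\<integral>\<^sup>+x. (\<integral>\<^sup>+y. (\<integral>\<^sup>+\<theta>. ?K \<theta> x y * indicator {0..2*pi} \<theta> \<partial>lborel) \<partial>lborel) \<partial>lborel)"
    by (intro nn_integral_cong lborel_pair.Fubini') measurable
  also have "\<dots> \<le> (\<integral>\<^sup>+x\<in>{-2..-\<tau>/2}. ennreal ((-x) powr e * (-2*x)) * (3 * circ_integral P (exp x) h) \<partial>lborel)"
  proof (rule nn_integral_mono)
    fix x :: real
    show "(\<integral>\<^sup>+y. (\<integral>\<^sup>+\<theta>. ?K \<theta> x y * indicator {0..2*pi} \<theta> \<partial>lborel) \<partial>lborel)
       \<le> ennreal ((-x) powr e * (-2*x)) * (3 * circ_integral P (exp x) h) * indicator {-2..-\<tau>/2} x"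
    proof (cases "x \<in> {-2..-\<tau>/2}")
      case True
      then have x: "x < 0" "-2 \<le> x" using \<tau> by auto
      have "(\<integral>\<^sup>+y. (\<integral>\<^sup>+\<theta>. ?K \<theta> x y * indicator {0..2*pi} \<theta> \<partial>lborel) \<partial>lborel) \<le>
        (\<integral>\<^sup>+y. ennreal ((-x) powr e * (-2*x)) * (ennreal (cmod (h (exp (Complex x y))) powr P) * indicator {-2*pi..4*pi} y) \<partial>lborel)"
      proof (rule nn_integral_mono)
        fix y :: real
        let ?c = "ennreal ((-x) powr e) * (ennreal (cmod (h (exp (Complex x y))) powr P) * indicator {-2*pi..4*pi} y)"
        \<comment> \<open>Since |y - \<theta>| \<le> -x \<le> 2 < 2 pi, only y in the window
          [-2 pi, 4 pi] contribute.\<close>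
        have "(\<integral>\<^sup>+\<theta>. ?K \<theta> x y * indicator {0..2*pi} \<theta> \<partial>lborel) \<le> (\<integral>\<^sup>+\<theta>. ?c * indicator {y+x..y-x} \<theta> \<partial>lborel)"
          using x pi_gt3 by (intro nn_integral_mono) (auto simp: indicator_def halfplane_powr_def)
        also have "\<dots> = ?c * ennreal (-2*x)"
          using x by (simp add: nn_integral_cmult_indicator)
        also have "\<dots> = ennreal ((-x) powr e * (-2*x)) * (ennreal (cmod (h (exp (Complex x y))) powr P) * indicator {-2*pi..4*pi} y)"
          using x by (subst ennreal_mult) (auto simp: mult_ac)
        finally show "(\<integral>\<^sup>+\<theta>. ?K \<theta> x y * indicator {0..2*pi} \<theta> \<partial>lborel) \<le> \<dots>" .
      qed
      also have "\<dots> = ennreal ((-x) powr e * (-2*x)) * (\<integral>\<^sup>+y\<in>{-2*pi..4*pi}. ennreal (cmod (h (exp (Complex x y))) powr P) \<partial>lborel)"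
      proof (rule nn_integral_cmult)
        have "(\<lambda>y. halfplane_powr P h x y * indicator {-2*pi..4*pi} y) \<in> borel_measurable lborel" by measurable
        then show "(\<lambda>y. ennreal (cmod (h (exp (Complex x y))) powr P) * indicator {-2*pi..4*pi} y) \<in> borel_measurable lborel"
          using x by (simp add: halfplane_powr_def)
      qed
      also have "\<dots> \<le> ennreal ((-x) powr e * (-2*x)) * (3 * circ_integral P (exp x) h)"
        using circ_integral_arc_le[OF h x(1) P, of "-2*pi" "4*pi"] by (intro mult_left_mono) auto
      finally show ?thesis using True by simp
    qed simp
  qed
  finally show ?thesis .
qed

text \<open>The square of half-side \<sigma>/2 around (-\<sigma>, \<theta>) lies in the cone and in
  the strip -2 \<le> x \<le> -\<tau>/2. On it -x stays between \<sigma>/2 and 3\<sigma>/2, so the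
  weight enters the integral at a cost of 2^|e|; the factor 4 undoes (\<sigma>/2)^2.\<close>

lemma cone_integral_ge:
  assumes hol: "h holomorphic_on ball 0 1" and P: "0 < P" and \<tau>: "0 < \<tau>"
    and C: "\<And>G w R S. 0 < R \<Longrightarrow> open S \<Longrightarrow> cball w R \<subseteq> S \<Longrightarrow> G holomorphic_on S \<Longrightarrow>
      ennreal (R\<^sup>2 * cmod (G w) powr P) \<le> ennreal C * square_integral P G w R"
    and \<sigma>: "\<tau> \<le> \<sigma>" "\<sigma> \<le> 1"
  shows "ennreal (\<sigma> powr (e + 2) * cmod (h (exp (Complex (-\<sigma>) \<theta>))) powr P)
    \<le> ennreal (4 * 2 powr \<bar>e\<bar>) * ennreal C * cone_integral P e \<tau> h \<theta>"
proof -
  have h: "continuous_on (ball 0 1) h" using hol by (rule holomorphic_on_imp_continuous_on)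
  note [measurable (raw)] = halfplane_powr_measurable[OF h P]
  let ?H = "\<lambda>w. h (exp w)"
  define w where "w = Complex (-\<sigma>) \<theta>"
  define R where "R = \<sigma>/2"
  have R: "0 < R" "R < \<sigma>" using \<sigma> \<tau> by (auto simp: R_def)
  have sub: "cball w R \<subseteq> {w. Re w < 0}"
  proof
    fix u assume "u \<in> cball w R"
    then have "cmod (u - w) \<le> R" by (simp add: dist_norm norm_minus_commute)
    then have "Re u - Re w \<le> R" using abs_Re_le_cmod[of "u - w"] by simp
    then show "u \<in> {w. Re w < 0}" using R by (simp add: w_def)
  qed
  have "ennreal (R\<^sup>2 * cmod (?H w) powr P) \<le> ennreal C * square_integral P ?H w R"
    by (intro C[OF R(1) open_halfspace_Re_lt sub] holomorphic_on_exp_halfplane hol)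
  then have "ennreal (\<sigma> powr e) * ennreal (R\<^sup>2 * cmod (?H w) powr P) \<le> ennreal C * (ennreal (\<sigma> powr e) * square_integral P ?H w R)"
    by (metis mult.left_commute mult_left_mono zero_le)
  also have "ennreal (\<sigma> powr e) * square_integral P ?H w R \<le> ennreal (2 powr \<bar>e\<bar>) * cone_integral P e \<tau> h \<theta>"
  proof -
    have pw: "\<sigma> powr e \<le> 2 powr \<bar>e\<bar> * (-x) powr e" if "-3*\<sigma>/2 \<le> x" "x \<le> -\<sigma>/2" for x
    proof (cases "0 \<le> e")
      case True
      have "\<sigma> powr e \<le> (2 * (-x)) powr e" using that \<sigma> \<tau> True by (intro powr_mono2) auto
      then show ?thesis using True by (simp only: powr_mult abs_of_nonneg)
    next
      case False
      have "\<sigma> powr e \<le> ((-x) / 2) powr e" using that \<sigma> \<tau> False by (intro powr_mono2') auto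
      also have "\<dots> = (-x) powr e / 2 powr e" by (rule powr_divide)
      finally show ?thesis using False by (simp add: powr_minus_divide)
    qed
    have "ennreal (\<sigma> powr e) * square_integral P ?H w R = ennreal (\<sigma> powr e) *
       (\<integral>\<^sup>+x\<in>{Re w - R..Re w + R}. (\<integral>\<^sup>+y\<in>{Im w - R..Im w + R}. halfplane_powr P h x y \<partial>lborel) \<partial>lborel)"
      unfolding square_integral_def
    proof (intro arg_cong2[where f = "(*)"] refl, rule nn_integral_cong)
      fix x :: real
      show "(\<integral>\<^sup>+y\<in>{Im w - R..Im w + R}. ennreal (cmod (h (exp (Complex x y))) powr P) \<partial>lborel) * indicator {Re w - R..Re w + R} x
         = (\<integral>\<^sup>+y\<in>{Im w - R..Im w + R}. halfplane_powr P h x y \<partial>lborel) * indicator {Re w - R..Re w + R} x"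
        using R by (cases "x \<in> {Re w - R..Re w + R}") (auto simp: halfplane_powr_def w_def)
    qed
    also have "\<dots> = (\<integral>\<^sup>+x. (\<integral>\<^sup>+y. ennreal (\<sigma> powr e) * (halfplane_powr P h x y * indicator {Im w - R..Im w + R} y * indicator {Re w - R..Re w + R} x) \<partial>lborel) \<partial>lborel)"
      by (simp add: nn_integral_multc nn_integral_cmult)
    also have "\<dots> \<le> (\<integral>\<^sup>+x. (\<integral>\<^sup>+y. ennreal (2 powr \<bar>e\<bar>) * (ennreal ((-x) powr e) * indicator {-2..-\<tau>/2} x *
        (if \<theta> + x \<le> y \<and> y \<le> \<theta> - x then 1 else 0) * halfplane_powr P h x y) \<partial>lborel) \<partial>lborel)"
    proof (intro nn_integral_mono)
      fix x y :: real
      show "ennreal (\<sigma> powr e) * (halfplane_powr P h x y * indicator {Im w - R..Im w + R} y * indicator {Re w - R..Re w + R} x)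
        \<le> ennreal (2 powr \<bar>e\<bar>) * (ennreal ((-x) powr e) * indicator {-2..-\<tau>/2} x *
        (if \<theta> + x \<le> y \<and> y \<le> \<theta> - x then 1 else 0) * halfplane_powr P h x y)"
      proof (cases "y \<in> {Im w - R..Im w + R} \<and> x \<in> {Re w - R..Re w + R}")
        case True
        then have *: "-3*\<sigma>/2 \<le> x" "x \<le> -\<sigma>/2" "\<theta> + x \<le> y" "y \<le> \<theta> - x" "-2 \<le> x" "x \<le> -\<tau>/2"
          using \<sigma> by (auto simp: w_def R_def)
        have "ennreal (\<sigma> powr e) * halfplane_powr P h x y \<le> ennreal (2 powr \<bar>e\<bar> * (-x) powr e) * halfplane_powr P h x y"
          using * by (intro mult_right_mono ennreal_leI pw) auto
        then show ?thesis using True * by (simp add: ennreal_mult mult_ac)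
      qed auto
    qed
    also have "\<dots> = ennreal (2 powr \<bar>e\<bar>) * cone_integral P e \<tau> h \<theta>"
      unfolding cone_integral_def by (simp add: nn_integral_cmult)
    finally show ?thesis .
  qed
  finally have "ennreal (\<sigma> powr e) * ennreal (R\<^sup>2 * cmod (?H w) powr P) \<le>
     ennreal C * (ennreal (2 powr \<bar>e\<bar>) * cone_integral P e \<tau> h \<theta>)"
    by (simp add: mult_left_mono)
  then have "ennreal 4 * (ennreal (\<sigma> powr e) * ennreal (R\<^sup>2 * cmod (?H w) powr P)) \<le>
     ennreal 4 * (ennreal C * (ennreal (2 powr \<bar>e\<bar>) * cone_integral P e \<tau> h \<theta>))"
    by (rule mult_left_mono) simp
  moreover have "ennreal 4 * (ennreal (\<sigma> powr e) * ennreal (R\<^sup>2 * cmod (?H w) powr P)) =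
      ennreal (\<sigma> powr (e + 2) * cmod (h (exp (Complex (-\<sigma>) \<theta>))) powr P)"
    using \<sigma> \<tau> by (simp add: ennreal_mult[symmetric] powr_add R_def w_def power2_eq_square mult_ac
       del: ennreal_numeral)
  moreover have "ennreal 4 * (ennreal C * (ennreal (2 powr \<bar>e\<bar>) * cone_integral P e \<tau> h \<theta>)) =
      ennreal (4 * 2 powr \<bar>e\<bar>) * ennreal C * cone_integral P e \<tau> h \<theta>"
    by (subst ennreal_mult) (auto simp: mult_ac)
  ultimately show ?thesis by simp
qed

lemma one_le_powr_minus:
  fixes x a :: real
  assumes "0 < x" "x \<le> 1" "0 \<le> a"
  shows "1 \<le> x powr (-a)"
  using powr_mono2'[of "-a" x 1] assms by simp

text \<open>With e + 2 = (1 + \<delta>) P, the P-th root of the cone bound controls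
  (-x)^(1+\<delta>) |h| by one number S along the whole radius from exp(-1) to exp(-\<tau>). There
  |h| is at most the derivative of S/\<delta> * (-x)^(-\<delta>), and integrating this majorant
  bounds F pointwise; the L^P mean is taken only afterwards.\<close>

lemma radial_powr_le_cone_integral:
  assumes hol: "h holomorphic_on ball 0 1" and P: "0 < P" and \<tau>: "0 < \<tau>" "\<tau> < 1" and \<delta>: "0 < \<delta>"
    and C: "0 < C" "\<And>G w R S. 0 < R \<Longrightarrow> open S \<Longrightarrow> cball w R \<subseteq> S \<Longrightarrow> G holomorphic_on S \<Longrightarrow>
      ennreal (R\<^sup>2 * cmod (G w) powr P) \<le> ennreal C * square_integral P G w R"
    and der: "\<And>z. cmod z < 1 \<Longrightarrow> (F has_field_derivative h z) (at z)"
    and B: "\<And>z. cmod z = exp (-1) \<Longrightarrow> cmod (F z) \<le> B" "0 \<le> B"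
    and e: "e + 2 = (1 + \<delta>) * P"
  shows "ennreal (cmod (F (of_real (exp (-\<tau>)) * cis \<theta>)) powr P) \<le> ennreal (2 powr P * B powr P) +
     ennreal (2 powr P * (\<tau> powr (-\<delta>) / \<delta>) powr P) * (ennreal (4 * 2 powr \<bar>e\<bar>) * ennreal C * cone_integral P e \<tau> h \<theta>)"
proof (cases "cone_integral P e \<tau> h \<theta> = \<infinity>")
  case True
  have "ennreal (2 powr P * (\<tau> powr (-\<delta>) / \<delta>) powr P) * (ennreal (4 * 2 powr \<bar>e\<bar>) * ennreal C * \<infinity>) = \<infinity>"
    using \<tau> \<delta> C(1) by (simp add: ennreal_mult_eq_top_iff)
  then show ?thesis unfolding True by simp
next
  case False
  let ?T = "ennreal (4 * 2 powr \<bar>e\<bar>) * ennreal C * cone_integral P e \<tau> h \<theta>"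
  have "?T \<noteq> \<infinity>" using False by (simp add: ennreal_mult_eq_top_iff)
  then obtain T where T: "?T = ennreal T" "0 \<le> T" by (cases ?T) auto
  define S where "S = T powr (1/P)"
  have S: "0 \<le> S" "S powr P = T" using P T by (auto simp: S_def powr_powr)
  have hb: "cmod (h (exp (Complex x \<theta>))) \<le> S * (-x) powr (-\<delta> - 1)" if x: "-1 \<le> x" "x \<le> -\<tau>" for x
  proof -
    have "ennreal ((-x) powr (e + 2) * cmod (h (exp (Complex (-(-x)) \<theta>))) powr P) \<le> ?T"
      by (rule cone_integral_ge[OF hol P \<tau>(1)]) (fact C(2), use x in auto)
    then have "ennreal ((-x) powr (e + 2) * cmod (h (exp (Complex x \<theta>))) powr P) \<le> ennreal T"
      unfolding T(1) by simp
    then have "(-x) powr ((1 + \<delta>) * P) * cmod (h (exp (Complex x \<theta>))) powr P \<le> T"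
      using T e by (simp add: ennreal_le_iff)
    then have "((-x) powr (1 + \<delta>) * cmod (h (exp (Complex x \<theta>)))) powr P \<le> S powr P"
      unfolding S powr_mult powr_powr .
    then have "(-x) powr (1 + \<delta>) * cmod (h (exp (Complex x \<theta>))) \<le> S"
      using P S(1) by (metis not_le powr_less_mono2)
    moreover have eq: "(-x) powr (-\<delta> - 1) = 1 / (-x) powr (1 + \<delta>)"
    proof -
      have "-\<delta> - 1 = -(1 + \<delta>)" by simp
      then show ?thesis by (simp only: powr_minus_divide)
    qed
    ultimately show ?thesis unfolding eq using x \<tau> by (simp add: pos_le_divide_eq mult.commute)
  qed
  define \<phi> where "\<phi> x = S / \<delta> * (-x) powr (-\<delta>)" for x
  let ?u = "F \<circ> (\<lambda>x. exp (Complex x \<theta>))"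
  let ?u' = "\<lambda>x. exp (Complex x \<theta>) * h (exp (Complex x \<theta>))"
  have u': "(?u has_vector_derivative ?u' x) (at x)" if "x < 0" for x
  proof (rule field_vector_diff_chain_at)
    have "((\<lambda>x. of_real x + \<i> * of_real \<theta>) has_vector_derivative 1) (at x)"
      by (auto intro!: derivative_eq_intros)
    from field_vector_diff_chain_at[OF this DERIV_exp]
    show "((\<lambda>x. exp (Complex x \<theta>)) has_vector_derivative exp (Complex x \<theta>)) (at x)"
      by (simp add: o_def Complex_eq)
    show "(F has_field_derivative h (exp (Complex x \<theta>))) (at (exp (Complex x \<theta>)))"
      using that by (intro der) simp
  qed
  have \<phi>': "(\<phi> has_vector_derivative S * (-x) powr (-\<delta> - 1)) (at x)" if "x < 0" for x
    unfolding has_real_derivative_iff_has_vector_derivative[symmetric] \<phi>_def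
    using that \<delta> by (auto intro!: derivative_eq_intros simp: field_simps)
  have "norm (?u (-\<tau>) - ?u (-1)) \<le> \<phi> (-\<tau>) - \<phi> (-1)"
  proof (rule differentiable_bound_general)
    show "continuous_on {-1..-\<tau>} ?u"
      using has_vector_derivative_continuous[OF u'] \<tau> by (intro continuous_at_imp_continuous_on) fastforce
    show "continuous_on {-1..-\<tau>} \<phi>"
      using has_vector_derivative_continuous[OF \<phi>'] \<tau> by (intro continuous_at_imp_continuous_on) fastforce
    fix x assume x: "-1 < x" "x < -\<tau>"
    show "(?u has_vector_derivative ?u' x) (at x)" using x \<tau> by (intro u') auto
    show "(\<phi> has_vector_derivative S * (-x) powr (-\<delta> - 1)) (at x)" using x \<tau> by (intro \<phi>') auto
    have "norm (?u' x) \<le> 1 * norm (h (exp (Complex x \<theta>)))"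
      unfolding norm_mult using x \<tau> by (intro mult_right_mono) auto
    also have "\<dots> \<le> S * (-x) powr (-\<delta> - 1)" using hb[of x] x by simp
    finally show "norm (?u' x) \<le> S * (-x) powr (-\<delta> - 1)" .
  qed (use \<tau> in auto)
  moreover have "cmod (?u (-1)) \<le> B" using B(1)[of "exp (Complex (-1) \<theta>)"] by simp
  moreover have "0 \<le> \<phi> (-1)" using S \<delta> by (simp add: \<phi>_def)
  ultimately have "cmod (?u (-\<tau>)) \<le> B + \<phi> (-\<tau>)"
    using norm_triangle_ineq2[of "?u (-\<tau>)" "?u (-1)"] by linarith
  then have "cmod (?u (-\<tau>)) powr P \<le> (B + \<phi> (-\<tau>)) powr P"
    using P by (intro powr_mono2) auto
  also have "\<dots> \<le> 2 powr P * B powr P + 2 powr P * \<phi> (-\<tau>) powr P"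
    using B(2) S \<delta> P by (intro powr_add_le) (auto simp: \<phi>_def)
  also have "\<phi> (-\<tau>) powr P = (\<tau> powr (-\<delta>) / \<delta>) powr P * T"
  proof -
    have "\<phi> (-\<tau>) = (\<tau> powr (-\<delta>) / \<delta>) * S" by (simp add: \<phi>_def)
    then show ?thesis by (simp only: powr_mult S)
  qed
  finally have "cmod (?u (-\<tau>)) powr P \<le> 2 powr P * B powr P + 2 powr P * (\<tau> powr (-\<delta>) / \<delta>) powr P * T"
    by (simp add: mult_ac)
  then have "ennreal (cmod (?u (-\<tau>)) powr P) \<le> ennreal (2 powr P * B powr P + 2 powr P * (\<tau> powr (-\<delta>) / \<delta>) powr P * T)"
    by (rule ennreal_leI)
  also have "\<dots> = ennreal (2 powr P * B powr P) + ennreal (2 powr P * (\<tau> powr (-\<delta>) / \<delta>) powr P) * ennreal T"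
    using T(2) by (simp add: ennreal_mult)
  finally show ?thesis unfolding T(1) by (simp add: exp_eq_polar)
qed

lemma nn_integral_powr_le:
  assumes "0 < \<tau>" "\<tau> < 1" "0 < \<eta>"
  shows "(\<integral>\<^sup>+x\<in>{-2..-\<tau>/2}. ennreal ((-x) powr (-\<eta> - 1)) \<partial>lborel) \<le> ennreal ((\<tau>/2) powr (-\<eta>) / \<eta>)"
proof -
  let ?F = "\<lambda>x. (-x) powr (-\<eta>) / \<eta>"
  have "(\<integral>\<^sup>+x\<in>{-2..-\<tau>/2}. ennreal ((-x) powr (-\<eta> - 1)) \<partial>lborel) = ?F (-\<tau>/2) - ?F (-2)"
  proof (rule nn_integral_FTC_Icc)
    fix x assume "x \<in> {-2..-\<tau>/2}"
    then have "x < 0" using assms by auto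
    then show "(?F has_real_derivative (-x) powr (-\<eta> - 1)) (at x)"
      using assms by (auto intro!: derivative_eq_intros simp: field_simps)
  qed (use assms in auto)
  also have "\<dots> \<le> ennreal ((\<tau>/2) powr (-\<eta>) / \<eta>)"
    using assms by (intro ennreal_leI) simp
  finally show ?thesis .
qed

text \<open>This does the work of Minkowski's integral inequality for every P > 0. Averaging the
  pointwise cone bound leaves the integral of (-x)^(-\<eta>-1) over x \<le> -\<tau>/2, of order
  \<tau>^(-\<eta>), times the factor \<tau>^(-\<delta> P) from the radial integration.\<close>

lemma integral_Hle_ereal:
  assumes P: "0 < P" and \<alpha>: "0 < \<alpha>"
  shows "\<exists>K>0. \<forall>A F h. Hle (ereal P) (\<alpha> + 1) A h \<longrightarrow> (\<forall>z. cmod z < 1 \<longrightarrow> (F has_field_derivative h z) (at z)) \<longrightarrow>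
     F 0 = 0 \<longrightarrow> Hle (ereal P) \<alpha> (K * A) F"
proof -
  define \<gamma> where "\<gamma> = \<alpha> + 1/P"
  have \<gamma>: "0 < \<gamma>" using P \<alpha> by (simp add: \<gamma>_def add_pos_pos)
  obtain C0 where C0: "C0 > 0" "\<And>A h z. Hle (ereal P) (\<alpha> + 1) A h \<Longrightarrow> cmod z < 1 \<Longrightarrow>
      cmod (h z) \<le> C0 * A * (1 - cmod z) powr (-((\<alpha> + 1) + pinv (ereal P)))"
    using pointwise_growth[of "ereal P" "\<alpha> + 1"] P \<alpha> by auto
  have exq: "-((\<alpha> + 1) + pinv (ereal P)) = -(\<gamma> + 1)" by (simp add: \<gamma>_def pinv_def)
  obtain C where C: "C > 0" "\<And>G w R S. 0 < R \<Longrightarrow> open S \<Longrightarrow> cball w R \<subseteq> S \<Longrightarrow> G holomorphic_on S \<Longrightarrow>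
    ennreal (R\<^sup>2 * cmod (G w) powr P) \<le> ennreal C * square_integral P G w R"
    using local_powr_le_square_integral[OF P] by meson
  \<comment> \<open>The radial integration and the cone integral each cost \<tau>^(-\<delta> P);
    with \<delta> = \<alpha>/2 they add up to \<tau>^(-\<alpha> P). The choice of e turns the
    exponent -(\<alpha>+1) P + e + 1 into -\<eta> - 1.\<close>
  define \<delta> where "\<delta> = \<alpha> / 2"
  define e where "e = (1 + \<delta>) * P - 2"
  define \<eta> where "\<eta> = \<delta> * P"
  define B0 where "B0 = C0 / \<gamma> * 2 powr \<gamma>"
  define c1 where "c1 = 4 * 2 powr \<bar>e\<bar> * C"
  define c3 where "c3 = 12 * pi * 4 powr ((\<alpha> + 1) * P)"
  \<comment> \<open>D adds the coefficients of A^P \<tau>^(-\<alpha> P) from the starting value on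
    the circle of radius exp(-1) and from the cone term.\<close>
  define D where "D = 2*pi * 2 powr P * B0 powr P + 2 powr P * \<delta> powr (-P) * c1 * c3 * 2 powr \<eta> / \<eta>"
  define K where "K = (D / (2*pi)) powr (1/P) + B0"
  have pos: "0 < \<delta>" "0 < \<eta>" "0 < B0" "0 < c1" "0 < c3"
    using \<alpha> P C0(1) C(1) \<gamma> by (auto simp: \<delta>_def \<eta>_def B0_def c1_def c3_def)
  have D: "0 < D" unfolding D_def using pos by (intro add_pos_pos divide_pos_pos mult_pos_pos) auto
  have "Hle (ereal P) \<alpha> (K * A) F"
    if h: "Hle (ereal P) (\<alpha> + 1) A h" and der: "\<And>z. cmod z < 1 \<Longrightarrow> (F has_field_derivative h z) (at z)" and F0: "F 0 = 0" for A F h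
  proof -
    have A: "0 \<le> A" by (rule Hle_nonneg[OF h])
    have hol: "h holomorphic_on ball 0 1" using h by (simp add: Hle_def)
    have ch: "continuous_on (ball 0 1) h" using hol by (rule holomorphic_on_imp_continuous_on)
    have holF: "F holomorphic_on ball 0 1"
      unfolding holomorphic_on_open[OF open_ball] by (auto intro!: exI der)
    have cF: "continuous_on (ball 0 1) F" using holF by (rule holomorphic_on_imp_continuous_on)
    \<comment> \<open>Covers the small radii and, because exp(-1) \<le> 1/2, the starting point of
      every radial integration.\<close>
    have Fb: "cmod (F z) \<le> B0 * A" if z: "cmod z \<le> 1/2" for z
    proof -
      have "cmod (F z) \<le> C0 * A / \<gamma> * (1 - cmod z) powr (-\<gamma>)"
        using C0(2)[OF h, unfolded exq] z by (intro radial_growth[OF der F0 _ \<gamma>]) auto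
      also have "\<dots> \<le> C0 * A / \<gamma> * (1/2) powr (-\<gamma>)"
        using z \<gamma> A C0(1) by (intro mult_left_mono powr_mono2') auto
      also have "\<dots> = B0 * A" by (simp add: B0_def powr_divide powr_minus_divide)
      finally show ?thesis .
    qed
    have e1: "exp (-1) \<le> (1/2 :: real)" using exp_minus_le[of 1] by simp
    have large: "Mp (ereal P) (exp (-\<tau>)) F \<le> (D / (2*pi)) powr (1/P) * A * \<tau> powr (-\<alpha>)" if \<tau>: "0 < \<tau>" "\<tau> < 1" for \<tau>
    proof -
      let ?b = "ennreal (2 powr P * (B0 * A) powr P)"
      let ?t = "2 powr P * (\<tau> powr (-\<delta>) / \<delta>) powr P"
      have [measurable]: "cone_integral P e \<tau> h \<in> borel_measurable borel"
      proof -
        note [measurable (raw)] = halfplane_powr_measurable[OF ch P]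
        have "(\<lambda>\<theta>. cone_integral P e \<tau> h \<theta>) \<in> borel_measurable borel"
          unfolding cone_integral_def by measurable
        then show ?thesis by simp
      qed
      have cone: "(\<integral>\<^sup>+\<theta>\<in>{0..2*pi}. cone_integral P e \<tau> h \<theta> \<partial>lborel) \<le> ennreal (c3 * A powr P * ((\<tau>/2) powr (-\<eta>) / \<eta>))"
      proof -
        have "(\<integral>\<^sup>+\<theta>\<in>{0..2*pi}. cone_integral P e \<tau> h \<theta> \<partial>lborel)
          \<le> (\<integral>\<^sup>+x\<in>{-2..-\<tau>/2}. ennreal ((-x) powr e * (-2*x)) * (3 * circ_integral P (exp x) h) \<partial>lborel)"
          by (rule nn_integral_cone_integral_le[OF ch P \<tau>(1)])
        also have "\<dots> \<le> (\<integral>\<^sup>+x. ennreal (c3 * A powr P) * (ennreal ((-x) powr (-\<eta> - 1)) * indicator {-2..-\<tau>/2} x) \<partial>lborel)"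
        proof (rule nn_integral_mono)
          fix x :: real
          show "ennreal ((-x) powr e * (-2*x)) * (3 * circ_integral P (exp x) h) * indicator {-2..-\<tau>/2} x
            \<le> ennreal (c3 * A powr P) * (ennreal ((-x) powr (-\<eta> - 1)) * indicator {-2..-\<tau>/2} x)"
          proof (cases "x \<in> {-2..-\<tau>/2}")
            case True
            then have x: "x < 0" "-2 \<le> x" using \<tau> by auto
            \<comment> \<open>x may reach -2, so it is halved to bring \<open>exp_minus_le\<close>
              into its range.\<close>
            have "exp x \<le> exp (- (-x/2))" using x by simp
            also have "\<dots> \<le> 1 - (-x/2)/2" using x by (intro exp_minus_le) auto
            finally have "-x/4 \<le> 1 - exp x" by simp
            then have *: "(1 - exp x) powr (-(\<alpha> + 1)) \<le> (-x/4) powr (-(\<alpha> + 1))"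
              using x \<alpha> by (intro powr_mono2') auto
            have "circ_integral P (exp x) h \<le> ennreal (2*pi * (A * (1 - exp x) powr (-(\<alpha> + 1))) powr P)"
              using x by (intro Hle_circ_integral_le[OF h P]) auto
            also have "\<dots> \<le> ennreal (2*pi * (A * (-x/4) powr (-(\<alpha> + 1))) powr P)"
              using A P by (intro ennreal_leI mult_left_mono powr_mono2 mult_left_mono[OF *]) auto
            also have "(A * (-x/4) powr (-(\<alpha> + 1))) powr P = A powr P * 4 powr ((\<alpha> + 1) * P) * (-x) powr (-(\<alpha> + 1) * P)"
            proof -
              have "(-x/4) powr (-(\<alpha> + 1)) = 4 powr (\<alpha> + 1) * (-x) powr (-(\<alpha> + 1))"
                unfolding powr_divide[of "-x" 4] powr_minus_divide[of 4] by simp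
              then show ?thesis by (simp only: powr_mult powr_powr mult.assoc)
            qed
            finally have ci: "circ_integral P (exp x) h \<le> ennreal (2*pi * (A powr P * 4 powr ((\<alpha> + 1) * P) * (-x) powr (-(\<alpha> + 1) * P)))" .
            have "(-x) powr (-(\<alpha> + 1) * P) * ((-x) powr e * (-x)) = (-x) powr (-(\<alpha> + 1) * P + e + 1)"
              using x by (simp add: powr_add)
            also have "-(\<alpha> + 1) * P + e + 1 = -\<eta> - 1" by (simp add: e_def \<eta>_def \<delta>_def algebra_simps)
            finally have px: "(-x) powr (-(\<alpha> + 1) * P) * ((-x) powr e * (-x)) = (-x) powr (-\<eta> - 1)" .
            have "ennreal ((-x) powr e * (-2*x)) * (3 * circ_integral P (exp x) h) \<le>
               ennreal ((-x) powr e * (-2*x)) * (ennreal 3 * ennreal (2*pi * (A powr P * 4 powr ((\<alpha> + 1) * P) * (-x) powr (-(\<alpha> + 1) * P))))"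
              using ci by (intro mult_left_mono) (auto intro!: mult_left_mono)
            also have "\<dots> = ennreal (((-x) powr e * (-2*x)) * (3 * (2*pi * (A powr P * 4 powr ((\<alpha> + 1) * P) * (-x) powr (-(\<alpha> + 1) * P)))))"
              using x by (subst ennreal_mult[symmetric], simp, simp, subst ennreal_mult[symmetric]) (auto simp: mult_nonpos_nonneg)
            also have "((-x) powr e * (-2*x)) * (3 * (2*pi * (A powr P * 4 powr ((\<alpha> + 1) * P) * (-x) powr (-(\<alpha> + 1) * P))))
               = c3 * A powr P * ((-x) powr (-(\<alpha> + 1) * P) * ((-x) powr e * (-x)))" by (simp add: c3_def)
            also have "\<dots> = c3 * A powr P * (-x) powr (-\<eta> - 1)" by (simp only: px)
            also have "ennreal \<dots> = ennreal (c3 * A powr P) * ennreal ((-x) powr (-\<eta> - 1))"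
              using pos by (intro ennreal_mult) auto
            finally show ?thesis using True by simp
          qed simp
        qed
        also have "\<dots> = ennreal (c3 * A powr P) * (\<integral>\<^sup>+x\<in>{-2..-\<tau>/2}. ennreal ((-x) powr (-\<eta> - 1)) \<partial>lborel)"
          by (intro nn_integral_cmult) measurable
        also have "\<dots> \<le> ennreal (c3 * A powr P) * ennreal ((\<tau>/2) powr (-\<eta>) / \<eta>)"
          using nn_integral_powr_le[OF \<tau> pos(2)] by (intro mult_left_mono) auto
        also have "\<dots> = ennreal (c3 * A powr P * ((\<tau>/2) powr (-\<eta>) / \<eta>))"
          using pos by (intro ennreal_mult[symmetric]) auto
        finally show ?thesis .
      qed
      have "circ_integral P (exp (-\<tau>)) F \<le> (\<integral>\<^sup>+\<theta>. ?b * indicator {0..2*pi} \<theta> +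
          (ennreal ?t * ennreal c1) * (cone_integral P e \<tau> h \<theta> * indicator {0..2*pi} \<theta>) \<partial>lborel)"
        unfolding circ_integral_def
      proof (rule nn_integral_mono)
        fix \<theta> :: real
        have "ennreal (cmod (F (of_real (exp (-\<tau>)) * cis \<theta>)) powr P) \<le> ?b + ennreal ?t * (ennreal (4 * 2 powr \<bar>e\<bar>) * ennreal C * cone_integral P e \<tau> h \<theta>)"
          using pos A e1 by (intro radial_powr_le_cone_integral[OF hol P \<tau> pos(1) C der] Fb) (auto simp: e_def)
        then show "ennreal (cmod (F (of_real (exp (-\<tau>)) * cis \<theta>)) powr P) * indicator {0..2*pi} \<theta>
          \<le> ?b * indicator {0..2*pi} \<theta> + (ennreal ?t * ennreal c1) * (cone_integral P e \<tau> h \<theta> * indicator {0..2*pi} \<theta>)"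
          by (cases "\<theta> \<in> {0..2*pi}") (use C(1) in \<open>auto simp: c1_def ennreal_mult mult.assoc\<close>)
      qed
      also have "\<dots> = ?b * ennreal (2*pi) + (ennreal ?t * ennreal c1) * (\<integral>\<^sup>+\<theta>\<in>{0..2*pi}. cone_integral P e \<tau> h \<theta> \<partial>lborel)"
        by (subst nn_integral_add) (auto simp: nn_integral_cmult nn_integral_cmult_indicator)
      also have "\<dots> \<le> ?b * ennreal (2*pi) + (ennreal ?t * ennreal c1) * ennreal (c3 * A powr P * ((\<tau>/2) powr (-\<eta>) / \<eta>))"
        using cone by (intro add_left_mono mult_left_mono) auto
      also have "\<dots> = ennreal (2 powr P * (B0 * A) powr P * (2*pi) + ?t * c1 * (c3 * A powr P * ((\<tau>/2) powr (-\<eta>) / \<eta>)))"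
        using pos by (simp add: ennreal_mult[symmetric] flip: ennreal_plus)
      also have "\<dots> \<le> ennreal (D * A powr P * \<tau> powr (-\<alpha> * P))"
      proof (rule ennreal_leI)
        have 1: "1 \<le> \<tau> powr (-\<alpha> * P)"
          using one_le_powr_minus[of \<tau> "\<alpha> * P"] \<tau> \<alpha> P by simp
        have "2 powr P * (B0 * A) powr P * (2*pi) \<le> 2*pi * 2 powr P * B0 powr P * A powr P * \<tau> powr (-\<alpha> * P)"
          using 1 mult_left_mono[OF 1, of "2*pi * 2 powr P * B0 powr P * A powr P"] by (simp add: powr_mult mult_ac)
        moreover have "?t * c1 * (c3 * A powr P * ((\<tau>/2) powr (-\<eta>) / \<eta>)) =
           2 powr P * \<delta> powr (-P) * c1 * c3 * 2 powr \<eta> / \<eta> * A powr P * \<tau> powr (-\<alpha> * P)"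
        proof -
          have "(\<tau> powr (-\<delta>) / \<delta>) powr P = \<tau> powr (-\<eta>) * \<delta> powr (-P)"
            using \<tau> pos by (simp add: powr_divide powr_mult powr_powr powr_minus_divide \<eta>_def)
          moreover have "(\<tau>/2) powr (-\<eta>) = \<tau> powr (-\<eta>) * 2 powr \<eta>"
            unfolding powr_divide[of \<tau> 2] powr_minus_divide[of 2] by simp
          moreover have "\<tau> powr (-\<eta>) * \<tau> powr (-\<eta>) = \<tau> powr (-\<alpha> * P)"
            unfolding powr_add[symmetric] by (simp add: \<eta>_def \<delta>_def mult.commute)
          ultimately show ?thesis by (simp add: mult_ac)
        qed
        ultimately show "2 powr P * (B0 * A) powr P * (2*pi) + ?t * c1 * (c3 * A powr P * ((\<tau>/2) powr (-\<eta>) / \<eta>))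
           \<le> D * A powr P * \<tau> powr (-\<alpha> * P)" 
          unfolding D_def distrib_right by (rule add_mono[OF _ eq_refl])
      qed
      also have "D * A powr P * \<tau> powr (-\<alpha> * P) = 2*pi * ((D / (2*pi)) powr (1/P) * A * \<tau> powr (-\<alpha>)) powr P"
        using D P by (simp add: powr_mult powr_powr)
      finally show ?thesis
        using \<tau> A by (subst Mp_ereal_le_iff[OF cF _ _ P]) auto
    qed
    show ?thesis unfolding Hle_def
    proof (intro conjI holF ballI)
      fix r :: real assume r: "r \<in> {0..<1}"
      have r1: "1 \<le> (1 - r) powr (-\<alpha>)" using r \<alpha> by (intro one_le_powr_minus) auto
      show "Mp (ereal P) r F \<le> K * A * (1 - r) powr (-\<alpha>)"
      proof (cases "r \<le> exp (-1)")
        case True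
        have "Mp (ereal P) r F \<le> B0 * A"
          using r P A pos True e1 by (intro Mp_le_of_bound[OF cF] Fb) auto
        also have "\<dots> \<le> B0 * A * (1 - r) powr (-\<alpha>)"
          using mult_left_mono[OF r1, of "B0 * A"] pos A by simp
        also have "\<dots> \<le> K * A * (1 - r) powr (-\<alpha>)"
          using A by (intro mult_right_mono) (auto simp: K_def)
        finally show ?thesis .
      next
        case False
        define \<tau> where "\<tau> = - ln r"
        have r0: "0 < r" using False exp_gt_zero[of "-1::real"] by linarith
        have "ln (exp (-1)) < ln r" using False r0 by (subst ln_less_cancel_iff) auto
        then have \<tau>: "0 < \<tau>" "\<tau> < 1" "exp (-\<tau>) = r" using r r0 by (auto simp: \<tau>_def)
        have "1 - r \<le> \<tau>" using r0 ln_le_minus_one[of r] by (simp add: \<tau>_def)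
        then have t: "\<tau> powr (-\<alpha>) \<le> (1 - r) powr (-\<alpha>)" using r \<alpha> by (intro powr_mono2') auto
        have "Mp (ereal P) r F \<le> (D / (2*pi)) powr (1/P) * A * \<tau> powr (-\<alpha>)" using large[OF \<tau>(1,2)] \<tau>(3) by simp
        also have "\<dots> \<le> (D / (2*pi)) powr (1/P) * A * (1 - r) powr (-\<alpha>)"
          using t A by (intro mult_left_mono) auto
        also have "\<dots> \<le> K * A * (1 - r) powr (-\<alpha>)"
          using A pos by (intro mult_right_mono) (auto simp: K_def)
        finally show ?thesis .
      qed
    qed
  qed
  moreover have "K > 0" using pos D by (simp add: K_def add_pos_pos)
  ultimately show ?thesis by blast
qed

lemma integral_Hle:
  assumes "0 < p" "0 < \<alpha>"
  shows "\<exists>K>0. \<forall>A F h. Hle p (\<alpha> + 1) A h \<longrightarrow> (\<forall>z. cmod z < 1 \<longrightarrow> (F has_field_derivative h z) (at z)) \<longrightarrow>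
     F 0 = 0 \<longrightarrow> Hle p \<alpha> (K * A) F"
proof (cases p)
  case (real P)
  then show ?thesis using integral_Hle_ereal[of P \<alpha>] assms by simp
next
  case PInf
  have "Hle p \<alpha> ((1/\<alpha>) * A) F"
    if h: "Hle p (\<alpha> + 1) A h" and der: "\<And>z. cmod z < 1 \<Longrightarrow> (F has_field_derivative h z) (at z)" and F0: "F 0 = 0" for A F h
  proof -
    have hol: "F holomorphic_on ball 0 1"
      unfolding holomorphic_on_open[OF open_ball] by (auto intro!: exI der)
    have hb: "cmod (h z) \<le> A * (1 - cmod z) powr (-(\<alpha> + 1))" if "cmod z < 1" for z
    proof -
      have "Mp \<infinity> (cmod z) h \<le> A * (1 - cmod z) powr (-(\<alpha> + 1))"
        using h that PInf by (auto simp: Hle_def)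
      then show ?thesis
        using h that by (subst (asm) Mp_infinity_le_iff) (auto simp: Hle_def holomorphic_on_imp_continuous_on)
    qed
    show ?thesis unfolding Hle_def PInf
    proof (intro conjI hol ballI)
      fix r :: real assume "r \<in> {0..<1}"
      then show "Mp \<infinity> r F \<le> (1/\<alpha>) * A * (1 - r) powr (-\<alpha>)"
        using radial_growth[OF der F0 hb assms(2)] hol
        by (subst Mp_infinity_le_iff) (auto simp: holomorphic_on_imp_continuous_on)
    qed
  qed
  then show ?thesis using assms by (intro exI[of _ "1/\<alpha>"]) auto
qed (use assms in auto)

section \<open>Boundedness of \<open>Tg\<close> for Bloch symbols\<close>

lemma Tg_has_field_derivative:
  assumes g: "g holomorphic_on ball 0 1" and f: "f holomorphic_on ball 0 1"
  shows "cmod z < 1 \<Longrightarrow> (Tg g f has_field_derivative f z * deriv g z) (at z)" and "Tg g f 0 = 0"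
proof -
  have hol: "(\<lambda>z. f z * deriv g z) holomorphic_on ball 0 1"
    using f g by (intro holomorphic_intros holomorphic_deriv) auto
  obtain H where H: "\<And>x. x \<in> ball 0 1 \<Longrightarrow> (H has_field_derivative f x * deriv g x) (at x within ball 0 1)"
    using holomorphic_convex_primitive'[OF convex_ball open_ball hol] by blast
  have eq: "Tg g f z = H z - H 0" if "z \<in> ball 0 1" for z
  proof -
    have "path_image (linepath 0 z) \<subseteq> ball 0 1"
      using that by (simp add: closed_segment_subset)
    from contour_integral_unique[OF contour_integral_primitive[OF H valid_path_linepath this]]
    show ?thesis by (simp add: Tg_def)
  qed
  show "Tg g f 0 = 0" using eq[of 0] by simp
  assume z: "cmod z < 1"
  have "((\<lambda>z. H z - H 0) has_field_derivative f z * deriv g z) (at z)"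
    using H[of z] z by (auto intro!: derivative_eq_intros simp: at_within_open[of _ "ball 0 1"])
  then show "(Tg g f has_field_derivative f z * deriv g z) (at z)"
    by (rule has_field_derivative_transform_within_open[of _ _ _ "ball 0 1"]) (use z eq in auto)
qed

lemma Tg_diff:
  assumes g: "g holomorphic_on ball 0 1" and f: "f holomorphic_on ball 0 1" and h: "h holomorphic_on ball 0 1" and z: "cmod z < 1"
  shows "Tg g (\<lambda>z. f z - h z) z = Tg g f z - Tg g h z"
proof -
  have seg: "closed_segment 0 z \<subseteq> ball 0 1" using z by (simp add: closed_segment_subset)
  have "(\<lambda>\<zeta>. u \<zeta> * deriv g \<zeta>) contour_integrable_on linepath 0 z" if "u holomorphic_on ball 0 1" for u
  proof -
    have "(\<lambda>\<zeta>. u \<zeta> * deriv g \<zeta>) holomorphic_on ball 0 1"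
      using that g by (intro holomorphic_on_mult holomorphic_deriv) auto
    then have "continuous_on (closed_segment 0 z) (\<lambda>\<zeta>. u \<zeta> * deriv g \<zeta>)"
      using seg by (meson holomorphic_on_imp_continuous_on continuous_on_subset)
    then show ?thesis by (rule contour_integrable_continuous_linepath)
  qed
  from contour_integral_diff[OF this[OF f] this[OF h]] show ?thesis
    by (simp add: Tg_def left_diff_distrib)
qed

lemma Bloch_deriv_bound:
  assumes "g \<in> Bloch"
  obtains B where "0 < B" "\<And>z. cmod z < 1 \<Longrightarrow> cmod (deriv g z) \<le> B / (1 - cmod z)"
proof -
  have "\<exists>B0. \<forall>z\<in>ball 0 1. (1 - (cmod z)\<^sup>2) * cmod (deriv g z) \<le> B0"
    using assms by (auto simp: Bloch_def bdd_above_def)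
  then obtain B0 where B0: "\<And>z. z \<in> ball 0 1 \<Longrightarrow> (1 - (cmod z)\<^sup>2) * cmod (deriv g z) \<le> B0"
    by blast
  define B where "B = \<bar>B0\<bar> + 1"
  have "cmod (deriv g z) \<le> B / (1 - cmod z)" if "cmod z < 1" for z
  proof -
    have "(cmod z)\<^sup>2 \<le> cmod z" using that by (simp add: power2_eq_square mult_left_le)
    then have "(1 - cmod z) * cmod (deriv g z) \<le> (1 - (cmod z)\<^sup>2) * cmod (deriv g z)"
      by (intro mult_right_mono) auto
    also have "\<dots> \<le> B" using B0[of z] that by (simp add: B_def)
    finally show ?thesis using that by (simp add: field_simps)
  qed
  moreover have "0 < B" by (simp add: B_def)
  ultimately show ?thesis using that by blast
qed

text \<open>On a single circle |g'| is at most the constant B/(1 - r), so f g' obeys the bound with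
  weight \<alpha> + 1; integration gives the lost power back.\<close>

lemma Tg_Hle:
  assumes "0 < p" "0 < \<alpha>" "g \<in> Bloch"
  shows "\<exists>K>0. \<forall>A f. Hle p \<alpha> A f \<longrightarrow> Hle p \<alpha> (K * A) (Tg g f)"
proof -
  have g: "g holomorphic_on ball 0 1" using assms by (simp add: Bloch_def)
  obtain B where Bpos: "0 < B" and B: "\<And>z. cmod z < 1 \<Longrightarrow> cmod (deriv g z) \<le> B / (1 - cmod z)"
    using Bloch_deriv_bound[OF assms(3)] by blast
  obtain K where K: "K > 0" "\<And>A F h. Hle p (\<alpha> + 1) A h \<Longrightarrow> (\<And>z. cmod z < 1 \<Longrightarrow> (F has_field_derivative h z) (at z)) \<Longrightarrow>
     F 0 = 0 \<Longrightarrow> Hle p \<alpha> (K * A) F"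
    using integral_Hle[OF assms(1,2)] by meson
  have "Hle p \<alpha> (K * B * A) (Tg g f)" if f: "Hle p \<alpha> A f" for A f
  proof -
    have hf: "f holomorphic_on ball 0 1" using f by (simp add: Hle_def)
    have "Hle p (\<alpha> + 1) (B * A) (\<lambda>z. f z * deriv g z)"
      unfolding Hle_def
    proof (intro conjI ballI)
      show hol: "(\<lambda>z. f z * deriv g z) holomorphic_on ball 0 1"
        using hf g by (intro holomorphic_intros holomorphic_deriv) auto
      fix r :: real assume r: "r \<in> {0..<1}"
      define c :: complex where "c = of_real (B / (1 - r))"
      have c: "cmod c = B / (1 - r)" using r Bpos by (simp add: c_def del: of_real_divide)
      have cf: "continuous_on (ball 0 1) f" using hf by (rule holomorphic_on_imp_continuous_on)
      have "Mp p r (\<lambda>z. f z * deriv g z) \<le> Mp p r (\<lambda>z. c * f z)"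
      proof (rule Mp_mono)
        show "cmod (f z * deriv g z) \<le> cmod (c * f z)" if "cmod z = r" for z
          unfolding norm_mult c mult.commute[of "cmod (f z)"]
          using B[of z] that r by (intro mult_right_mono) auto
      qed (use r assms hol cf in \<open>auto intro!: holomorphic_on_imp_continuous_on continuous_on_mult_left\<close>)
      also have "\<dots> \<le> cmod c * Mp p r f" using r by (intro Mp_cmult cf assms) auto
      also have "\<dots> \<le> cmod c * (A * (1 - r) powr (-\<alpha>))"
        using f r by (intro mult_left_mono) (auto simp: Hle_def)
      also have "\<dots> = B * A * (1 - r) powr (-(\<alpha> + 1))"
      proof -
        have "(1 - r) powr (-\<alpha> - 1) = (1 - r) powr (-\<alpha>) / (1 - r)" using r by (simp add: powr_diff)
        then show ?thesis by (simp add: c)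
      qed
      finally show "Mp p r (\<lambda>z. f z * deriv g z) \<le> B * A * (1 - r) powr (-(\<alpha> + 1))" .
    qed
    from K(2)[OF this Tg_has_field_derivative[OF g hf]] show ?thesis by (simp add: mult.assoc)
  qed
  then show ?thesis using K(1) Bpos by (intro exI[of _ "K * B"]) auto
qed

section \<open>Criteria for membership in \<open>H0\<close>\<close>

lemma growth_imp_H0:
  assumes hol: "f holomorphic_on ball 0 1" and p: "0 < p" and \<gamma>: "0 \<le> \<gamma>" "\<gamma> < \<alpha>" and B: "0 \<le> B"
    and b: "\<And>z. cmod z < 1 \<Longrightarrow> cmod (f z) \<le> B * (1 - cmod z) powr (-\<gamma>)"
  shows "f \<in> H0 p \<alpha>"
proof -
  have cf: "continuous_on (ball 0 1) f" using hol by (rule holomorphic_on_imp_continuous_on)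
  have M: "Mp p r f \<le> B * (1 - r) powr (-\<gamma>)" if "r \<in> {0..<1}" for r
    using that b B by (intro Mp_le_of_bound cf p) auto
  have "Hle p \<alpha> B f" unfolding Hle_def
  proof (intro conjI hol ballI)
    fix r :: real assume r: "r \<in> {0..<1}"
    have "(1 - r) powr (-\<gamma>) \<le> (1 - r) powr (-\<alpha>)"
      using r \<gamma> by (intro powr_mono') auto
    then show "Mp p r f \<le> B * (1 - r) powr (-\<alpha>)"
      using M[OF r] B by (meson mult_left_mono order_trans)
  qed
  moreover have "((\<lambda>r. (1 - r) powr \<alpha> * Mp p r f) \<longlongrightarrow> 0) (at_left 1)"
  proof (rule tendsto_sandwich)
    have ev: "eventually (\<lambda>r. r \<in> {0<..<1}) (at_left (1::real))"
      by (rule eventually_at_left_real) auto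
    then show "eventually (\<lambda>r. 0 \<le> (1 - r) powr \<alpha> * Mp p r f) (at_left 1)"
      by eventually_elim (auto intro!: mult_nonneg_nonneg Mp_nonneg[OF cf])
    show "eventually (\<lambda>r. (1 - r) powr \<alpha> * Mp p r f \<le> B * (1 - r) powr (\<alpha> - \<gamma>)) (at_left 1)"
      using ev
    proof eventually_elim
      case (elim r)
      then have "(1 - r) powr \<alpha> * Mp p r f \<le> (1 - r) powr \<alpha> * (B * (1 - r) powr (-\<gamma>))"
        by (intro mult_left_mono M) auto
      also have "\<dots> = B * (1 - r) powr (\<alpha> - \<gamma>)"
        using powr_add[of "1 - r" \<alpha> "-\<gamma>"] by simp
      finally show ?case .
    qed
    have "((\<lambda>r. 1 - r) \<longlongrightarrow> 1 - 1) (at_left (1::real))" by (intro tendsto_intros)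
    then have "((\<lambda>r. (1 - r) powr (\<alpha> - \<gamma>)) \<longlongrightarrow> 0 powr (\<alpha> - \<gamma>)) (at_left (1::real))"
      using \<gamma> ev by (intro tendsto_powr') (auto elim: eventually_mono)
    from tendsto_mult_left[OF this, of B]
    show "((\<lambda>r. B * (1 - r) powr (\<alpha> - \<gamma>)) \<longlongrightarrow> 0) (at_left 1)" using \<gamma> by simp
  qed auto
  ultimately show ?thesis using Hinf_Hnorm_le_iff_Hle by (auto simp: H0_def)
qed

lemma H0_closed:
  assumes p: "0 < p" and f: "f \<in> Hinf p \<alpha>"
    and approx: "\<And>\<epsilon>. 0 < \<epsilon> \<Longrightarrow> \<exists>h\<in>H0 p \<alpha>. Hle p \<alpha> \<epsilon> (\<lambda>z. f z - h z)"
  shows "f \<in> H0 p \<alpha>"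
proof -
  obtain K where K: "K > 0" "\<And>f h r. continuous_on (ball 0 1) f \<Longrightarrow> continuous_on (ball 0 1) h \<Longrightarrow>
      0 \<le> r \<Longrightarrow> r < 1 \<Longrightarrow> Mp p r (\<lambda>z. f z + h z) \<le> K * (Mp p r f + Mp p r h)"
    using Mp_quasi_triangle[OF p] by metis
  have cf: "continuous_on (ball 0 1) f" using f by (simp add: Hinf_def holomorphic_on_imp_continuous_on)
  have ev: "eventually (\<lambda>r. r \<in> {0<..<1}) (at_left (1::real))"
    by (rule eventually_at_left_real) auto
  have "((\<lambda>r. (1 - r) powr \<alpha> * Mp p r f) \<longlongrightarrow> 0) (at_left 1)"
  proof (rule tendstoI)
    fix e :: real assume e: "0 < e"
    define \<epsilon> where "\<epsilon> = e / (2 * K)"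
    have \<epsilon>: "0 < \<epsilon>" using e K by (simp add: \<epsilon>_def)
    obtain h where h: "h \<in> H0 p \<alpha>" "Hle p \<alpha> \<epsilon> (\<lambda>z. f z - h z)" using approx[OF \<epsilon>] by blast
    have ch: "continuous_on (ball 0 1) h" using h by (simp add: H0_def Hinf_def holomorphic_on_imp_continuous_on)
    have "eventually (\<lambda>r. (1 - r) powr \<alpha> * Mp p r h < \<epsilon>) (at_left 1)"
      using h(1) \<epsilon> by (auto simp: H0_def intro: order_tendstoD)
    with ev show "eventually (\<lambda>r. dist ((1 - r) powr \<alpha> * Mp p r f) 0 < e) (at_left 1)"
    proof eventually_elim
      case (elim r)
      have "Mp p r f = Mp p r (\<lambda>z. h z + (f z - h z))" by simp
      also have "\<dots> \<le> K * (Mp p r h + Mp p r (\<lambda>z. f z - h z))"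
        using elim by (intro K(2) ch continuous_on_diff cf) auto
      finally have "(1 - r) powr \<alpha> * Mp p r f \<le> (1 - r) powr \<alpha> * (K * (Mp p r h + Mp p r (\<lambda>z. f z - h z)))"
        by (intro mult_left_mono) auto
      also have "\<dots> = K * ((1 - r) powr \<alpha> * Mp p r h + (1 - r) powr \<alpha> * Mp p r (\<lambda>z. f z - h z))"
        by (simp add: algebra_simps)
      also have "(1 - r) powr \<alpha> * Mp p r (\<lambda>z. f z - h z) \<le> \<epsilon>"
      proof -
        have "(1 - r) powr \<alpha> * Mp p r (\<lambda>z. f z - h z) \<le> (1 - r) powr \<alpha> * (\<epsilon> * (1 - r) powr (-\<alpha>))"
          using h(2) elim by (intro mult_left_mono) (auto simp: Hle_def)
        also have "\<dots> = \<epsilon>" using elim by (simp add: powr_minus)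
        finally show ?thesis .
      qed
      also have "K * ((1 - r) powr \<alpha> * Mp p r h + \<epsilon>) < K * (\<epsilon> + \<epsilon>)"
        using elim K(1) by simp
      also have "\<dots> = e" using K(1) by (simp add: \<epsilon>_def)
      finally have "(1 - r) powr \<alpha> * Mp p r f < e" using K(1) by (simp add: mult_left_mono)
      moreover have "0 \<le> (1 - r) powr \<alpha> * Mp p r f"
        using elim by (intro mult_nonneg_nonneg Mp_nonneg[OF cf]) auto
      ultimately show ?case by simp
    qed
  qed
  then show ?thesis using f by (simp add: H0_def)
qed

section \<open>Integral means of the kernels\<close>

text \<open>The normalisation of the Poisson kernel. For |u| = 1 one has |1 - b u|^2 = (1 - b u)(u -
  cnj b)/u, so this is Cauchy's formula for 1/(1 - b u) at the interior point cnj b; the factor -i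
  comes from du = i u dt.\<close>

lemma has_integral_inverse_square_kernel:
  assumes b: "cmod b < 1"
  shows "((\<lambda>t. 1 / (cmod (1 - b * cis t))\<^sup>2) has_integral (2*pi / (1 - (cmod b)\<^sup>2))) {0..2*pi}"
proof -
  have nz: "1 - b * u \<noteq> 0" if "cmod u \<le> 1" for u
  proof
    assume "1 - b * u = 0"
    then have "cmod b * cmod u = 1" by (metis eq_iff_diff_eq_0 norm_mult norm_one)
    moreover have "cmod b * cmod u \<le> cmod b" using that by (simp add: mult_left_le)
    ultimately show False using b by simp
  qed
  have "((\<lambda>u. (1 / (1 - b * u)) / (u - cnj b)) has_contour_integral (2 * of_real pi * \<i> * (1 / (1 - b * cnj b)))) (circlepath 0 1)"
    using nz b by (intro Cauchy_integral_circlepath_simple holomorphic_intros) (auto simp: mult.commute)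
  then have "((\<lambda>t. (1 / (1 - b * (0 + of_real 1 * cis t))) / ((0 + of_real 1 * cis t) - cnj b) * of_real 1 * \<i> * cis t) has_integral (2 * of_real pi * \<i> * (1 / (1 - b * cnj b)))) {0..2*pi}"
    unfolding circlepath_def by (subst (asm) has_contour_integral_part_circlepath_iff) auto
  then have "((\<lambda>t. - \<i> * ((1 / (1 - b * cis t)) / (cis t - cnj b) * \<i> * cis t)) has_integral (- \<i> * (2 * of_real pi * \<i> * (1 / (1 - b * cnj b))))) {0..2*pi}"
    by (intro has_integral_mult_right) simp
  moreover have "- \<i> * ((1 / (1 - b * cis t)) / (cis t - cnj b) * \<i> * cis t) = of_real (1 / (cmod (1 - b * cis t))\<^sup>2)" for t
  proof -
    have "cis t * cnj (1 - b * cis t) = cis t - cnj b"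
      by (simp add: algebra_simps cis_cnj cis_mult)
    then have "(1 - b * cis t) * (cis t - cnj b) = cis t * ((1 - b * cis t) * cnj (1 - b * cis t))"
      by (simp add: mult_ac)
    also have "\<dots> = cis t * of_real ((cmod (1 - b * cis t))\<^sup>2)" by (simp only: complex_norm_square)
    finally show ?thesis by (simp add: field_simps)
  qed
  moreover have "- \<i> * (2 * of_real pi * \<i> * (1 / (1 - b * cnj b))) = of_real (2*pi / (1 - (cmod b)\<^sup>2))"
  proof -
    have "- \<i> * (2 * of_real pi * \<i> * X) = 2 * of_real pi * X" for X
      by (simp add: complex_eq_iff)
    note this[of "1 / (1 - b * cnj b)"]
    moreover have "b * cnj b = of_real ((cmod b)\<^sup>2)" by (simp only: complex_norm_square)
    ultimately show ?thesis by simp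
  qed
  ultimately have "((\<lambda>t. complex_of_real (1 / (cmod (1 - b * cis t))\<^sup>2)) has_integral of_real (2*pi / (1 - (cmod b)\<^sup>2))) {0..2*pi}"
    by simp
  from has_integral_Re[OF this] show ?thesis by simp
qed

text \<open>For finite P only the exponent 2 is integrated exactly. The remaining exponent k P - 2
  is nonnegative by the hypothesis on k, so that factor is bounded by its value at the smallest
  possible modulus 1 - r |a|.\<close>

lemma Mp_kernel_le:
  fixes k :: nat
  assumes p: "0 < p" and k: "2 * pinv p \<le> k" and a: "cmod a < 1" and r: "0 \<le> r" "r < 1"
  shows "Mp p r (\<lambda>z. 1 / (1 - cnj a * z) ^ k) \<le> (1 - r * cmod a) powr (pinv p - k)"
proof -
  define \<rho> where "\<rho> = r * cmod a"
  have "r * cmod a \<le> r" using a r by (simp add: mult_left_le)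
  then have \<rho>: "0 \<le> \<rho>" "\<rho> < 1" using r by (auto simp: \<rho>_def)
  have low: "1 - cmod z * cmod a \<le> cmod (1 - cnj a * z)" for z
    using norm_triangle_ineq2[of 1 "cnj a * z"] by (simp add: norm_mult mult.commute)
  have nz: "1 - cnj a * z \<noteq> 0" if "cmod z < 1" for z
  proof -
    have "cmod z * cmod a \<le> cmod z" using a by (simp add: mult_left_le)
    then show ?thesis using low[of z] that by auto
  qed
  have cf: "continuous_on (ball 0 1) (\<lambda>z. 1 / (1 - cnj a * z) ^ k)"
    using nz by (intro continuous_intros) auto
  show ?thesis
  proof (cases p)
    case (real P)
    then have P: "0 < P" using p by simp
    have kP: "2 \<le> k * P" using k P real by (simp add: pinv_def field_simps)
    define b where "b = cnj a * of_real r"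
    have b: "cmod b = \<rho>" using r by (simp add: b_def \<rho>_def norm_mult mult.commute)
    have "integral {0..2*pi} (\<lambda>t. cmod (1 / (1 - cnj a * (of_real r * cis t)) ^ k) powr P)
        \<le> integral {0..2*pi} (\<lambda>t. (1 - \<rho>) powr (2 - k * P) * (1 / (cmod (1 - b * cis t))\<^sup>2))"
    proof (rule integral_le)
      show "(\<lambda>t. cmod (1 / (1 - cnj a * (of_real r * cis t)) ^ k) powr P) integrable_on {0..2*pi}"
        by (rule integrable_continuous_interval) (rule continuous_on_subset[OF continuous_on_circle_powr[OF cf r P]], simp)
      show "(\<lambda>t. (1 - \<rho>) powr (2 - k * P) * (1 / (cmod (1 - b * cis t))\<^sup>2)) integrable_on {0..2*pi}"
        using has_integral_mult_right[OF has_integral_inverse_square_kernel[of b]] b \<rho> by blast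
      fix t :: real
      define m where "m = cmod (1 - b * cis t)"
      have m: "1 - \<rho> \<le> m" using low[of "of_real r * cis t"] r by (simp add: m_def b_def \<rho>_def norm_mult mult_ac)
      then have m0: "m > 0" using \<rho> by simp
      have "cmod (1 / (1 - cnj a * (of_real r * cis t)) ^ k) powr P = m powr (-(k * P))"
        using m0 by (simp add: m_def b_def norm_divide norm_power powr_divide powr_minus_divide powr_powr powr_realpow[symmetric] mult_ac)
      also have "\<dots> = m powr (2 - k * P) * (1 / m\<^sup>2)"
        using m0 powr_diff[of m "2 - k * P" 2] by simp
      also have "\<dots> \<le> (1 - \<rho>) powr (2 - k * P) * (1 / m\<^sup>2)"
        using m \<rho> kP by (intro mult_right_mono powr_mono2') auto
      finally show "cmod (1 / (1 - cnj a * (of_real r * cis t)) ^ k) powr P \<le> (1 - \<rho>) powr (2 - k * P) * (1 / (cmod (1 - b * cis t))\<^sup>2)"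
        by (simp add: m_def)
    qed
    also have "\<dots> = (1 - \<rho>) powr (2 - k * P) * (2*pi / (1 - \<rho>\<^sup>2))"
      using integral_unique[OF has_integral_mult_right[OF has_integral_inverse_square_kernel[of b]]] b \<rho> by simp
    also have "\<dots> \<le> (1 - \<rho>) powr (2 - k * P) * (2*pi / (1 - \<rho>))"
    proof -
      have "\<rho>\<^sup>2 \<le> \<rho>" using \<rho> by (simp add: power2_eq_square mult_left_le)
      then show ?thesis using \<rho> by (intro mult_left_mono divide_left_mono) (auto intro!: mult_pos_pos)
    qed
    also have "\<dots> = 2*pi * (1 - \<rho>) powr (1 - k * P)"
      using \<rho> powr_diff[of "1 - \<rho>" "2 - k * P" 1] by simp
    also have "(1 - \<rho>) powr (1 - k * P) = ((1 - \<rho>) powr (pinv p - k)) powr P"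
      using P real by (simp add: powr_powr pinv_def left_diff_distrib)
    finally show ?thesis
      unfolding real \<rho>_def[symmetric]
      by (subst Mp_ereal_le_iff[OF cf r P]) (auto simp: circ_integral_eq[OF cf r P] intro!: ennreal_leI)
  next
    case PInf
    have "cmod (1 / (1 - cnj a * z) ^ k) \<le> (1 - \<rho>) powr (- real k)" if "cmod z = r" for z
    proof -
      have "1 / cmod (1 - cnj a * z) ^ k \<le> 1 / (1 - \<rho>) ^ k"
        using low[of z] that \<rho> by (intro divide_left_mono power_mono mult_pos_pos zero_less_power) (auto simp: \<rho>_def)
      then show ?thesis using \<rho> by (simp add: norm_divide norm_power powr_minus_divide powr_realpow)
    qed
    then show ?thesis unfolding \<rho>_def[symmetric]
      using PInf p r by (intro Mp_le_of_bound[OF cf]) (auto simp: pinv_def)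
  qed (use p in auto)
qed

section \<open>Lacunary scales and weighted series\<close>

lemma powr_lt_one:
  fixes x s :: real
  assumes "0 < x" "x < 1" "0 < s"
  shows "x powr s < 1"
  using powr_less_mono2[of s x 1] assms by simp

text \<open>The maximum cancels one of the two powers: the left side equals (d/t)^b when d \<le> t
  and (t/d)^a otherwise. Both bases are at most 1, so the smaller common exponent \<beta> is
  weaker.\<close>

lemma peak_exponent_le:
  fixes t d a b \<beta> :: real
  assumes "0 < t" "0 < d" "\<beta> \<le> a" "\<beta> \<le> b"
  shows "t powr a * d powr b * max t d powr (-(a + b)) \<le> min (d/t) (t/d) powr \<beta>"
proof (cases "d \<le> t")
  case True
  have "t powr a * d powr b * max t d powr (-(a + b)) = (d/t) powr b"
    using True assms by (simp add: powr_divide powr_add powr_diff powr_minus field_simps)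
  also have "\<dots> \<le> (d/t) powr \<beta>" using assms True by (intro powr_mono') auto
  also have "d/t = min (d/t) (t/d)" using True assms
    by (intro min_absorb1[symmetric]) (meson divide_le_eq_1_pos le_divide_eq_1_pos order_trans)
  finally show ?thesis .
next
  case False
  have "t powr a * d powr b * max t d powr (-(a + b)) = (t/d) powr a"
    using False assms by (simp add: powr_divide powr_add powr_diff powr_minus field_simps)
  also have "\<dots> \<le> (t/d) powr \<beta>" using assms False by (intro powr_mono') auto
  also have "t/d = min (d/t) (t/d)" using False assms
    by (intro min_absorb2[symmetric]) (meson divide_le_eq_1_pos le_divide_eq_1_pos less_imp_le not_le order_trans)
  finally show ?thesis .
qed

locale lacunary =
  fixes d :: "nat \<Rightarrow> real" and \<eta> :: real
  assumes \<eta>: "0 < \<eta>" "\<eta> < 1" and d_pos: "0 < d n" and d_Suc: "d (Suc n) \<le> \<eta> * d n"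
begin

text \<open>For t > 0 this is exp(-|ln t - ln (d n)|): a value in (0, 1] measuring how far apart the
  scales t and \<open>d n\<close> are.\<close>

definition v :: "real \<Rightarrow> nat \<Rightarrow> real" where
  "v t n = min (d n / t) (t / d n)"

lemma d_add: "d (n + m) \<le> \<eta> ^ m * d n"
proof (induction m)
  case (Suc m)
  have "d (n + Suc m) \<le> \<eta> * d (n + m)" using d_Suc[of "n + m"] by simp
  also have "\<dots> \<le> \<eta> * (\<eta> ^ m * d n)" using Suc \<eta> by (intro mult_left_mono) auto
  finally show ?case by (simp add: mult_ac)
qed simp

lemma d_tendsto_0: "d \<longlonglongrightarrow> 0"
proof (rule tendsto_sandwich[of "\<lambda>_. 0" d sequentially "\<lambda>n. \<eta> ^ n * d 0"])
  show "(\<lambda>n. \<eta> ^ n * d 0) \<longlonglongrightarrow> 0"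
    using \<eta> by (intro tendsto_mult_left_zero LIMSEQ_realpow_zero) auto
  show "eventually (\<lambda>n. d n \<le> \<eta> ^ n * d 0) sequentially" using d_add[of 0] by (intro always_eventually) simp
  show "eventually (\<lambda>n. 0 \<le> d n) sequentially" using d_pos by (intro always_eventually) (simp add: less_imp_le)
qed auto

lemma v_pos: "0 < t \<Longrightarrow> 0 < v t n"
  using d_pos by (simp add: v_def)

text \<open>N is the first index with d N \<le> t. Below it the last scale above t is d (N - 1),
  which is why the second exponent counts from N - 1 and not from N.\<close>

lemma v_bounds:
  assumes t: "0 < t"
  obtains N where "\<And>n. N \<le> n \<Longrightarrow> v t n \<le> \<eta> ^ (n - N)" "\<And>n. n < N \<Longrightarrow> v t n \<le> \<eta> ^ (N - 1 - n)"
proof -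
  define N where "N = (LEAST n. d n \<le> t)"
  have "eventually (\<lambda>n. d n < t) sequentially" using order_tendstoD(2)[OF d_tendsto_0 t] .
  then obtain m where "d m < t" by (auto simp: eventually_sequentially)
  then have N: "d N \<le> t" unfolding N_def using LeastI[of "\<lambda>n. d n \<le> t" m] by simp
  show ?thesis
  proof
    fix n assume n: "N \<le> n"
    have "d n \<le> \<eta> ^ (n - N) * d N" using d_add[of N "n - N"] n by simp
    also have "\<dots> \<le> \<eta> ^ (n - N) * t" using N \<eta> by (intro mult_left_mono) auto
    finally have "d n / t \<le> \<eta> ^ (n - N)" using t by (simp add: field_simps)
    then show "v t n \<le> \<eta> ^ (n - N)" by (simp add: v_def)
  next
    fix n assume n: "n < N"
    have "\<not> d (N - 1) \<le> t" using not_less_Least[of "N - 1" "\<lambda>n. d n \<le> t"] n by (simp add: N_def)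
    then have "t \<le> \<eta> ^ (N - 1 - n) * d n" using d_add[of n "N - 1 - n"] n by simp
    then have "t / d n \<le> \<eta> ^ (N - 1 - n)" using d_pos[of n] by (simp add: field_simps)
    then show "v t n \<le> \<eta> ^ (N - 1 - n)" by (simp add: v_def)
  qed
qed

text \<open>The indices on either side of t contribute a geometric series of ratio \<eta>^s each.
  The resulting bound does not depend on t, which is what makes the norm estimates uniform in the
  radius.\<close>

lemma v_sum:
  assumes t: "0 < t" and s: "0 < s"
  shows "summable (\<lambda>n. v t n powr s)" and "(\<Sum>n. v t n powr s) \<le> 2 / (1 - \<eta> powr s)"
proof -
  obtain N where N: "\<And>n. N \<le> n \<Longrightarrow> v t n \<le> \<eta> ^ (n - N)" "\<And>n. n < N \<Longrightarrow> v t n \<le> \<eta> ^ (N - 1 - n)"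
    using v_bounds[OF t] by blast
  define m where "m = \<eta> powr s"
  have m: "0 < m" "m < 1" using \<eta> s by (auto simp: m_def powr_lt_one)
  have pw: "v t n powr s \<le> m ^ j" if "v t n \<le> \<eta> ^ j" for n j
  proof -
    have "v t n powr s \<le> (\<eta> ^ j) powr s" using that v_pos[OF t, of n] s by (intro powr_mono2) auto
    also have "\<dots> = m ^ j" using \<eta> by (simp add: m_def powr_powr powr_realpow[symmetric] mult.commute)
    finally show ?thesis .
  qed
  have geo: "(\<Sum>j<M. m ^ j) \<le> 1 / (1 - m)" for M
    using m by (simp add: sum_gp_strict field_simps)
  have part: "(\<Sum>n<M. v t n powr s) \<le> 2 / (1 - m)" for M
  proof -
    \<comment> \<open>Enlarging the range to N + M permits a split at N whatever M is.\<close>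
    have "(\<Sum>n<M. v t n powr s) \<le> (\<Sum>n<N+M. v t n powr s)"
      by (intro sum_mono2) auto
    also have "\<dots> = (\<Sum>n<N. v t n powr s) + (\<Sum>n=N..<N+M. v t n powr s)"
      by (metis lessThan_atLeast0 le_add1 sum.atLeastLessThan_concat zero_le)
    also have "(\<Sum>n<N. v t n powr s) \<le> (\<Sum>n<N. m ^ (N - 1 - n))" using N(2) pw by (intro sum_mono) auto
    also have "\<dots> = (\<Sum>n<N. m ^ n)" using sum.nat_diff_reindex[of "\<lambda>i. m ^ i" N] by simp
    also have "(\<Sum>n=N..<N+M. v t n powr s) \<le> (\<Sum>n=N..<N+M. m ^ (n - N))" using N(1) pw by (intro sum_mono) auto
    also have "\<dots> = (\<Sum>n<M. m ^ n)"
      using sum.shift_bounds_nat_ivl[of "\<lambda>n. m ^ (n - N)" 0 N M] by (simp add: add.commute lessThan_atLeast0)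
    finally show ?thesis using geo[of N] geo[of M] by simp
  qed
  show "summable (\<lambda>n. v t n powr s)" using part by (intro summableI_nonneg_bounded) auto
  then show "(\<Sum>n. v t n powr s) \<le> 2 / (1 - \<eta> powr s)"
    using part unfolding m_def by (intro suminf_le_const) auto
qed

lemma v_off_diagonal:
  assumes "m \<noteq> n" shows "v (d n) m \<le> \<eta>"
proof (cases "m < n")
  case True
  then have "d n \<le> \<eta> ^ (n - m) * d m" using d_add[of m "n - m"] by simp
  also have "\<dots> \<le> \<eta> ^ 1 * d m" using True \<eta> d_pos[of m] by (intro mult_right_mono power_decreasing) auto
  finally show ?thesis using d_pos[of m] by (simp add: v_def min_le_iff_disj field_simps)
next
  case False
  then have "n < m" using assms by simp
  then have "d m \<le> \<eta> ^ (m - n) * d n" using d_add[of n "m - n"] by simp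
  also have "\<dots> \<le> \<eta> ^ 1 * d n" using \<open>n < m\<close> \<eta> d_pos[of n] by (intro mult_right_mono power_decreasing) auto
  finally show ?thesis using d_pos[of n] by (simp add: v_def min_le_iff_disj field_simps)
qed

end

lemma ennreal_le_suminf: "f n \<le> suminf f" for f :: "nat \<Rightarrow> ennreal"
  using sum_le_suminf[OF summableI, of "{n}" f] by simp

text \<open>Replaces Minkowski's inequality, uniformly in \<open>P > 0\<close>: \<open>a n \<le> T powr (1/P) * w n\<close> with T the last sum.\<close>
lemma powr_suminf_le_weighted:
  fixes a w :: "nat \<Rightarrow> real"
  assumes P: "0 < P" and a: "\<And>n. 0 \<le> a n" "summable a" and w: "\<And>n. 0 < w n" "summable w"
  shows "ennreal ((\<Sum>n. a n) powr P) \<le> ennreal ((\<Sum>n. w n) powr P) * (\<Sum>n. ennreal ((a n / w n) powr P))"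
proof -
  let ?T = "\<Sum>n. ennreal ((a n / w n) powr P)"
  have W: "0 < (\<Sum>n. w n)" using w by (intro suminf_pos) auto
  show ?thesis
  proof (cases "?T = \<infinity>")
    case True
    then show ?thesis using W by (simp add: ennreal_mult_eq_top_iff)
  next
    case False
    then obtain T where T: "?T = ennreal T" "0 \<le> T"
      by (metis ennreal_cases infinity_ennreal_def)
    have "a n \<le> T powr (1/P) * w n" for n
    proof -
      have "ennreal ((a n / w n) powr P) \<le> ?T"
        by (rule ennreal_le_suminf)
      then have "(a n / w n) powr P \<le> T" unfolding T(1) using T(2) by simp
      then have "((a n / w n) powr P) powr (1/P) \<le> T powr (1/P)" using P by (intro powr_mono2) auto
      then have "a n / w n \<le> T powr (1/P)" using P a(1)[of n] w(1)[of n] by (simp add: powr_powr)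
      then show ?thesis using w(1)[of n] by (simp add: field_simps)
    qed
    then have "(\<Sum>n. a n) \<le> (\<Sum>n. T powr (1/P) * w n)"
      using a w by (intro suminf_le summable_mult) auto
    also have "\<dots> = T powr (1/P) * (\<Sum>n. w n)" using w by (intro suminf_mult) auto
    finally have "(\<Sum>n. a n) powr P \<le> (T powr (1/P) * (\<Sum>n. w n)) powr P"
      using P a by (intro powr_mono2 suminf_nonneg) auto
    also have "\<dots> = (\<Sum>n. w n) powr P * T" using P T by (simp add: powr_mult powr_powr)
    finally show ?thesis unfolding T(1) using T by (simp add: ennreal_mult[symmetric] ennreal_leI)
  qed
qed

section \<open>The kernels at the chosen points and the embedding \<open>J\<close>\<close>

text \<open>\<open>k1\<close> makes the decay exponent \<beta> positive, \<open>k2\<close> is the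
  condition for the means of the kernels, and \<open>small\<close>, which says \<eta>^(\<beta>/2)
  \<le> 2^-(k+3), is the separation that keeps foreign terms below half of the diagonal one.\<close>

locale peak_family =
  fixes p :: ereal and \<alpha> :: real and k :: nat and \<eta> :: real and z :: "nat \<Rightarrow> complex"
  assumes p: "0 < p" and \<alpha>: "0 < \<alpha>" and k1: "\<alpha> + pinv p < k" and k2: "2 * pinv p \<le> k"
    and \<eta>: "0 < \<eta>" "\<eta> < 1" and z: "cmod (z n) < 1"
    and sep: "1 - cmod (z (Suc n)) \<le> \<eta> * (1 - cmod (z n))"
    and small: "\<eta> powr (min \<alpha> (k - \<alpha> - pinv p) / 2) \<le> 1 / 2 ^ (k + 3)"
begin

definition q :: real where "q = pinv p"
definition \<beta> :: real where "\<beta> = min \<alpha> (k - \<alpha> - q)"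
definition d :: "nat \<Rightarrow> real" where "d n = 1 - cmod (z n)"
definition peak :: "nat \<Rightarrow> complex \<Rightarrow> complex" where
  "peak n w = of_real (d n powr (k - \<alpha> - q)) * (1 / (1 - cnj (z n) * w) ^ k)"
text \<open>The value 0 off the disk makes additivity and homogeneity hold as equations between
  total functions, as \<open>fixes_copy\<close> requires, also where the series need not
  converge.\<close>

definition J :: "(nat \<Rightarrow> complex) \<Rightarrow> complex \<Rightarrow> complex" where
  "J x w = (if cmod w < 1 then (\<Sum>n. x n * peak n w) else 0)"

sublocale lacunary d \<eta>
  by unfold_locales (use \<eta> z sep in \<open>auto simp: d_def\<close>)

lemma q_nonneg: "0 \<le> q"
  unfolding q_def using p by (cases p) (auto simp: pinv_def)

lemma \<beta>_pos: "0 < \<beta>"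
  using \<alpha> k1 by (simp add: \<beta>_def q_def)

lemma d_le_1: "d n \<le> 1"
  by (simp add: d_def)

lemma kernel_ge: 
  assumes "cmod w < 1"
  shows "max (1 - cmod w) (d n) \<le> 1 - cmod w * cmod (z n)" "1 - cmod w * cmod (z n) \<le> cmod (1 - cnj (z n) * w)"
proof -
  have "cmod w * cmod (z n) \<le> cmod w" "cmod w * cmod (z n) \<le> cmod (z n)"
    using assms z[of n] by (auto simp: mult_left_le mult_left_le_one_le)
  then show "max (1 - cmod w) (d n) \<le> 1 - cmod w * cmod (z n)" by (auto simp: d_def)
  show "1 - cmod w * cmod (z n) \<le> cmod (1 - cnj (z n) * w)"
    using norm_triangle_ineq2[of 1 "cnj (z n) * w"] by (simp add: norm_mult mult.commute)
qed

lemma peak_holomorphic: "peak n holomorphic_on ball 0 1"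
proof -
  have "1 - cnj (z n) * w \<noteq> 0" if "cmod w < 1" for w
    using kernel_ge[OF that, of n] d_pos[of n] by auto
  then show ?thesis unfolding peak_def by (intro holomorphic_intros) auto
qed

lemma peak_norm_le:
  assumes "cmod w < 1"
  shows "cmod (peak n w) \<le> d n powr (k - \<alpha> - q) * max (1 - cmod w) (d n) powr (- real k)"
proof -
  have m: "0 < max (1 - cmod w) (d n)" using d_pos[of n] by simp
  have "1 / cmod (1 - cnj (z n) * w) ^ k \<le> 1 / max (1 - cmod w) (d n) ^ k"
    using kernel_ge[OF assms, of n] m
    by (intro divide_left_mono power_mono mult_pos_pos zero_less_power) auto
  also have "\<dots> = max (1 - cmod w) (d n) powr (- real k)"
    using m by (simp add: powr_minus_divide powr_realpow)
  finally have *: "1 / cmod (1 - cnj (z n) * w) ^ k \<le> max (1 - cmod w) (d n) powr (- real k)" .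
  have "cmod (peak n w) = d n powr (k - \<alpha> - q) * (1 / cmod (1 - cnj (z n) * w) ^ k)"
    by (simp add: peak_def norm_mult norm_divide norm_power)
  also have "\<dots> \<le> d n powr (k - \<alpha> - q) * max (1 - cmod w) (d n) powr (- real k)"
    by (intro mult_left_mono *) simp
  finally show ?thesis .
qed

lemma peak_growth:
  assumes "cmod w < 1"
  shows "(1 - cmod w) powr (\<alpha> + q) * cmod (peak n w) \<le> v (1 - cmod w) n powr \<beta>"
proof -
  have "(1 - cmod w) powr (\<alpha> + q) * cmod (peak n w) \<le>
     (1 - cmod w) powr (\<alpha> + q) * (d n powr (k - \<alpha> - q) * max (1 - cmod w) (d n) powr (- real k))"
    by (intro mult_left_mono peak_norm_le assms) auto
  also have "\<dots> = (1 - cmod w) powr (\<alpha> + q) * d n powr (k - \<alpha> - q) * max (1 - cmod w) (d n) powr (-((\<alpha> + q) + (k - \<alpha> - q)))"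
    by simp
  also have "\<dots> \<le> v (1 - cmod w) n powr \<beta>" unfolding v_def
    using assms d_pos[of n] q_nonneg by (intro peak_exponent_le) (auto simp: \<beta>_def)
  finally show ?thesis .
qed

text \<open>Averaging over the circle gains the exponent q over the pointwise bound: the kernel
  contributes k - q instead of k, so the weight (1 - r)^\<alpha> suffices.\<close>

lemma Mp_peak:
  assumes r: "0 \<le> r" "r < 1"
  shows "Mp p r (peak n) \<le> (1 - r) powr (-\<alpha>) * v (1 - r) n powr \<beta>"
proof -
  let ?m = "max (1 - r) (d n)"
  have m: "0 < ?m" using r by simp
  have cont: "continuous_on (ball 0 1) (\<lambda>w. 1 / (1 - cnj (z n) * w) ^ k)"
  proof -
    have "1 - cnj (z n) * w \<noteq> 0" if "cmod w < 1" for w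
      using kernel_ge[OF that, of n] d_pos[of n] by auto
    then show ?thesis by (intro continuous_intros) auto
  qed
  have "Mp p r (peak n) \<le> cmod (of_real (d n powr (k - \<alpha> - q))) * Mp p r (\<lambda>w. 1 / (1 - cnj (z n) * w) ^ k)"
    unfolding peak_def using Mp_cmult[OF cont r p] by blast
  also have "\<dots> \<le> d n powr (k - \<alpha> - q) * (1 - r * cmod (z n)) powr (q - k)"
    using Mp_kernel_le[OF p k2 z r] by (simp add: q_def mult_left_mono)
  also have "\<dots> \<le> d n powr (k - \<alpha> - q) * ?m powr (q - k)"
    using kernel_ge(1)[of "of_real r" n] r m k1 \<alpha>
    by (intro mult_left_mono powr_mono2') (auto simp: q_def)
  also have "\<dots> = (1 - r) powr (-\<alpha>) * ((1 - r) powr \<alpha> * d n powr (k - \<alpha> - q) * ?m powr (-(\<alpha> + (k - \<alpha> - q))))"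
    using r by (simp add: powr_minus)
  also have "\<dots> \<le> (1 - r) powr (-\<alpha>) * v (1 - r) n powr \<beta>"
    unfolding v_def using r d_pos[of n]
    by (intro mult_left_mono peak_exponent_le) (auto simp: \<beta>_def)
  finally show ?thesis .
qed

text \<open>On a smaller disk the kernels are bounded uniformly in n while their coefficients decay
  geometrically; this is the majorant for locally uniform convergence.\<close>

lemma peak_majorant:
  assumes "cmod w \<le> \<rho>" "\<rho> < 1" "cmod (x n) \<le> X"
  shows "cmod (x n * peak n w) \<le> X * (1 - \<rho>) powr (- real k) * (\<eta> powr (k - \<alpha> - q)) ^ n"
proof -
  have X: "0 \<le> X" using assms(3) norm_ge_zero order_trans by blast
  have "cmod (peak n w) \<le> d n powr (k - \<alpha> - q) * max (1 - cmod w) (d n) powr (- real k)"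
    using assms by (intro peak_norm_le) auto
  also have "\<dots> \<le> (\<eta> powr (k - \<alpha> - q)) ^ n * (1 - \<rho>) powr (- real k)"
  proof (rule mult_mono)
    have "d n \<le> \<eta> ^ n" using d_add[of 0 n] d_le_1[of 0] \<eta> d_pos[of 0]
      by (simp add: mult_left_le order_trans)
    then have "d n powr (k - \<alpha> - q) \<le> (\<eta> ^ n) powr (k - \<alpha> - q)"
      using d_pos[of n] k1 by (intro powr_mono2) (auto simp: q_def)
    also have "\<dots> = (\<eta> powr (k - \<alpha> - q)) ^ n"
      using \<eta> by (simp add: powr_powr powr_realpow[symmetric] mult.commute)
    finally show "d n powr (k - \<alpha> - q) \<le> (\<eta> powr (k - \<alpha> - q)) ^ n" .
    show "max (1 - cmod w) (d n) powr (- real k) \<le> (1 - \<rho>) powr (- real k)"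
      using assms by (intro powr_mono2') auto
  qed (use \<eta> in auto)
  finally show ?thesis unfolding norm_mult
    using X assms(3) by (subst mult.assoc) (auto intro!: mult_mono simp: mult.commute)
qed

lemma summable_majorant: "summable (\<lambda>n. c * (\<eta> powr (k - \<alpha> - q)) ^ n)"
  using \<eta> k1 by (intro summable_mult summable_geometric) (auto simp: q_def powr_lt_one)

lemma J_abs_summable:
  assumes "cmod w < 1" "\<And>n. cmod (x n) \<le> X"
  shows "summable (\<lambda>n. cmod (x n * peak n w))"
  using peak_majorant[of w "cmod w" x _ X] assms
  by (intro summable_comparison_test'[OF summable_majorant[of "X * (1 - cmod w) powr (- real k)"]]) auto

lemma J_holomorphic:
  assumes X: "\<And>n. cmod (x n) \<le> X"
  shows "J x holomorphic_on ball 0 1"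
proof (rule holomorphic_uniform_sequence[OF open_ball])
  show "(\<lambda>w. \<Sum>i<n. x i * peak i w) holomorphic_on ball 0 1" for n
    by (intro holomorphic_intros peak_holomorphic)
  fix w :: complex assume w: "w \<in> ball 0 1"
  define r where "r = (1 - cmod w) / 2"
  define \<rho> where "\<rho> = (1 + cmod w) / 2"
  have r: "0 < r" "\<rho> < 1" using w by (auto simp: r_def \<rho>_def)
  have sub: "cmod u \<le> \<rho>" if "u \<in> cball w r" for u
  proof -
    have "cmod (u - w) \<le> r" using that by (simp add: dist_norm norm_minus_commute)
    then have "cmod u \<le> cmod w + r" using norm_triangle_ineq[of "u - w" w] by simp
    then show ?thesis by (simp add: r_def \<rho>_def field_simps)
  qed
  have "uniform_limit (cball w r) (\<lambda>n u. \<Sum>i<n. x i * peak i u) (\<lambda>u. \<Sum>i. x i * peak i u) sequentially"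
    using peak_majorant[OF sub r(2) X] by (intro Weierstrass_m_test[OF _ summable_majorant])
  then have "uniform_limit (cball w r) (\<lambda>n u. \<Sum>i<n. x i * peak i u) (J x) sequentially"
    by (rule uniform_limit_cong'[THEN iffD1, rotated -1])
       (use sub r in \<open>force simp: J_def\<close>)+
  moreover have "cball w r \<subseteq> ball 0 1" using sub r by force
  ultimately show "\<exists>r>0. cball w r \<subseteq> ball 0 1 \<and> uniform_limit (cball w r) (\<lambda>n u. \<Sum>i<n. x i * peak i u) (J x) sequentially"
    using r by blast
qed

lemma J_norm_le:
  assumes "cmod w < 1" "\<And>n. cmod (x n) \<le> X"
  shows "summable (\<lambda>n. cmod (peak n w))" "cmod (J x w) \<le> X * (\<Sum>n. cmod (peak n w))"
proof -
  have s: "summable (\<lambda>n. cmod (peak n w))" using J_abs_summable[OF assms(1), of "\<lambda>_. 1" 1] by simp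
  then show "summable (\<lambda>n. cmod (peak n w))" .
  have "cmod (J x w) \<le> (\<Sum>n. cmod (x n * peak n w))"
    using assms J_abs_summable[OF assms] by (simp add: J_def summable_norm)
  also have "\<dots> \<le> (\<Sum>n. X * cmod (peak n w))"
    using assms s J_abs_summable[OF assms] by (intro suminf_le) (auto simp: norm_mult mult_right_mono summable_mult)
  also have "\<dots> = X * (\<Sum>n. cmod (peak n w))" using s by (rule suminf_mult)
  finally show "cmod (J x w) \<le> X * (\<Sum>n. cmod (peak n w))" .
qed

text \<open>The means of the n-th term are of order v^\<beta>. For finite P the decay is shared
  equally: v^(\<beta>/2) serves as the summable weight, and dividing by it leaves P-th powers
  v^(\<beta> P/2), which again sum to a bound independent of the radius. For p = \<infinity> the
  pointwise bounds are summed directly.\<close>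

lemma J_Hle: "\<exists>K>0. \<forall>x X. (\<forall>n. cmod (x n) \<le> X) \<longrightarrow> Hle p \<alpha> (K * X) (J x)"
proof (cases p)
  case (real P)
  then have P: "0 < P" using p by simp
  define W where "W = 2 / (1 - \<eta> powr (\<beta>/2))"
  define V where "V = 2 / (1 - \<eta> powr (\<beta> * P/2))"
  define K where "K = W * V powr (1/P)"
  have "\<eta> powr (\<beta>/2) < 1" "\<eta> powr (\<beta> * P/2) < 1" using \<eta> \<beta>_pos P by (auto simp: powr_lt_one)
  then have WV: "0 < W" "0 < V" by (auto simp: W_def V_def)
  have "Hle p \<alpha> (K * X) (J x)" if X: "\<And>n. cmod (x n) \<le> X" for x X
    unfolding Hle_def
  proof (intro conjI ballI J_holomorphic[OF X])
    fix r :: real assume "r \<in> {0..<1}"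
    then have r: "0 \<le> r" "r < 1" by auto
    define t where "t = 1 - r"
    have t: "0 < t" using r by (simp add: t_def)
    have X0: "0 \<le> X" using X[of 0] norm_ge_zero order_trans by blast
    define w where "w n = v t n powr (\<beta>/2)" for n
    have w: "0 < w n" for n using v_pos[OF t, of n] by (simp add: w_def)
    have ws: "summable w" "(\<Sum>n. w n) \<le> W"
      using v_sum[OF t, of "\<beta>/2"] \<beta>_pos by (auto simp: w_def[abs_def] W_def)
    have cp: "continuous_on (ball 0 1) (peak n)" for n by (rule holomorphic_on_imp_continuous_on[OF peak_holomorphic])
    have [measurable]: "(\<lambda>\<theta>. cmod (peak n (of_real r * cis \<theta>)) powr P) \<in> borel_measurable borel" for n
      by (rule borel_measurable_continuous_onI[OF continuous_on_circle_powr[OF cp r P]])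
    have pt: "ennreal (cmod (J x u) powr P) \<le> ennreal ((X * W) powr P) * (\<Sum>n. ennreal (w n powr (-P)) * ennreal (cmod (peak n u) powr P))"
      if "cmod u < 1" for u
    proof -
      have "cmod (J x u) powr P \<le> (X * (\<Sum>n. cmod (peak n u))) powr P"
        using J_norm_le(2)[OF that X] P by (intro powr_mono2) auto
      also have "\<dots> = X powr P * (\<Sum>n. cmod (peak n u)) powr P" by (rule powr_mult)
      finally have "ennreal (cmod (J x u) powr P) \<le> ennreal (X powr P) * ennreal ((\<Sum>n. cmod (peak n u)) powr P)"
        by (simp add: ennreal_mult[symmetric] ennreal_leI)
      also have "\<dots> \<le> ennreal (X powr P) * (ennreal ((\<Sum>n. w n) powr P) * (\<Sum>n. ennreal ((cmod (peak n u) / w n) powr P)))"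
        using J_norm_le(1)[OF that X] w ws by (intro mult_left_mono powr_suminf_le_weighted P) auto
      also have "\<dots> \<le> ennreal (X powr P) * (ennreal (W powr P) * (\<Sum>n. ennreal ((cmod (peak n u) / w n) powr P)))"
        using ws w P by (intro mult_left_mono mult_right_mono ennreal_leI powr_mono2 suminf_nonneg) (auto simp: less_imp_le)
      also have "\<dots> = ennreal ((X * W) powr P) * (\<Sum>n. ennreal (w n powr (-P)) * ennreal (cmod (peak n u) powr P))"
      proof -
        have "ennreal ((c / w n) powr P) = ennreal (w n powr (-P)) * ennreal (c powr P)" for c n
          by (subst ennreal_mult[symmetric]) (auto simp: powr_divide powr_minus_divide)
        then show ?thesis by (subst powr_mult, subst ennreal_mult) (auto simp: mult.assoc)
      qed
      finally show ?thesis .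
    qed
    have "circ_integral P r (J x) \<le> (\<integral>\<^sup>+\<theta>. ennreal ((X * W) powr P) * (\<Sum>n. ennreal (w n powr (-P)) *
        (ennreal (cmod (peak n (of_real r * cis \<theta>)) powr P) * indicator {0..2*pi} \<theta>)) \<partial>lborel)"
      unfolding circ_integral_def
    proof (rule nn_integral_mono)
      fix \<theta> :: real
      show "ennreal (cmod (J x (of_real r * cis \<theta>)) powr P) * indicator {0..2*pi} \<theta> \<le> ennreal ((X * W) powr P) * (\<Sum>n. ennreal (w n powr (-P)) *
        (ennreal (cmod (peak n (of_real r * cis \<theta>)) powr P) * indicator {0..2*pi} \<theta>))"
        using pt[of "of_real r * cis \<theta>"] r by (cases "\<theta> \<in> {0..2*pi}") (auto simp: norm_mult)
    qed
    also have "\<dots> = ennreal ((X * W) powr P) * (\<Sum>n. ennreal (w n powr (-P)) * circ_integral P r (peak n))"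
      unfolding circ_integral_def by (simp add: nn_integral_cmult nn_integral_suminf)
    also have "\<dots> \<le> ennreal ((X * W) powr P) * (\<Sum>n. ennreal (2*pi * t powr (-\<alpha> * P) * v t n powr (\<beta> * P/2)))"
    proof (intro mult_left_mono suminf_le)
      fix n
      have "circ_integral P r (peak n) \<le> ennreal (2*pi * (t powr (-\<alpha>) * v t n powr \<beta>) powr P)"
        using Mp_peak[OF r, of n] real r by (subst Mp_ereal_le_iff[OF cp r P, symmetric]) (auto simp: t_def)
      then have "ennreal (w n powr (-P)) * circ_integral P r (peak n) \<le>
          ennreal (w n powr (-P)) * ennreal (2*pi * (t powr (-\<alpha>) * v t n powr \<beta>) powr P)"
        by (rule mult_left_mono) simp
      also have "\<dots> = ennreal (w n powr (-P) * (2*pi * (t powr (-\<alpha>) * v t n powr \<beta>) powr P))"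
        by (simp add: ennreal_mult)
      also have "w n powr (-P) * (2*pi * (t powr (-\<alpha>) * v t n powr \<beta>) powr P) = 2*pi * t powr (-\<alpha> * P) * v t n powr (\<beta> * P/2)"
      proof -
        have "w n powr (-P) * v t n powr (\<beta> * P) = v t n powr (\<beta> * P/2)"
          unfolding w_def powr_powr powr_add[symmetric] by (simp add: mult.commute)
        then show ?thesis by (simp add: powr_mult powr_powr mult_ac)
      qed
      finally show "ennreal (w n powr (-P)) * circ_integral P r (peak n) \<le> ennreal (2*pi * t powr (-\<alpha> * P) * v t n powr (\<beta> * P/2))" .
    qed auto
    also have "(\<Sum>n. ennreal (2*pi * t powr (-\<alpha> * P) * v t n powr (\<beta> * P/2))) = ennreal (\<Sum>n. 2*pi * t powr (-\<alpha> * P) * v t n powr (\<beta> * P/2))"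
      using v_sum(1)[OF t, of "\<beta> * P/2"] \<beta>_pos P by (intro suminf_ennreal2 summable_mult) auto
    also have "(\<Sum>n. 2*pi * t powr (-\<alpha> * P) * v t n powr (\<beta> * P/2)) = 2*pi * t powr (-\<alpha> * P) * (\<Sum>n. v t n powr (\<beta> * P/2))"
      using v_sum(1)[OF t, of "\<beta> * P/2"] \<beta>_pos P by (intro suminf_mult) auto
    also have "ennreal ((X * W) powr P) * ennreal (2*pi * t powr (-\<alpha> * P) * (\<Sum>n. v t n powr (\<beta> * P/2)))
        \<le> ennreal ((X * W) powr P) * ennreal (2*pi * t powr (-\<alpha> * P) * V)"
      using v_sum(2)[OF t, of "\<beta> * P/2"] \<beta>_pos P unfolding V_def
      by (intro mult_left_mono ennreal_leI) auto
    also have "\<dots> = ennreal (2*pi * (K * X * t powr (-\<alpha>)) powr P)"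
      using WV P by (simp add: ennreal_mult[symmetric] K_def powr_mult powr_powr mult_ac)
    \<comment> \<open>\<open>J\<close> itself depends on the locale parameter p, so only the index
      of \<open>Mp\<close> is rewritten to \<open>ereal P\<close>.\<close>
    finally show "Mp p r (J x) \<le> K * X * (1 - r) powr (-\<alpha>)"
      unfolding arg_cong[where f = "\<lambda>s. Mp s r (J x)", OF real] t_def[symmetric] using WV X0
      by (subst Mp_ereal_le_iff[OF holomorphic_on_imp_continuous_on[OF J_holomorphic[OF X]] r P]) (auto simp: K_def)
  qed
  moreover have "K > 0" using WV by (simp add: K_def)
  ultimately show ?thesis by blast
next
  case PInf
  have q0: "q = 0" unfolding q_def using PInf by (simp add: pinv_def)
  define K where "K = 2 / (1 - \<eta> powr \<beta>)"
  have "Hle p \<alpha> (K * X) (J x)" if X: "\<And>n. cmod (x n) \<le> X" for x X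
    unfolding Hle_def
  proof (intro conjI ballI J_holomorphic[OF X])
    fix r :: real assume r: "r \<in> {0..<1}"
    have X0: "0 \<le> X" using X[of 0] norm_ge_zero order_trans by blast
    have "cmod (J x w) \<le> K * X * (1 - r) powr (-\<alpha>)" if w: "cmod w = r" for w
    proof -
      have w1: "cmod w < 1" using w r by simp
      have "(\<Sum>n. cmod (peak n w)) \<le> (\<Sum>n. (1 - r) powr (-\<alpha>) * v (1 - r) n powr \<beta>)"
      proof (rule suminf_le)
        fix n
        have "(1 - r) powr \<alpha> * cmod (peak n w) \<le> v (1 - r) n powr \<beta>"
          using peak_growth[OF w1, of n] w q0 by simp
        then show "cmod (peak n w) \<le> (1 - r) powr (-\<alpha>) * v (1 - r) n powr \<beta>"
          using r by (simp add: powr_minus field_simps)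
      qed (use J_norm_le(1)[OF w1 X] v_sum(1)[of "1 - r" \<beta>] r \<beta>_pos in \<open>auto intro!: summable_mult\<close>)
      also have "\<dots> = (1 - r) powr (-\<alpha>) * (\<Sum>n. v (1 - r) n powr \<beta>)"
        using v_sum(1)[of "1 - r" \<beta>] r \<beta>_pos by (intro suminf_mult) auto
      also have "\<dots> \<le> (1 - r) powr (-\<alpha>) * K"
        using v_sum(2)[of "1 - r" \<beta>] r \<beta>_pos by (intro mult_left_mono) (auto simp: K_def)
      finally have "X * (\<Sum>n. cmod (peak n w)) \<le> X * ((1 - r) powr (-\<alpha>) * K)"
        using X0 by (rule mult_left_mono)
      with J_norm_le(2)[OF w1, of x X, OF X] show ?thesis by (simp add: mult_ac)
    qed
    then show "Mp p r (J x) \<le> K * X * (1 - r) powr (-\<alpha>)"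
      unfolding arg_cong[where f = "\<lambda>s. Mp s r (J x)", OF PInf]
      using r Mp_infinity_le_iff[OF holomorphic_on_imp_continuous_on[OF J_holomorphic[OF X]]] by auto
  qed
  moreover have "K > 0" using \<eta> \<beta>_pos by (simp add: K_def powr_lt_one)
  ultimately show ?thesis by blast
qed (use p in auto)

text \<open>At its own point the n-th kernel, scaled by d_n^(\<alpha>+q), equals (1 + |z n|)^-k,
  hence is at least 2^-k. The others are bounded by X v^\<beta>; one half of the exponent gives the
  small factor m, the other half a sum of at most 2/(1 - m) \<le> 4. So they contribute at most 4 m
  X \<le> X / 2^(k+1).\<close>

lemma J_lower:
  assumes X: "\<And>n. cmod (x n) \<le> X"
  shows "cmod (x n) / 2 ^ k \<le> d n powr (\<alpha> + q) * cmod (J x (z n)) + X / 2 ^ (k + 1)"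
proof -
  \<comment> \<open>Deleting one coordinate makes J y (z n) exactly the off-diagonal part of the
    series.\<close>
  define y where "y = x(n := 0)"
  have y: "cmod (y m) \<le> X" for m using X[of m] order_trans[OF norm_ge_zero X] by (simp add: y_def)
  have s: "summable (\<lambda>m. x m * peak m (z n))" "summable (\<lambda>m. y m * peak m (z n))"
    using J_abs_summable[OF z X] J_abs_summable[OF z y] by (auto intro: summable_norm_cancel)
  have split: "J x (z n) = x n * peak n (z n) + J y (z n)"
  proof -
    have "(\<Sum>m. x m * peak m (z n)) - (\<Sum>m. y m * peak m (z n)) = (\<Sum>m. x m * peak m (z n) - y m * peak m (z n))"
      using s by (rule suminf_diff)
    also have "\<dots> = (\<Sum>m\<in>{n}. x m * peak m (z n) - y m * peak m (z n))"
      by (rule suminf_finite) (auto simp: y_def)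
    also have "\<dots> = x n * peak n (z n)" by (simp add: y_def)
    finally show ?thesis using z[of n] by (simp add: J_def algebra_simps)
  qed
  have dn: "1 - cmod (z n) = d n" by (simp add: d_def)
  define m where "m = \<eta> powr (\<beta>/2)"
  have m: "0 < m" "m \<le> 1 / 2 ^ (k + 3)" using \<eta> small by (auto simp: m_def \<beta>_def q_def)
  have m8: "m \<le> 1/8"
  proof -
    have "(1::real) / 2 ^ (k + 3) \<le> 1 / 2 ^ 3" by (intro divide_left_mono power_increasing) auto
    from order_trans[OF m(2) this] show ?thesis by simp
  qed
  have diag: "1 / 2 ^ k \<le> d n powr (\<alpha> + q) * cmod (peak n (z n))"
  proof -
    have e: "1 - cnj (z n) * z n = of_real (1 - (cmod (z n))\<^sup>2)"
      by (simp only: mult.commute[of "cnj (z n)"] complex_norm_square[symmetric] of_real_diff of_real_1)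
    have e2: "1 - (cmod (z n))\<^sup>2 = d n * (1 + cmod (z n))" by (simp add: d_def power2_eq_square algebra_simps)
    have "cmod (peak n (z n)) = d n powr (k - \<alpha> - q) / (d n * (1 + cmod (z n))) ^ k"
      unfolding peak_def e e2 using d_pos[of n]
      by (simp add: norm_mult norm_divide norm_power abs_mult add_nonneg_nonneg del: of_real_mult of_real_add)
    then have "d n powr (\<alpha> + q) * cmod (peak n (z n)) = (d n powr (\<alpha> + q) * d n powr (k - \<alpha> - q)) / (d n ^ k * (1 + cmod (z n)) ^ k)"
      by (simp add: power_mult_distrib)
    also have "d n powr (\<alpha> + q) * d n powr (k - \<alpha> - q) = d n ^ k"
      using d_pos[of n] by (simp add: powr_add[symmetric] powr_realpow)
    also have "d n ^ k / (d n ^ k * (1 + cmod (z n)) ^ k) = 1 / (1 + cmod (z n)) ^ k"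
      using d_pos[of n] by simp
    also have "\<dots> \<ge> 1 / 2 ^ k" using z[of n] by (intro divide_left_mono power_mono mult_pos_pos) (auto simp: add_pos_nonneg)
    finally show ?thesis .
  qed
  have off: "d n powr (\<alpha> + q) * cmod (J y (z n)) \<le> X / 2 ^ (k + 1)"
  proof -
    have sy: "summable (\<lambda>m. cmod (y m * peak m (z n)))" by (rule J_abs_summable[OF z y])
    have sv: "summable (\<lambda>j. v (d n) j powr (\<beta>/2))" "(\<Sum>j. v (d n) j powr (\<beta>/2)) \<le> 2 / (1 - m)"
      using v_sum[OF d_pos, of "\<beta>/2" n] \<beta>_pos by (auto simp: m_def)
    have X0: "0 \<le> X" using order_trans[OF norm_ge_zero X] .
    have "cmod (J y (z n)) \<le> (\<Sum>m. cmod (y m * peak m (z n)))"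
      using z sy by (simp add: J_def summable_norm)
    then have "d n powr (\<alpha> + q) * cmod (J y (z n)) \<le> d n powr (\<alpha> + q) * (\<Sum>m. cmod (y m * peak m (z n)))"
      by (intro mult_left_mono) auto
    also have "\<dots> = (\<Sum>m. d n powr (\<alpha> + q) * cmod (y m * peak m (z n)))"
      using sy by (rule suminf_mult[symmetric])
    also have "\<dots> \<le> (\<Sum>j. X * m * v (d n) j powr (\<beta>/2))"
    proof (rule suminf_le)
      fix j
      show "d n powr (\<alpha> + q) * cmod (y j * peak j (z n)) \<le> X * m * v (d n) j powr (\<beta>/2)"
      proof (cases "j = n")
        case True
        then show ?thesis using X0 m by (simp add: y_def)
      next
        case False
        have "d n powr (\<alpha> + q) * cmod (y j * peak j (z n)) = cmod (y j) * (d n powr (\<alpha> + q) * cmod (peak j (z n)))"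
          by (simp add: norm_mult)
        also have "\<dots> \<le> X * v (d n) j powr \<beta>"
          using peak_growth[OF z[of n], of j] y[of j] X0 unfolding dn by (intro mult_mono) auto
        also have "v (d n) j powr \<beta> = v (d n) j powr (\<beta>/2) * v (d n) j powr (\<beta>/2)"
          by (simp add: powr_add[symmetric])
        also have "\<dots> \<le> m * v (d n) j powr (\<beta>/2)"
          using v_off_diagonal[OF False] v_pos[OF d_pos, of n j] \<beta>_pos unfolding m_def
          by (intro mult_right_mono powr_mono2) auto
        finally show ?thesis using X0 by (simp add: mult_left_mono mult.assoc)
      qed
    qed (use sy sv in \<open>auto intro!: summable_mult\<close>)
    also have "\<dots> = X * m * (\<Sum>j. v (d n) j powr (\<beta>/2))" using sv by (intro suminf_mult)
    also have "\<dots> \<le> X * m * (2 / (1 - m))" using sv X0 m by (intro mult_left_mono) auto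
    also have "\<dots> \<le> X * m * 4" using X0 m m8 by (intro mult_left_mono) (auto simp: field_simps)
    also have "\<dots> \<le> X * (1 / 2 ^ (k + 3)) * 4" using X0 m by (intro mult_right_mono mult_left_mono) auto
    also have "\<dots> = X / 2 ^ (k + 1)" by (simp add: power_add)
    finally show ?thesis .
  qed
  have "cmod (x n) * (1 / 2 ^ k) \<le> cmod (x n) * (d n powr (\<alpha> + q) * cmod (peak n (z n)))"
    using diag by (intro mult_left_mono) auto
  also have "\<dots> = d n powr (\<alpha> + q) * cmod (x n * peak n (z n))" by (simp add: norm_mult)
  also have "\<dots> \<le> d n powr (\<alpha> + q) * (cmod (J x (z n)) + cmod (J y (z n)))"
    using norm_triangle_ineq4[of "J x (z n)" "J y (z n)"] split by (intro mult_left_mono) auto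
  also have "\<dots> \<le> d n powr (\<alpha> + q) * cmod (J x (z n)) + X / 2 ^ (k + 1)" using off by (simp add: distrib_left)
  finally show ?thesis by simp
qed

lemma J_add:
  assumes "\<And>n. cmod (x n) \<le> X" "\<And>n. cmod (y n) \<le> Y"
  shows "J (\<lambda>n. x n + y n) = (\<lambda>w. J x w + J y w)"
proof
  fix w
  show "J (\<lambda>n. x n + y n) w = J x w + J y w"
    using J_abs_summable[of w x X] J_abs_summable[of w y Y] assms
    by (auto simp: J_def distrib_right suminf_add summable_norm_cancel)
qed

lemma J_scale:
  assumes "\<And>n. cmod (x n) \<le> X"
  shows "J (\<lambda>n. s * x n) = (\<lambda>w. s * J x w)"
proof
  fix w
  show "J (\<lambda>n. s * x n) w = s * J x w"
    using J_abs_summable[of w x X] assms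
    by (auto simp: J_def mult.assoc suminf_mult summable_norm_cancel)
qed

text \<open>Boundedness of these functions, with a constant depending on the truncation, is the
  starting point of the c_0 case.\<close>

lemma J_finite_bounded:
  obtains B where "0 \<le> B" "\<And>w. cmod w < 1 \<Longrightarrow> cmod (J (\<lambda>n. if n < N then x n else 0) w) \<le> B"
proof
  define B where "B = (\<Sum>n<N. cmod (x n) * (d n powr (k - \<alpha> - q) * d n powr (- real k)))"
  show "0 \<le> B" unfolding B_def by (intro sum_nonneg) auto
  fix w :: complex assume w: "cmod w < 1"
  have "(\<Sum>n. (if n < N then x n else 0) * peak n w) = (\<Sum>n<N. (if n < N then x n else 0) * peak n w)"
    by (rule suminf_finite) auto
  then have "J (\<lambda>n. if n < N then x n else 0) w = (\<Sum>n<N. x n * peak n w)" using w by (simp add: J_def)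
  also have "cmod \<dots> \<le> (\<Sum>n<N. cmod (x n * peak n w))" by (rule norm_sum)
  also have "\<dots> \<le> B" unfolding B_def norm_mult
  proof (intro sum_mono mult_left_mono)
    fix n
    have "cmod (peak n w) \<le> d n powr (k - \<alpha> - q) * max (1 - cmod w) (d n) powr (- real k)" by (rule peak_norm_le[OF w])
    also have "\<dots> \<le> d n powr (k - \<alpha> - q) * d n powr (- real k)"
      using d_pos[of n] by (intro mult_left_mono powr_mono2') auto
    finally show "cmod (peak n w) \<le> d n powr (k - \<alpha> - q) * d n powr (- real k)" .
  qed auto
  finally show "cmod (J (\<lambda>n. if n < N then x n else 0) w) \<le> B" .
qed

end

section \<open>The action of \<open>Tg\<close> on the range of \<open>J\<close>\<close>

text \<open>For bounded f the Bloch bound makes f g' of order 1/(1 - |w|), so its primitive grows at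
  most logarithmically. The cruder power \<alpha>/2 is enough, since any exponent below \<alpha>
  leads into \<open>H0\<close>.\<close>

lemma Tg_bounded_in_H0:
  assumes "0 < p" "0 < \<alpha>" "g \<in> Bloch" and f: "f holomorphic_on ball 0 1"
    and B: "0 \<le> B" "\<And>z. cmod z < 1 \<Longrightarrow> cmod (f z) \<le> B"
  shows "Tg g f \<in> H0 p \<alpha>"
proof -
  have g: "g holomorphic_on ball 0 1" using assms by (simp add: Bloch_def)
  obtain b where b: "0 < b" "\<And>z. cmod z < 1 \<Longrightarrow> cmod (deriv g z) \<le> b / (1 - cmod z)"
    using Bloch_deriv_bound[OF assms(3)] by blast
  note der = Tg_has_field_derivative[OF g f]
  have "Tg g f holomorphic_on ball 0 1"
    unfolding holomorphic_on_open[OF open_ball] by (auto intro!: exI der(1))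
  moreover have "cmod (Tg g f z) \<le> B * b / (\<alpha>/2) * (1 - cmod z) powr (-(\<alpha>/2))" if "cmod z < 1" for z
  proof (rule radial_growth[OF der])
    fix w :: complex assume w: "cmod w < 1"
    have "cmod (f w * deriv g w) \<le> B * (b / (1 - cmod w))"
      unfolding norm_mult using B b(2)[OF w] w by (intro mult_mono) auto
    also have "\<dots> = B * b * (1 - cmod w) powr (-1)"
      using w by (simp add: powr_minus_divide)
    also have "\<dots> \<le> B * b * (1 - cmod w) powr (-(\<alpha>/2 + 1))"
      using w B(1) b(1) assms(2) by (intro mult_left_mono powr_mono') auto
    finally show "cmod (f w * deriv g w) \<le> B * b * (1 - cmod w) powr (-(\<alpha>/2 + 1))" .
  qed (use assms that in auto)
  ultimately show ?thesis
    using assms b(1) by (intro growth_imp_H0[of _ _ "\<alpha>/2" _ "B * b / (\<alpha>/2)"]) auto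
qed

lemma uncountable_nat_sets: "uncountable (UNIV :: nat set set)"
proof
  assume "countable (UNIV :: nat set set)"
  then have "range (from_nat_into (UNIV :: nat set set)) = UNIV" by (intro range_from_nat_into) auto
  then have "range (from_nat_into (UNIV :: nat set set)) = Pow UNIV" by simp
  then show False using Cantors_theorem[of "UNIV :: nat set"] by blast
qed

lemma linf_bound: "x \<in> linf \<Longrightarrow> cmod (x n) \<le> supnorm x"
  unfolding supnorm_def linf_def
  by (rule cSUP_upper) (auto simp: bounded_iff bdd_above_def)

lemma c0_subset_linf: "c0 \<subseteq> linf"
  using convergent_imp_bounded by (auto simp: c0_def linf_def)

lemma supnorm_le: "(\<And>n. cmod (x n) \<le> B) \<Longrightarrow> supnorm x \<le> B"
  unfolding supnorm_def by (rule cSUP_least) auto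

locale Bloch_peak_family = peak_family +
  fixes g :: "complex \<Rightarrow> complex" and e :: real
  assumes g: "g \<in> Bloch" and e: "0 < e" and ge: "e \<le> (1 - (cmod (z n))\<^sup>2) * cmod (deriv g (z n))"
begin

lemma g_holomorphic: "g holomorphic_on ball 0 1"
  using g by (simp add: Bloch_def)

lemma J_linf: "x \<in> linf \<Longrightarrow> J x holomorphic_on ball 0 1"
  using J_holomorphic linf_bound by blast

text \<open>With X = supnorm x the error in \<open>J_lower\<close> becomes half of supnorm x after
  multiplication by 2^k, and is absorbed on the left.\<close>

lemma supnorm_le_of_samples:
  assumes x: "x \<in> linf" and Y: "\<And>n. d n powr (\<alpha> + q) * cmod (J x (z n)) \<le> Y"
  shows "supnorm x \<le> 2 ^ (k + 1) * Y"
proof -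
  have "supnorm x \<le> 2 ^ k * (Y + supnorm x / 2 ^ (k + 1))"
  proof (rule supnorm_le)
    fix n
    have "cmod (x n) / 2 ^ k \<le> Y + supnorm x / 2 ^ (k + 1)"
      using J_lower[of x "supnorm x" n, OF linf_bound[OF x]] Y[of n] by linarith
    then show "cmod (x n) \<le> 2 ^ k * (Y + supnorm x / 2 ^ (k + 1))"
      by (simp add: pos_divide_le_eq mult.commute)
  qed
  also have "\<dots> = 2 ^ k * Y + supnorm x / 2" by (simp add: field_simps)
  finally show ?thesis by simp
qed

lemma supnorm_le_J: "\<exists>M>0. \<forall>x\<in>linf. \<forall>A. Hle p \<alpha> A (J x) \<longrightarrow> supnorm x \<le> M * A"
proof -
  obtain C where C: "C > 0" "\<And>A F w. Hle p \<alpha> A F \<Longrightarrow> cmod w < 1 \<Longrightarrow> cmod (F w) \<le> C * A * (1 - cmod w) powr (-(\<alpha> + q))"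
    using pointwise_growth[OF p \<alpha>] unfolding q_def by meson
  have "supnorm x \<le> 2 ^ (k + 1) * (C * A)" if x: "x \<in> linf" and A: "Hle p \<alpha> A (J x)" for x A
  proof (rule supnorm_le_of_samples[OF x])
    fix n
    have "d n powr (\<alpha> + q) * cmod (J x (z n)) \<le> d n powr (\<alpha> + q) * (C * A * d n powr (-(\<alpha> + q)))"
      using C(2)[OF A z, of n] by (intro mult_left_mono) (auto simp: d_def)
    also have "\<dots> = C * A" using d_pos[of n] powr_add[of "d n" "\<alpha> + q" "-(\<alpha> + q)"] by simp
    finally show "d n powr (\<alpha> + q) * cmod (J x (z n)) \<le> C * A" .
  qed
  then show ?thesis using C(1) by (intro exI[of _ "2 ^ (k + 1) * C"]) (auto simp: mult.assoc)
qed

text \<open>Differentiating undoes the integral. The extra power of d_n in the growth of derivatives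
  is cancelled by |g'(z n)| >= e/(2 d_n), the factor 2 coming from 1 + |z n| < 2.\<close>

lemma supnorm_le_Tg_J: "\<exists>M>0. \<forall>x\<in>linf. \<forall>A. Hle p \<alpha> A (Tg g (J x)) \<longrightarrow> supnorm x \<le> M * A"
proof -
  obtain C where C: "C > 0" "\<And>A F w. Hle p \<alpha> A F \<Longrightarrow> cmod w < 1 \<Longrightarrow> cmod (deriv F w) \<le> C * A * (1 - cmod w) powr (-(\<alpha> + q + 1))"
    using deriv_growth[OF p \<alpha>] unfolding q_def by meson
  have "supnorm x \<le> 2 ^ (k + 1) * (2 * C / e * A)" if x: "x \<in> linf" and A: "Hle p \<alpha> A (Tg g (J x))" for x A
  proof (rule supnorm_le_of_samples[OF x])
    fix n
    have gn: "e / (2 * d n) \<le> cmod (deriv g (z n))"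
    proof -
      have "1 - (cmod (z n))\<^sup>2 = d n * (1 + cmod (z n))" by (simp add: d_def power2_eq_square algebra_simps)
      also have "\<dots> \<le> d n * 2" using d_pos[of n] z[of n] by (intro mult_left_mono) auto
      finally have "(1 - (cmod (z n))\<^sup>2) * cmod (deriv g (z n)) \<le> d n * 2 * cmod (deriv g (z n))"
        by (intro mult_right_mono) auto
      with ge[of n] have "e \<le> d n * 2 * cmod (deriv g (z n))" by linarith
      then show ?thesis using d_pos[of n] by (simp add: field_simps)
    qed
    have "deriv (Tg g (J x)) (z n) = J x (z n) * deriv g (z n)"
      by (rule DERIV_imp_deriv[OF Tg_has_field_derivative(1)[OF g_holomorphic J_linf[OF x] z]])
    then have "cmod (J x (z n)) * cmod (deriv g (z n)) \<le> C * A * d n powr (-(\<alpha> + q + 1))"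
      using C(2)[OF A z, of n] by (simp add: norm_mult d_def)
    then have "cmod (J x (z n)) * (e / (2 * d n)) \<le> C * A * d n powr (-(\<alpha> + q + 1))"
      using gn by (meson mult_left_mono norm_ge_zero order_trans)
    then have le: "(2 * d n / e * d n powr (\<alpha> + q)) * (cmod (J x (z n)) * (e / (2 * d n))) \<le> (2 * d n / e * d n powr (\<alpha> + q)) * (C * A * d n powr (-(\<alpha> + q + 1)))"
      using d_pos[of n] e by (intro mult_left_mono) auto
    have lhs: "(2 * d n / e * d n powr (\<alpha> + q)) * (cmod (J x (z n)) * (e / (2 * d n))) = d n powr (\<alpha> + q) * cmod (J x (z n))"
      using d_pos[of n] e by simp
    have rhs: "(2 * d n / e * d n powr (\<alpha> + q)) * (C * A * d n powr (-(\<alpha> + q + 1))) = 2 * C / e * A"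
    proof -
      have "d n * d n powr (\<alpha> + q) * d n powr (-(\<alpha> + q + 1)) = d n powr (1 + (\<alpha> + q) + (-(\<alpha> + q + 1)))"
        unfolding powr_add using d_pos[of n] by simp
      also have "\<dots> = 1" using d_pos[of n] by simp
      finally have "2 * C / e * A * (d n * d n powr (\<alpha> + q) * d n powr (-(\<alpha> + q + 1))) = 2 * C / e * A"
        by (simp only: mult_1_right)
      then show ?thesis by (simp only: times_divide_eq_left times_divide_eq_right mult_ac)
    qed
    show "d n powr (\<alpha> + q) * cmod (J x (z n)) \<le> 2 * C / e * A" by (rule le[unfolded lhs rhs])
  qed
  then show ?thesis using C(1) e by (intro exI[of _ "2 ^ (k + 1) * (2 * C / e)"]) (auto simp: mult.assoc)
qed

text \<open>A null sequence is a truncation u N plus a tail r N with small supremum.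
  \<open>J_Hle\<close> and \<open>Tg_Hle\<close> make the tail's function and its image small in
  norm, the truncated parts lie in \<open>H0\<close>, and closedness of \<open>H0\<close>
  concludes.\<close>

lemma J_c0:
  assumes x: "x \<in> c0"
  shows "J x \<in> H0 p \<alpha>" "Tg g (J x) \<in> H0 p \<alpha>"
proof -
  have xl: "x \<in> linf" using x c0_subset_linf by blast
  obtain K where K: "K > 0" "\<And>x X. (\<And>n. cmod (x n) \<le> X) \<Longrightarrow> Hle p \<alpha> (K * X) (J x)"
    using J_Hle by meson
  obtain L where L: "L > 0" "\<And>A f. Hle p \<alpha> A f \<Longrightarrow> Hle p \<alpha> (L * A) (Tg g f)"
    using Tg_Hle[OF p \<alpha> g] by meson
  have JH: "Hle p \<alpha> (K * supnorm x) (J x)" by (rule K(2)[OF linf_bound[OF xl]])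
  define u where "u N n = (if n < N then x n else 0)" for N n :: nat
  define r where "r N n = (if n < N then 0 else x n)" for N n :: nat
  have u: "cmod (u N n) \<le> supnorm x" and r: "cmod (r N n) \<le> supnorm x" for N n
    using linf_bound[OF xl] order_trans[OF norm_ge_zero linf_bound[OF xl]] by (auto simp: u_def r_def)
  have hol: "J (u N) holomorphic_on ball 0 1" "J (r N) holomorphic_on ball 0 1" for N
    using J_holomorphic[OF u] J_holomorphic[OF r] by auto
  have Jx: "J x = (\<lambda>w. J (u N) w + J (r N) w)" for N
  proof -
    have "x = (\<lambda>n. u N n + r N n)" by (auto simp: u_def r_def)
    then show ?thesis using J_add[of "u N" "supnorm x" "r N" "supnorm x", OF u r] by simp
  qed
  have tail: "\<exists>N. Hle p \<alpha> \<epsilon> (J (r N))" if "0 < \<epsilon>" for \<epsilon>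
  proof -
    have "eventually (\<lambda>n. cmod (x n) < \<epsilon> / K) sequentially"
      using x K(1) that by (intro order_tendstoD(2)[of _ 0]) (auto simp: c0_def tendsto_norm_zero)
    then obtain N where "\<And>n. N \<le> n \<Longrightarrow> cmod (x n) < \<epsilon> / K" by (auto simp: eventually_sequentially)
    then have "cmod (r N n) \<le> \<epsilon> / K" for n
      using K(1) that by (cases "n < N") (auto simp: r_def less_imp_le)
    from K(2)[of "r N", OF this] show ?thesis using K(1) by auto
  qed
  have uH0: "J (u N) \<in> H0 p \<alpha>" "Tg g (J (u N)) \<in> H0 p \<alpha>" for N
  proof -
    obtain B where B: "0 \<le> B" "\<And>w. cmod w < 1 \<Longrightarrow> cmod (J (u N) w) \<le> B"
      using J_finite_bounded[of N x] unfolding u_def by blast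
    show "J (u N) \<in> H0 p \<alpha>"
      using B p \<alpha> hol by (intro growth_imp_H0[of _ _ 0 _ B]) auto
    show "Tg g (J (u N)) \<in> H0 p \<alpha>"
      by (rule Tg_bounded_in_H0[OF p \<alpha> g hol(1) B])
  qed
  show "J x \<in> H0 p \<alpha>"
  proof (rule H0_closed[OF p])
    show "J x \<in> Hinf p \<alpha>" using JH Hinf_Hnorm_le_iff_Hle by blast
    fix \<epsilon> :: real assume "0 < \<epsilon>"
    then obtain N where N: "Hle p \<alpha> \<epsilon> (J (r N))" using tail by blast
    have "(\<lambda>w. J x w - J (u N) w) = J (r N)" by (subst Jx[of N]) auto
    then show "\<exists>h\<in>H0 p \<alpha>. Hle p \<alpha> \<epsilon> (\<lambda>w. J x w - h w)" using N uH0(1)[of N] by metis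
  qed
  show "Tg g (J x) \<in> H0 p \<alpha>"
  proof (rule H0_closed[OF p])
    show "Tg g (J x) \<in> Hinf p \<alpha>" using L(2)[OF JH] Hinf_Hnorm_le_iff_Hle by blast
    fix \<epsilon> :: real assume "0 < \<epsilon>"
    then obtain N where N: "Hle p \<alpha> (\<epsilon> / L) (J (r N))" using tail[of "\<epsilon> / L"] L(1) by auto
    have "Hle p \<alpha> \<epsilon> (Tg g (J (r N)))" using L(2)[OF N] L(1) by simp
    moreover have "Tg g (J (r N)) w = Tg g (J x) w - Tg g (J (u N)) w" if "w \<in> ball 0 1" for w
    proof -
      have "(\<lambda>w. J x w - J (u N) w) = J (r N)" by (subst Jx[of N]) auto
      then show ?thesis using Tg_diff[OF g_holomorphic J_linf[OF xl] hol(1)[of N], of w] that by simp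
    qed
    ultimately have "Hle p \<alpha> \<epsilon> (\<lambda>w. Tg g (J x) w - Tg g (J (u N)) w)"
      using Hle_cong[of "Tg g (J (r N))" "\<lambda>w. Tg g (J x) w - Tg g (J (u N)) w" p \<alpha> \<epsilon>] by blast
    then show "\<exists>h\<in>H0 p \<alpha>. Hle p \<alpha> \<epsilon> (\<lambda>w. Tg g (J x) w - h w)" using uH0(2)[of N] by blast
  qed
qed

text \<open>The estimates are the same for both sequence spaces; only the membership of J x and its
  image differs, so it is left as a hypothesis. The lower bound for \<open>Tg\<close> combines the
  upper bound K for \<open>J\<close> with the bound M' of supnorm x by the image.\<close>

lemma fixes_copy_J:
  assumes Y: "Y \<subseteq> linf" and Z: "Z \<subseteq> Hinf p \<alpha>" and mem: "\<And>x. x \<in> Y \<Longrightarrow> J x \<in> Z \<and> Tg g (J x) \<in> Z"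
  shows "fixes_copy Y Z (Hnorm p \<alpha>) (Tg g)"
proof -
  obtain K where K: "K > 0" "\<And>x X. (\<And>n. cmod (x n) \<le> X) \<Longrightarrow> Hle p \<alpha> (K * X) (J x)"
    using J_Hle by meson
  obtain M where M: "M > 0" "\<And>x A. x \<in> linf \<Longrightarrow> Hle p \<alpha> A (J x) \<Longrightarrow> supnorm x \<le> M * A"
    using supnorm_le_J by meson
  obtain M' where M': "M' > 0" "\<And>x A. x \<in> linf \<Longrightarrow> Hle p \<alpha> A (Tg g (J x)) \<Longrightarrow> supnorm x \<le> M' * A"
    using supnorm_le_Tg_J by meson
  have low: "1 / M * supnorm x \<le> Hnorm p \<alpha> (J x)" and up: "Hnorm p \<alpha> (J x) \<le> K * supnorm x"
    and T: "1 / (K * M') * Hnorm p \<alpha> (J x) \<le> Hnorm p \<alpha> (Tg g (J x))" if x: "x \<in> Y" for x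
  proof -
    have xl: "x \<in> linf" using x Y by blast
    have "J x \<in> Hinf p \<alpha>" "Tg g (J x) \<in> Hinf p \<alpha>" using mem[OF x] Z by auto
    note H = this[THEN Hle_Hnorm]
    show "1 / M * supnorm x \<le> Hnorm p \<alpha> (J x)" using M(2)[OF xl H(1)] M(1) by (simp add: field_simps)
    show up: "Hnorm p \<alpha> (J x) \<le> K * supnorm x"
      using K(2)[of x "supnorm x", OF linf_bound[OF xl]] Hinf_Hnorm_le_iff_Hle by blast
    have "K * supnorm x \<le> K * (M' * Hnorm p \<alpha> (Tg g (J x)))"
      using M'(2)[OF xl H(2)] K(1) by (intro mult_left_mono) auto
    with up have "Hnorm p \<alpha> (J x) \<le> K * (M' * Hnorm p \<alpha> (Tg g (J x)))" by linarith
    then show "1 / (K * M') * Hnorm p \<alpha> (J x) \<le> Hnorm p \<alpha> (Tg g (J x))"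
      using K(1) M'(1) by (simp add: field_simps)
  qed
  have "J (\<lambda>n. x n + y n) = (\<lambda>w. J x w + J y w)" if "x \<in> Y" "y \<in> Y" for x y
    using that Y by (intro J_add[of x "supnorm x" y "supnorm y"] linf_bound) auto
  moreover have "J (\<lambda>n. s * x n) = (\<lambda>w. s * J x w)" if "x \<in> Y" for x s
    using that Y by (intro J_scale[of x "supnorm x"] linf_bound) auto
  ultimately show ?thesis unfolding fixes_copy_def using K(1) M(1) M'(1) low up T mem
    by (intro exI[of _ J] exI[of _ "1/M"] exI[of _ K] exI[of _ "1 / (K * M')"] conjI ballI allI) auto
qed

lemma Tg_Hinf: "f \<in> Hinf p \<alpha> \<Longrightarrow> Tg g f \<in> Hinf p \<alpha>"
  using Tg_Hle[OF p \<alpha> g] Hle_Hnorm[of f p \<alpha>] Hinf_Hnorm_le_iff_Hle by blast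

lemma J_Hinf: "x \<in> linf \<Longrightarrow> J x \<in> Hinf p \<alpha>"
  using J_Hle linf_bound[of x] Hinf_Hnorm_le_iff_Hle by blast

text \<open>Indicators of distinct sets of naturals are at supremum distance 1, so their images stay
  a fixed distance apart. Choosing a nearby element of a countable dense set for each set would
  therefore be injective on an uncountable domain.\<close>

lemma not_separable_range: "\<not> separable_in (Tg g ` Hinf p \<alpha>) (Hnorm p \<alpha>)"
proof
  assume "separable_in (Tg g ` Hinf p \<alpha>) (Hnorm p \<alpha>)"
  then obtain D where D: "countable D" "D \<subseteq> Tg g ` Hinf p \<alpha>"
    "\<And>f e. f \<in> Tg g ` Hinf p \<alpha> \<Longrightarrow> 0 < e \<Longrightarrow> \<exists>d\<in>D. Hnorm p \<alpha> (\<lambda>z. f z - d z) < e"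
    unfolding separable_in_def by meson
  obtain M where M: "M > 0" "\<And>x A. x \<in> linf \<Longrightarrow> Hle p \<alpha> A (Tg g (J x)) \<Longrightarrow> supnorm x \<le> M * A"
    using supnorm_le_Tg_J by meson
  obtain K where K: "K > 0" "\<And>f h A B. Hle p \<alpha> A f \<Longrightarrow> Hle p \<alpha> B h \<Longrightarrow> Hle p \<alpha> (K * (A + B)) (\<lambda>z. f z + h z)"
    using Hle_add[OF p] by meson
  \<comment> \<open>If two images shared an approximant, they would differ by at most K (\<epsilon>
    + \<epsilon>), and M times this is 1/2, less than the distance 1.\<close>
  define \<epsilon> where "\<epsilon> = 1 / (4 * K * M)"
  have \<epsilon>: "0 < \<epsilon>" using K(1) M(1) by (simp add: \<epsilon>_def)
  define x where "x S n = (indicator S n :: complex)" for S :: "nat set" and n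
  have xb: "cmod (x S n) \<le> 1" for S n by (simp add: x_def indicator_def)
  have xl: "x S \<in> linf" for S using xb by (auto simp: linf_def bounded_iff)
  define f where "f S = Tg g (J (x S))" for S
  have fR: "f S \<in> Tg g ` Hinf p \<alpha>" for S using J_Hinf[OF xl] by (simp add: f_def)
  have "\<forall>S. \<exists>d\<in>D. Hnorm p \<alpha> (\<lambda>z. f S z - d z) < \<epsilon>" using D(3)[OF fR \<epsilon>] by blast
  then obtain c where c: "\<And>S. c S \<in> D" "\<And>S. Hnorm p \<alpha> (\<lambda>z. f S z - c S z) < \<epsilon>" by metis
  \<comment> \<open>A small value of \<open>Hnorm\<close> is informative only for members of
    \<open>Hinf\<close>, so membership of the difference is established before it is used.\<close>
  have close: "Hle p \<alpha> \<epsilon> (\<lambda>z. f S z - c S z)" for S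
  proof -
    have "f S \<in> Hinf p \<alpha>" "c S \<in> Hinf p \<alpha>" using fR[of S] c(1)[of S] D(2) Tg_Hinf by auto
    from K(2)[OF Hle_Hnorm[OF this(1)] Hle_minus[OF p Hle_Hnorm[OF this(2)]]]
    have "(\<lambda>z. f S z - c S z) \<in> Hinf p \<alpha>" using Hinf_Hnorm_le_iff_Hle by auto
    then show ?thesis using c(2)[of S] Hinf_Hnorm_le_iff_Hle less_imp_le by blast
  qed
  have "inj c"
  proof (rule injI, rule ccontr)
    fix S S' assume eq: "c S = c S'" and ne: "S \<noteq> S'"
    define y where "y n = x S n + (-1) * x S' n" for n
    have ml: "(\<lambda>n. (-1) * x S' n) \<in> linf" using xb by (auto simp: linf_def bounded_iff)
    have yb: "cmod (y n) \<le> 1" for n by (simp add: y_def x_def indicator_def)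
    have yl: "y \<in> linf" using yb by (auto simp: linf_def bounded_iff)
    have Jy: "J y = (\<lambda>w. J (x S) w - J (x S') w)"
      unfolding y_def using J_add[OF linf_bound[OF xl] linf_bound[OF ml]] J_scale[OF linf_bound[OF xl], of "-1"] by simp
    have "Hle p \<alpha> (K * (\<epsilon> + \<epsilon>)) (\<lambda>w. (f S w - c S w) + - (f S' w - c S' w))"
      by (intro K(2) Hle_minus p close)
    then have "Hle p \<alpha> (K * (\<epsilon> + \<epsilon>)) (\<lambda>w. f S w - f S' w)" by (simp add: eq)
    moreover have "Tg g (J y) w = f S w - f S' w" if "w \<in> ball 0 1" for w
      unfolding Jy f_def using that by (intro Tg_diff g_holomorphic J_linf xl) auto
    ultimately have "Hle p \<alpha> (K * (\<epsilon> + \<epsilon>)) (Tg g (J y))"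
      using Hle_cong[of "Tg g (J y)" "\<lambda>w. f S w - f S' w" p \<alpha> "K * (\<epsilon> + \<epsilon>)"] by blast
    from M(2)[OF yl this] have "supnorm y \<le> 1/2" using K(1) M(1) by (simp add: \<epsilon>_def)
    moreover obtain n where "n \<in> S \<longleftrightarrow> n \<notin> S'" using ne by blast
    then have "cmod (y n) = 1" by (auto simp: y_def x_def indicator_def)
    ultimately show False using linf_bound[OF yl, of n] by simp
  qed
  moreover have "range c \<subseteq> D" using c(1) by blast
  ultimately have "countable (UNIV :: nat set set)" using D(1) by (metis countable_image_inj_eq countable_subset)
  then show False using uncountable_nat_sets by blast
qed

end

section \<open>Choice of the exponent k, the ratio and the points\<close>

theorem theorem5p5:
  fixes p :: ereal and \<alpha> :: real and g :: "complex \<Rightarrow> complex"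
  assumes "0 < p" and "0 < \<alpha>" and "g \<in> Bloch" and "g \<notin> little_Bloch"
  shows "fixes_copy c0 (H0 p \<alpha>) (Hnorm p \<alpha>) (Tg g) \<and>
         fixes_copy linf (Hinf p \<alpha>) (Hnorm p \<alpha>) (Tg g) \<and>
         \<not> separable_in (Tg g ` Hinf p \<alpha>) (Hnorm p \<alpha>)"
proof -
  have "\<exists>e>0. \<forall>\<delta><1. \<exists>z. \<delta> < cmod z \<and> cmod z < 1 \<and> e \<le> (1 - (cmod z)\<^sup>2) * cmod (deriv g z)"
  proof (rule ccontr)
    assume "\<not> ?thesis"
    then have "\<forall>e>0. \<exists>\<delta><1. \<forall>z. \<delta> < cmod z \<and> cmod z < 1 \<longrightarrow> (1 - (cmod z)\<^sup>2) * cmod (deriv g z) < e"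
      by (meson not_le)
    then show False using assms(3,4) by (simp add: little_Bloch_def)
  qed
  then obtain e where e: "0 < e" and big: "\<And>\<delta>. \<delta> < 1 \<Longrightarrow> \<exists>z. \<delta> < cmod z \<and> cmod z < 1 \<and> e \<le> (1 - (cmod z)\<^sup>2) * cmod (deriv g z)"
    by blast
  obtain k :: nat where "max (\<alpha> + pinv p) (2 * pinv p) < k" using reals_Archimedean2 by blast
  then have k: "\<alpha> + pinv p < k" "2 * pinv p \<le> k" by auto
  define \<beta> where "\<beta> = min \<alpha> (k - \<alpha> - pinv p)"
  have \<beta>: "0 < \<beta>" using k assms by (simp add: \<beta>_def)
  define m :: real where "m = 1 / 2 ^ (k + 3)"
  \<comment> \<open>Solves \<eta>^(\<beta>/2) = m = 2^-(k+3), the separation condition with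
    equality.\<close>
  define \<eta> where "\<eta> = m powr (2/\<beta>)"
  have "(2::real) ^ 0 < 2 ^ (k + 3)" by (intro power_strict_increasing) auto
  then have m: "0 < m" "m < 1" by (auto simp: m_def)
  have \<eta>: "0 < \<eta>" "\<eta> < 1" using m \<beta> powr_lt_one[OF m, of "2/\<beta>"] by (auto simp: \<eta>_def)
  have small: "\<eta> powr (\<beta>/2) \<le> 1 / 2 ^ (k + 3)"
    using m \<beta> by (simp add: \<eta>_def powr_powr flip: m_def)
  have "\<exists>z. \<forall>n. (cmod (z n) < 1 \<and> e \<le> (1 - (cmod (z n))\<^sup>2) * cmod (deriv g (z n))) \<and> 1 - cmod (z (Suc n)) \<le> \<eta> * (1 - cmod (z n))"
  proof (rule dependent_nat_choice)
    show "\<exists>z. cmod z < 1 \<and> e \<le> (1 - (cmod z)\<^sup>2) * cmod (deriv g z)" using big[of 0] by auto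
    fix w and n :: nat assume "cmod w < 1 \<and> e \<le> (1 - (cmod w)\<^sup>2) * cmod (deriv g w)"
    \<comment> \<open>Failure of the little Bloch condition supplies points with large derivative
      beyond every radius; beyond this one they satisfy the separation from w.\<close>
    then have "1 - \<eta> * (1 - cmod w) < 1" using \<eta> by simp
    from big[OF this] obtain u where "1 - \<eta> * (1 - cmod w) < cmod u" "cmod u < 1" "e \<le> (1 - (cmod u)\<^sup>2) * cmod (deriv g u)"
      by blast
    then show "\<exists>z. (cmod z < 1 \<and> e \<le> (1 - (cmod z)\<^sup>2) * cmod (deriv g z)) \<and> 1 - cmod z \<le> \<eta> * (1 - cmod w)"
      by (intro exI[of _ u]) auto
  qed
  then obtain z where z: "\<And>n. cmod (z n) < 1" "\<And>n. e \<le> (1 - (cmod (z n))\<^sup>2) * cmod (deriv g (z n))"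
    "\<And>n. 1 - cmod (z (Suc n)) \<le> \<eta> * (1 - cmod (z n))" by blast
  interpret Bloch_peak_family p \<alpha> k \<eta> z g e
    by unfold_locales (use assms k \<eta> z small e in \<open>auto simp: \<beta>_def\<close>)
  have "H0 p \<alpha> \<subseteq> Hinf p \<alpha>" by (auto simp: H0_def)
  then have "fixes_copy c0 (H0 p \<alpha>) (Hnorm p \<alpha>) (Tg g)"
    using J_c0 by (intro fixes_copy_J c0_subset_linf) auto
  moreover have "fixes_copy linf (Hinf p \<alpha>) (Hnorm p \<alpha>) (Tg g)"
    using J_Hinf Tg_Hinf by (intro fixes_copy_J) auto
  ultimately show ?thesis using not_separable_range by blast
qed

end
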